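(* For every measurable subset $\omega$ of $\Omega$, $$2C_{\infty}^{(W)}(\chi_{\omega})=C_{\infty}^{(S)}(\chi_{\omega})\leq J(\chi_{\omega}).$$ If moreover the domain $\Omega$ is such that every eigenvalue of $A$ is simple, then $$2\, C_\infty^{(W)}(\chi_\omega) = C_\infty^{(S)}(\chi_\omega) = \inf_{j\in\mathbb{N}^*}\int_\omega \phi_j(x)^2 \, dV_g = J(\chi_\omega)$$ for every measurable subset $\omega$ of $\Omega$.
   Context: Setting. $(M,g)$ is a smooth $n$-dimensional Riemannian manifold ($n\ge 1$), $\Omega$ is a bounded connected open subset of $M$ (the case $\partial\Omega=\emptyset$ is allowed; then $\Omega$ is a compact connected Riemannian manifold), and $V_g$ is the Riemannian volume measure; measurability is with respect to $V_g$. If $\partial\Omega\ne\emptyset$, one of the following boundary conditions $By=0$ on $\partial\Omega$ is fixed: Dirichlet ($By=y_{|\partial\Omega}$); Neumann ($By=\frac{\partial y}{\partial n}_{|\partial\Omega}$); mixed Dirichlet-Neumann ($By=\chi_{\Gamma_0}y_{|\partial\Omega}+\chi_{\Gamma_1}\frac{\partial y}{\partial n}_{|\partial\Omega}$ with $\partial\Omega=\Gamma_0\cup\Gamma_1$, $\Gamma_0\cap\Gamma_1=\emptyset$); Robin ($By=\frac{\partial y}{\partial n}_{|\partial\Omega}+\beta y_{|\partial\Omega}$, with $\beta\ge0$ bounded measurable on $\partial\Omega$, $\int_{\partial\Omega}\beta>0$). $X=\{y\in L^2(\Omega,\mathbb{C}) : \int_\Omega y\,dV_g=0\}$ in the Neumann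 and boundaryless cases, and $X=L^2(\Omega,\mathbb{C})$ otherwise. $A=-\triangle_g$ with domain $D(A)=\{y\in X : Ay\in X,\ By=0\}$ is a positive selfadjoint operator; $\|y\|_{D(A)}=\|Ay\|_{L^2}$ and $\|y\|_{D(A^{1/2})}=\|A^{1/2}y\|_{L^2}$. $(\phi_j)_{j\in\mathbb{N}^*}$ is a fixed orthonormal Hilbertian basis of $X$ of real-valued eigenfunctions of $A$, with $A\phi_j=\lambda_j^2\phi_j$, $\lambda_j>0$. $\chi_\omega$ is the characteristic function of $\omega$, and $J(\chi_\omega)=\inf_{j\in\mathbb{N}^*}\int_\omega\phi_j(x)^2\,dV_g$. Time asymptotic observability constants. For $(y^0,y^1)\in D(A^{1/2})\times X$, let $y$ be the solution of the wave equation $\partial_{tt}y=\triangle_g y$ (with $By=0$) such that $y(0)=y^0$, $\partial_ty(0)=y^1$. Then $$C_\infty^{(W)}(\chi_\omega)=\inf\left\{ \lim_{T\to+\infty} \frac{1}{T} \frac{ \int_0^T\int_\omega \vert \partial_{t} y(t,x) \vert ^2\, dV_g \, dt }{\Vert (y^0,y^1)\Vert^2_{D(A^{1/2})\times X}} \ \Big\vert\ (y^0,y^1)\in D(A^{1/2})\times X \setminus\{(0,0)\} \right\}.$$ For $y^0\in D(A)$, let $y$ be the solution of the Schr\"odinger equation $i\partial_ty=\triangle_gy$ (with $By=0$) such that $y(0)=y^0$. Then $$C_\infty^{(S)}(\chi_\omega)=\inf\left\{ \lim_{T\to+\infty} \frac{1}{T} \frac{ \int_0^T\int_\omega \vert \partial_{t}y(t,x)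 \vert ^2\, dV_g \, dt }{\Vert y^0\Vert^2_{D(A)}} \ \Big\vert\ y^0\in D(A) \setminus\{0\} \right\}.$$ *)

theory Defs
  imports "HOL-Analysis.Analysis"
begin

section \<open>Smooth functions on open subsets of Euclidean space\<close>

definition partial_deriv :: "'n::finite \<Rightarrow> (real^'n \<Rightarrow> 'b::real_normed_vector) \<Rightarrow> real^'n \<Rightarrow> 'b" where
  "partial_deriv i f x = frechet_derivative f (at x) (axis i 1)"

text \<open>Only meant for open \<open>S\<close>.\<close>

primrec Ck_on :: "nat \<Rightarrow> (real^'n::finite) set \<Rightarrow> (real^'n \<Rightarrow> 'b::real_normed_vector) \<Rightarrow> bool" where
  "Ck_on 0 S f \<longleftrightarrow> continuous_on S f"
| "Ck_on (Suc k) S f \<longleftrightarrow> f differentiable_on S \<and> (\<forall>i. Ck_on k S (partial_deriv i f))"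

definition C_infinity_on :: "(real^'n::finite) set \<Rightarrow> (real^'n \<Rightarrow> 'b::real_normed_vector) \<Rightarrow> bool" where
  "C_infinity_on S f \<longleftrightarrow> (\<forall>k. Ck_on k S f)"


section \<open>Riemannian manifolds\<close>

text \<open>The manifold is the whole type \<open>'m\<close>; its dimension is \<open>CARD('n)\<close>. A chart is a domain
  together with a coordinate map. The metric is given by its coefficient matrix
  \<open>(g_ij(p))\<close> in each chart.\<close>

type_synonym ('m, 'n) chart = "'m set \<times> ('m \<Rightarrow> real^'n)"

record ('m, 'n) riem =
  atlas :: "('m, 'n) chart set"
  metric :: "('m, 'n) chart \<Rightarrow> 'm \<Rightarrow> real^'n^'n"

definition chart_inv :: "('m, 'n::finite) chart \<Rightarrow> real^'n \<Rightarrow> 'm" where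
  "chart_inv c = inv_into (fst c) (snd c)"

definition is_chart :: "('m::topological_space, 'n::finite) chart \<Rightarrow> bool" where
  "is_chart c \<longleftrightarrow> open (fst c) \<and> open (snd c ` fst c) \<and>
     homeomorphism (fst c) (snd c ` fst c) (snd c) (chart_inv c)"

definition transition :: "('m, 'n::finite) chart \<Rightarrow> ('m, 'n) chart \<Rightarrow> real^'n \<Rightarrow> real^'n" where
  "transition c d = snd d \<circ> chart_inv c"

definition transition_jacobian :: "('m, 'n::finite) chart \<Rightarrow> ('m, 'n) chart \<Rightarrow> 'm \<Rightarrow> real^'n^'n" where
  "transition_jacobian c d p = matrix (frechet_derivative (transition c d) (at (snd c p)))"

definition smooth_riemannian_manifold ::
    "('m::{t2_space,second_countable_topology}, 'n::finite) riem \<Rightarrow> bool" where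
  "smooth_riemannian_manifold M \<longleftrightarrow>
     (\<forall>c\<in>atlas M. is_chart c) \<and>
     (\<Union>c\<in>atlas M. fst c) = UNIV \<and>
     (\<forall>c\<in>atlas M. \<forall>d\<in>atlas M. C_infinity_on (snd c ` (fst c \<inter> fst d)) (transition c d)) \<and>
     (\<forall>c\<in>atlas M. C_infinity_on (snd c ` fst c) (\<lambda>x. metric M c (chart_inv c x))) \<and>
     (\<forall>c\<in>atlas M. \<forall>p\<in>fst c. transpose (metric M c p) = metric M c p \<and>
        (\<forall>v. v \<noteq> 0 \<longrightarrow> v \<bullet> (metric M c p *v v) > 0)) \<and>
     (\<forall>c\<in>atlas M. \<forall>d\<in>atlas M. \<forall>p\<in>fst c \<inter> fst d.
        metric M c p =
          transpose (transition_jacobian c d p) ** metric M d p ** transition_jacobian c d p)"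

text \<open>An arbitrary chart around a point, used only in chart-independent expressions.\<close>

definition chart_at :: "('m, 'n::finite) riem \<Rightarrow> 'm \<Rightarrow> ('m, 'n) chart" where
  "chart_at M p = (SOME c. c \<in> atlas M \<and> p \<in> fst c)"

subsection \<open>Riemannian distance, volume and hypersurface measure\<close>

definition pw_C1_path :: "('m::topological_space, 'n::finite) riem \<Rightarrow> (real \<Rightarrow> 'm) \<Rightarrow> bool" where
  "pw_C1_path M \<gamma> \<longleftrightarrow> path \<gamma> \<and>
     (\<exists>S. finite S \<and>
       (\<forall>c\<in>atlas M. (snd c \<circ> \<gamma>) C1_differentiable_on ({t\<in>{0<..<1}. \<gamma> t \<in> fst c} - S)))"

definition riem_length :: "('m, 'n::finite) riem \<Rightarrow> (real \<Rightarrow> 'm) \<Rightarrow> ennreal" where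
  "riem_length M \<gamma> =
     (\<integral>\<^sup>+t\<in>{0<..<1}. (let c = chart_at M (\<gamma> t); v = vector_derivative (snd c \<circ> \<gamma>) (at t)
         in ennreal (sqrt (v \<bullet> (metric M c (\<gamma> t) *v v)))) \<partial>lborel)"

definition riem_dist :: "('m::topological_space, 'n::finite) riem \<Rightarrow> 'm \<Rightarrow> 'm \<Rightarrow> ennreal" where
  "riem_dist M p q =
     (INF \<gamma>\<in>{\<gamma>. pw_C1_path M \<gamma> \<and> pathstart \<gamma> = p \<and> pathfinish \<gamma> = q}. riem_length M \<gamma>)"

definition riem_bounded :: "('m::topological_space, 'n::finite) riem \<Rightarrow> 'm set \<Rightarrow> bool" where
  "riem_bounded M S \<longleftrightarrow> (\<exists>R<\<infinity>. \<forall>p\<in>S. \<forall>q\<in>S. riem_dist M p q \<le> R)"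

text \<open>The volume measure is the Borel measure with density \<open>sqrt (det g)\<close> with respect to
  Lebesgue measure in every chart.\<close>

definition riem_volume :: "('m::topological_space, 'n::finite) riem \<Rightarrow> 'm measure \<Rightarrow> bool" where
  "riem_volume M V \<longleftrightarrow> sets V = sets borel \<and>
     (\<forall>c\<in>atlas M. \<forall>B\<in>sets borel. B \<subseteq> fst c \<longrightarrow>
        emeasure V B =
          (\<integral>\<^sup>+x\<in>snd c ` B. ennreal (sqrt (det (metric M c (chart_inv c x)))) \<partial>lborel))"

definition riem_diam :: "('m::topological_space, 'n::finite) riem \<Rightarrow> 'm set \<Rightarrow> ennreal" where
  "riem_diam M S = (SUP p\<in>S. SUP q\<in>S. riem_dist M p q)"

definition hausdorff_pre ::
    "('m::topological_space, 'n::finite) riem \<Rightarrow> nat \<Rightarrow> ennreal \<Rightarrow> 'm set \<Rightarrow> ennreal" where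
  "hausdorff_pre M s \<delta> S =
     (INF C\<in>{C :: nat \<Rightarrow> 'm set. S \<subseteq> (\<Union>k. C k) \<and> (\<forall>k. riem_diam M (C k) \<le> \<delta>)}.
        \<Sum>k. if C k = {} then 0
             else ennreal (unit_ball_vol (real s) / 2 ^ s) * riem_diam M (C k) ^ s)"

definition hausdorff_outer :: "('m::topological_space, 'n::finite) riem \<Rightarrow> nat \<Rightarrow> 'm set \<Rightarrow> ennreal" where
  "hausdorff_outer M s S = (SUP \<delta>\<in>{0<..}. hausdorff_pre M s \<delta> S)"

text \<open>The hypersurface measure is the \<open>(n-1)\<close>-dimensional Hausdorff measure of the Riemannian
  distance.\<close>

definition surface_measure :: "('m::topological_space, 'n::finite) riem \<Rightarrow> 'm measure" where
  "surface_measure M = measure_of UNIV (sets borel) (hausdorff_outer M (CARD('n) - 1))"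

definition boundary_measure :: "('m::topological_space, 'n::finite) riem \<Rightarrow> 'm set \<Rightarrow> 'm measure" where
  "boundary_measure M \<Omega> = restrict_space (completion (surface_measure M)) (frontier \<Omega>)"

definition domain_measure :: "'m measure \<Rightarrow> 'm set \<Rightarrow> 'm measure" where
  "domain_measure V \<Omega> = restrict_space (completion V) \<Omega>"

definition riem_domain ::
    "('m::{t2_space,second_countable_topology}, 'n::finite) riem \<Rightarrow> 'm set \<Rightarrow> bool" where
  "riem_domain M \<Omega> \<longleftrightarrow> open \<Omega> \<and> connected \<Omega> \<and> riem_bounded M \<Omega> \<and>
     (frontier \<Omega> = {} \<longrightarrow> compact \<Omega>)"


section \<open>Square integrable functions\<close>

text \<open>Elements of \<open>L\<^sup>2\<close> are represented by functions; equality in \<open>L\<^sup>2\<close> is equality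
  almost everywhere. An operator is given by its graph, a set of pairs of representatives.\<close>

definition L2 :: "'a measure \<Rightarrow> ('a \<Rightarrow> complex) set" where
  "L2 \<mu> = {f \<in> borel_measurable \<mu>. integrable \<mu> (\<lambda>x. (cmod (f x))\<^sup>2)}"

definition l2_inner :: "'a measure \<Rightarrow> ('a \<Rightarrow> complex) \<Rightarrow> ('a \<Rightarrow> complex) \<Rightarrow> complex" where
  "l2_inner \<mu> f g = (LINT x|\<mu>. f x * cnj (g x))"

definition l2_norm :: "'a measure \<Rightarrow> ('a \<Rightarrow> complex) \<Rightarrow> real" where
  "l2_norm \<mu> f = sqrt (LINT x|\<mu>. (cmod (f x))\<^sup>2)"

definition L2_tendsto :: "'a measure \<Rightarrow> (nat \<Rightarrow> 'a \<Rightarrow> complex) \<Rightarrow> ('a \<Rightarrow> complex) \<Rightarrow> bool" where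
  "L2_tendsto \<mu> u f \<longleftrightarrow> (\<forall>k. u k \<in> L2 \<mu>) \<and> f \<in> L2 \<mu> \<and>
     (\<lambda>k. l2_norm \<mu> (\<lambda>x. u k x - f x)) \<longlonglongrightarrow> 0"

definition hilbert_subspace :: "'a measure \<Rightarrow> ('a \<Rightarrow> complex) set \<Rightarrow> bool" where
  "hilbert_subspace \<mu> X \<longleftrightarrow> X \<subseteq> L2 \<mu> \<and> (\<lambda>x. 0) \<in> X \<and>
     (\<forall>f\<in>X. \<forall>g\<in>X. \<forall>a b. (\<lambda>x. a * f x + b * g x) \<in> X) \<and>
     (\<forall>u. (\<forall>k. u k \<in> X) \<and>
        (\<forall>e>0. \<exists>N. \<forall>k\<ge>N. \<forall>l\<ge>N. l2_norm \<mu> (\<lambda>x. u k x - u l x) < e) \<longrightarrow>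
        (\<exists>f\<in>X. L2_tendsto \<mu> u f))"

definition positive_selfadjoint ::
    "'a measure \<Rightarrow> ('a \<Rightarrow> complex) set \<Rightarrow> (('a \<Rightarrow> complex) \<times> ('a \<Rightarrow> complex)) set \<Rightarrow> bool" where
  "positive_selfadjoint \<mu> X A \<longleftrightarrow> hilbert_subspace \<mu> X \<and> A \<subseteq> X \<times> X \<and>
     (\<forall>f\<in>X. \<exists>u. (\<forall>k. u k \<in> Domain A) \<and> L2_tendsto \<mu> u f) \<and>
     (\<forall>u\<in>X. \<forall>w\<in>X.
        (u, w) \<in> A \<longleftrightarrow> (\<forall>(v, z)\<in>A. l2_inner \<mu> u z = l2_inner \<mu> w v)) \<and>
     (\<forall>(u, w)\<in>A. Re (l2_inner \<mu> w u) \<ge> 0)"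

text \<open>For positive selfadjoint \<open>A\<close> exactly one positive selfadjoint \<open>S\<close> satisfies \<open>S\<^sup>2 = A\<close>, so
  the union below is that operator \<open>A\<^sup>1\<^sup>/\<^sup>2\<close>.\<close>

definition op_sqrt ::
    "'a measure \<Rightarrow> ('a \<Rightarrow> complex) set \<Rightarrow> (('a \<Rightarrow> complex) \<times> ('a \<Rightarrow> complex)) set
      \<Rightarrow> (('a \<Rightarrow> complex) \<times> ('a \<Rightarrow> complex)) set" where
  "op_sqrt \<mu> X A = \<Union>{S. positive_selfadjoint \<mu> X S \<and> S O S = A}"

definition hilbert_basis ::
    "'a measure \<Rightarrow> ('a \<Rightarrow> complex) set \<Rightarrow> (nat \<Rightarrow> 'a \<Rightarrow> complex) \<Rightarrow> bool" where
  "hilbert_basis \<mu> X e \<longleftrightarrow> (\<forall>j\<ge>1. e j \<in> X) \<and>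
     (\<forall>i\<ge>1. \<forall>j\<ge>1. l2_inner \<mu> (e i) (e j) = (if i = j then 1 else 0)) \<and>
     (\<forall>f\<in>X. L2_tendsto \<mu> (\<lambda>N x. \<Sum>j=1..N. l2_inner \<mu> f (e j) * e j x) f)"


section \<open>The Laplace-Beltrami operator\<close>

definition smooth_function ::
    "('m::topological_space, 'n::finite) riem \<Rightarrow> ('m \<Rightarrow> complex) \<Rightarrow> bool" where
  "smooth_function M f \<longleftrightarrow> (\<forall>c\<in>atlas M. C_infinity_on (snd c ` fst c) (f \<circ> chart_inv c))"

definition test_function ::
    "('m::topological_space, 'n::finite) riem \<Rightarrow> 'm set \<Rightarrow> ('m \<Rightarrow> complex) \<Rightarrow> bool" where
  "test_function M W f \<longleftrightarrow> smooth_function M f \<and>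
     compact (closure {p. f p \<noteq> 0}) \<and> closure {p. f p \<noteq> 0} \<subseteq> W"

text \<open>In coordinates, \<open>(det g)\<^sup>-\<^sup>1\<^sup>/\<^sup>2 \<Sum>\<^sub>i \<partial>\<^sub>i ((det g)\<^sup>1\<^sup>/\<^sup>2 \<Sum>\<^sub>j g\<^sup>i\<^sup>j \<partial>\<^sub>j f)\<close>.\<close>

definition laplace_beltrami ::
    "('m, 'n::finite) riem \<Rightarrow> ('m \<Rightarrow> complex) \<Rightarrow> 'm \<Rightarrow> complex" where
  "laplace_beltrami M f p =
     (let c = chart_at M p; G = (\<lambda>x. metric M c (chart_inv c x)) in
        (1 / sqrt (det (G (snd c p)))) *\<^sub>R
        (\<Sum>i\<in>UNIV. partial_deriv i
           (\<lambda>x. sqrt (det (G x)) *\<^sub>R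
              (\<Sum>j\<in>UNIV. (matrix_inv (G x) $ i $ j) *\<^sub>R partial_deriv j (f \<circ> chart_inv c) x))
           (snd c p)))"

text \<open>\<open>\<triangle>\<^sub>g y = h\<close> on \<open>\<Omega>\<close> in the sense of distributions.\<close>

definition weak_laplacian ::
    "('m::topological_space, 'n::finite) riem \<Rightarrow> 'm measure \<Rightarrow> 'm set
      \<Rightarrow> ('m \<Rightarrow> complex) \<Rightarrow> ('m \<Rightarrow> complex) \<Rightarrow> bool" where
  "weak_laplacian M V \<Omega> y h \<longleftrightarrow>
     (\<forall>\<psi>. test_function M \<Omega> \<psi> \<longrightarrow>
        (LINT p|domain_measure V \<Omega>. y p * laplace_beltrami M \<psi> p) =
        (LINT p|domain_measure V \<Omega>. h p * \<psi> p))"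

subsection \<open>Sobolev space and traces\<close>

text \<open>Complex covector fields are given by their components in every chart.\<close>

type_synonym ('m, 'n) covector_field = "('m, 'n) chart \<Rightarrow> 'm \<Rightarrow> complex^'n"

definition cometric ::
    "('m, 'n::finite) riem \<Rightarrow> ('m, 'n) covector_field \<Rightarrow> ('m, 'n) covector_field \<Rightarrow> 'm \<Rightarrow> complex" where
  "cometric M \<zeta> \<eta> p =
     (let c = chart_at M p in
        \<Sum>i\<in>UNIV. \<Sum>j\<in>UNIV. (matrix_inv (metric M c p) $ i $ j) *\<^sub>R (\<zeta> c p $ i * cnj (\<eta> c p $ j)))"

definition L2_covector ::
    "('m::topological_space, 'n::finite) riem \<Rightarrow> 'm measure \<Rightarrow> 'm set \<Rightarrow> ('m, 'n) covector_field \<Rightarrow> bool" where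
  "L2_covector M V \<Omega> \<zeta> \<longleftrightarrow>
     (\<forall>c\<in>atlas M. \<forall>d\<in>atlas M. \<forall>p\<in>fst c \<inter> fst d \<inter> \<Omega>. \<forall>i.
        \<zeta> c p $ i = (\<Sum>k\<in>UNIV. (transition_jacobian c d p $ k $ i) *\<^sub>R (\<zeta> d p $ k))) \<and>
     (\<forall>c\<in>atlas M. \<zeta> c \<in> borel_measurable (restrict_space (completion V) (fst c \<inter> \<Omega>))) \<and>
     integrable (domain_measure V \<Omega>) (\<lambda>p. cmod (cometric M \<zeta> \<zeta> p))"

definition differential :: "('m \<Rightarrow> complex) \<Rightarrow> ('m, 'n::finite) covector_field" where
  "differential f c p = (\<chi> i. partial_deriv i (f \<circ> chart_inv c) (snd c p))"

definition L2_covector_tendsto ::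
    "('m::topological_space, 'n::finite) riem \<Rightarrow> 'm measure \<Rightarrow> 'm set
      \<Rightarrow> (nat \<Rightarrow> ('m, 'n) covector_field) \<Rightarrow> ('m, 'n) covector_field \<Rightarrow> bool" where
  "L2_covector_tendsto M V \<Omega> \<xi> \<zeta> \<longleftrightarrow>
     (\<forall>k. L2_covector M V \<Omega> (\<xi> k)) \<and> L2_covector M V \<Omega> \<zeta> \<and>
     (\<lambda>k. LINT p|domain_measure V \<Omega>.
        cmod (cometric M (\<lambda>c q. \<xi> k c q - \<zeta> c q) (\<lambda>c q. \<xi> k c q - \<zeta> c q) p)) \<longlonglongrightarrow> 0"

text \<open>\<open>y\<close> belongs to the Sobolev space \<open>H\<^sup>1(\<Omega>)\<close> and \<open>\<zeta>\<close> is its weak differential.\<close>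

definition sobolev_differential ::
    "('m::topological_space, 'n::finite) riem \<Rightarrow> 'm measure \<Rightarrow> 'm set
      \<Rightarrow> ('m \<Rightarrow> complex) \<Rightarrow> ('m, 'n) covector_field \<Rightarrow> bool" where
  "sobolev_differential M V \<Omega> y \<zeta> \<longleftrightarrow>
     y \<in> L2 (domain_measure V \<Omega>) \<and> L2_covector M V \<Omega> \<zeta> \<and>
     (\<forall>c\<in>atlas M. \<forall>i. \<forall>\<psi> :: real^'n \<Rightarrow> complex.
        C_infinity_on UNIV \<psi> \<and> compact (closure {x. \<psi> x \<noteq> 0}) \<and>
        closure {x. \<psi> x \<noteq> 0} \<subseteq> snd c ` (fst c \<inter> \<Omega>) \<longrightarrow>
        (LINT x|lebesgue_on (snd c ` (fst c \<inter> \<Omega>)). y (chart_inv c x) * partial_deriv i \<psi> x) =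
        - (LINT x|lebesgue_on (snd c ` (fst c \<inter> \<Omega>)). \<zeta> c (chart_inv c x) $ i * \<psi> x))"

text \<open>\<open>y\<close>, with weak differential \<open>\<zeta>\<close>, lies in the \<open>H\<^sup>1\<close>-closure of the test functions on \<open>\<Omega>\<close>.\<close>

definition in_H10 ::
    "('m::topological_space, 'n::finite) riem \<Rightarrow> 'm measure \<Rightarrow> 'm set
      \<Rightarrow> ('m \<Rightarrow> complex) \<Rightarrow> ('m, 'n) covector_field \<Rightarrow> bool" where
  "in_H10 M V \<Omega> y \<zeta> \<longleftrightarrow> sobolev_differential M V \<Omega> y \<zeta> \<and>
     (\<exists>u. (\<forall>k. test_function M \<Omega> (u k)) \<and> L2_tendsto (domain_measure V \<Omega>) u y \<and>
        L2_covector_tendsto M V \<Omega> (\<lambda>k. differential (u k)) \<zeta>)"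

text \<open>The trace on the boundary is the continuous extension of the restriction of functions that
  are smooth up to the boundary.\<close>

definition has_trace ::
    "('m::topological_space, 'n::finite) riem \<Rightarrow> 'm measure \<Rightarrow> 'm set
      \<Rightarrow> ('m \<Rightarrow> complex) \<Rightarrow> ('m, 'n) covector_field \<Rightarrow> ('m \<Rightarrow> complex) \<Rightarrow> bool" where
  "has_trace M V \<Omega> y \<zeta> \<tau> \<longleftrightarrow> sobolev_differential M V \<Omega> y \<zeta> \<and>
     (\<exists>u. (\<forall>k. test_function M UNIV (u k)) \<and> L2_tendsto (domain_measure V \<Omega>) u y \<and>
        L2_covector_tendsto M V \<Omega> (\<lambda>k. differential (u k)) \<zeta> \<and>
        L2_tendsto (boundary_measure M \<Omega>) u \<tau>)"

subsection \<open>Boundary conditions\<close>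

datatype 'm bc = No_Boundary | Dirichlet | Neumann | Mixed "'m set" "'m set" | Robin "'m \<Rightarrow> real"

definition admissible_bc ::
    "('m::topological_space, 'n::finite) riem \<Rightarrow> 'm set \<Rightarrow> 'm bc \<Rightarrow> bool" where
  "admissible_bc M \<Omega> b \<longleftrightarrow> (frontier \<Omega> = {} \<longleftrightarrow> b = No_Boundary) \<and>
     (\<forall>\<Gamma>0 \<Gamma>1. b = Mixed \<Gamma>0 \<Gamma>1 \<longrightarrow> \<Gamma>0 \<union> \<Gamma>1 = frontier \<Omega> \<and> \<Gamma>0 \<inter> \<Gamma>1 = {}) \<and>
     (\<forall>\<beta>. b = Robin \<beta> \<longrightarrow>
        \<beta> \<in> borel_measurable (boundary_measure M \<Omega>) \<and>
        (\<forall>p\<in>frontier \<Omega>. 0 \<le> \<beta> p) \<and> (\<exists>C. \<forall>p\<in>frontier \<Omega>. \<beta> p \<le> C) \<and>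
        (\<integral>\<^sup>+p. ennreal (\<beta> p) \<partial>boundary_measure M \<Omega>) > 0)"

definition state_space :: "'m measure \<Rightarrow> 'm set \<Rightarrow> 'm bc \<Rightarrow> ('m \<Rightarrow> complex) set" where
  "state_space V \<Omega> b =
     (if b = Neumann \<or> b = No_Boundary
      then {y \<in> L2 (domain_measure V \<Omega>). integrable (domain_measure V \<Omega>) y \<and>
              (LINT p|domain_measure V \<Omega>. y p) = 0}
      else L2 (domain_measure V \<Omega>))"

text \<open>By Green's formula, for smooth \<open>y\<close> and \<open>v\<close> with differentials \<open>\<zeta>\<close> and \<open>\<eta>\<close> and for
  \<open>h = \<triangle>\<^sub>g y\<close>, the following is the integral of \<open>(\<partial>y/\<partial>n) cnj v\<close> over the boundary.\<close>

definition green_form ::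
    "('m, 'n::finite) riem \<Rightarrow> 'm measure \<Rightarrow> 'm set \<Rightarrow> ('m, 'n) covector_field \<Rightarrow> ('m \<Rightarrow> complex)
      \<Rightarrow> ('m, 'n) covector_field \<Rightarrow> ('m \<Rightarrow> complex) \<Rightarrow> complex" where
  "green_form M V \<Omega> \<zeta> h \<eta> v =
     (LINT p|domain_measure V \<Omega>. cometric M \<zeta> \<eta> p) + (LINT p|domain_measure V \<Omega>. h p * cnj (v p))"

text \<open>The condition \<open>B y = 0\<close>, where \<open>h = \<triangle>\<^sub>g y\<close>. Boundary values are traces (closure of test
  functions in the Dirichlet case) and normal derivatives are taken in the weak sense given by
  Green's formula.\<close>

fun boundary_condition ::
    "('m::topological_space, 'n::finite) riem \<Rightarrow> 'm measure \<Rightarrow> 'm set \<Rightarrow> 'm bc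
      \<Rightarrow> ('m \<Rightarrow> complex) \<Rightarrow> ('m \<Rightarrow> complex) \<Rightarrow> bool" where
  "boundary_condition M V \<Omega> No_Boundary y h \<longleftrightarrow> True"
| "boundary_condition M V \<Omega> Dirichlet y h \<longleftrightarrow> (\<exists>\<zeta>. in_H10 M V \<Omega> y \<zeta>)"
| "boundary_condition M V \<Omega> Neumann y h \<longleftrightarrow>
     (\<exists>\<zeta>. sobolev_differential M V \<Omega> y \<zeta> \<and>
        (\<forall>v \<eta>. sobolev_differential M V \<Omega> v \<eta> \<longrightarrow> green_form M V \<Omega> \<zeta> h \<eta> v = 0))"
| "boundary_condition M V \<Omega> (Mixed \<Gamma>0 \<Gamma>1) y h \<longleftrightarrow>
     (\<exists>\<zeta> \<tau>. has_trace M V \<Omega> y \<zeta> \<tau> \<and>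
        (AE p in boundary_measure M \<Omega>. p \<in> \<Gamma>0 \<longrightarrow> \<tau> p = 0) \<and>
        (\<forall>v \<eta> \<theta>. has_trace M V \<Omega> v \<eta> \<theta> \<and>
           (AE p in boundary_measure M \<Omega>. p \<in> \<Gamma>0 \<longrightarrow> \<theta> p = 0) \<longrightarrow>
           green_form M V \<Omega> \<zeta> h \<eta> v = 0))"
| "boundary_condition M V \<Omega> (Robin \<beta>) y h \<longleftrightarrow>
     (\<exists>\<zeta> \<tau>. has_trace M V \<Omega> y \<zeta> \<tau> \<and>
        (\<forall>v \<eta> \<theta>. has_trace M V \<Omega> v \<eta> \<theta> \<longrightarrow>
           green_form M V \<Omega> \<zeta> h \<eta> v =
             - (LINT p|boundary_measure M \<Omega>. complex_of_real (\<beta> p) * \<tau> p * cnj (\<theta> p))))"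

text \<open>The graph of \<open>A = -\<triangle>\<^sub>g\<close> with domain \<open>{y \<in> X. A y \<in> X, B y = 0}\<close>.\<close>

definition laplacian_op ::
    "('m::topological_space, 'n::finite) riem \<Rightarrow> 'm measure \<Rightarrow> 'm set \<Rightarrow> 'm bc
      \<Rightarrow> (('m \<Rightarrow> complex) \<times> ('m \<Rightarrow> complex)) set" where
  "laplacian_op M V \<Omega> b =
     {(y, f). y \<in> state_space V \<Omega> b \<and> f \<in> state_space V \<Omega> b \<and>
        weak_laplacian M V \<Omega> y (\<lambda>p. - f p) \<and> boundary_condition M V \<Omega> b y (\<lambda>p. - f p)}"

definition simple_eigenvalues ::
    "'a measure \<Rightarrow> (('a \<Rightarrow> complex) \<times> ('a \<Rightarrow> complex)) set \<Rightarrow> bool" where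
  "simple_eigenvalues \<mu> A \<longleftrightarrow>
     (\<forall>z u v. (u, \<lambda>x. z * u x) \<in> A \<and> (v, \<lambda>x. z * v x) \<in> A \<and> \<not> (AE x in \<mu>. u x = 0) \<longrightarrow>
        (\<exists>a. AE x in \<mu>. v x = a * u x))"


section \<open>Evolution equations and observability constants\<close>

definition L2_continuous :: "'a measure \<Rightarrow> (real \<Rightarrow> 'a \<Rightarrow> complex) \<Rightarrow> bool" where
  "L2_continuous \<mu> y \<longleftrightarrow> (\<forall>t\<ge>0. y t \<in> L2 \<mu>) \<and>
     (\<forall>t\<ge>0. ((\<lambda>s. l2_norm \<mu> (\<lambda>x. y s x - y t x)) \<longlongrightarrow> 0) (at t within {0..}))"

text \<open>\<open>y\<close> is continuously differentiable from \<open>[0,\<infinity>)\<close> to \<open>L\<^sup>2\<close> with time derivative \<open>dy\<close>.\<close>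

definition L2_C1 :: "'a measure \<Rightarrow> (real \<Rightarrow> 'a \<Rightarrow> complex) \<Rightarrow> (real \<Rightarrow> 'a \<Rightarrow> complex) \<Rightarrow> bool" where
  "L2_C1 \<mu> y dy \<longleftrightarrow> L2_continuous \<mu> y \<and> L2_continuous \<mu> dy \<and>
     (\<forall>t\<ge>0. ((\<lambda>s. l2_norm \<mu> (\<lambda>x. (y s x - y t x) /\<^sub>R (s - t) - dy t x)) \<longlongrightarrow> 0) (at t within {0..}))"

text \<open>Solution \<open>y \<in> C([0,\<infinity>); D(A\<^sup>1\<^sup>/\<^sup>2)) \<inter> C\<^sup>1([0,\<infinity>); X)\<close> of \<open>\<partial>\<^sub>t\<^sub>t y = -A y\<close> with time
  derivative \<open>dy\<close>, where the equation is tested against the elements of \<open>D(A)\<close>.\<close>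

definition wave_solution ::
    "'a measure \<Rightarrow> ('a \<Rightarrow> complex) set \<Rightarrow> (('a \<Rightarrow> complex) \<times> ('a \<Rightarrow> complex)) set
      \<Rightarrow> ('a \<Rightarrow> complex) \<Rightarrow> ('a \<Rightarrow> complex) \<Rightarrow> (real \<Rightarrow> 'a \<Rightarrow> complex) \<Rightarrow> (real \<Rightarrow> 'a \<Rightarrow> complex) \<Rightarrow> bool" where
  "wave_solution \<mu> X A y0 y1 y dy \<longleftrightarrow>
     (\<exists>z. (\<forall>t\<ge>0. (y t, z t) \<in> op_sqrt \<mu> X A) \<and> L2_continuous \<mu> z) \<and>
     L2_C1 \<mu> y dy \<and> (\<forall>t\<ge>0. dy t \<in> X) \<and>
     (\<forall>(v, w)\<in>A. \<forall>t\<ge>0.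
        ((\<lambda>s. l2_inner \<mu> (dy s) v) has_vector_derivative - l2_inner \<mu> (y t) w) (at t within {0..})) \<and>
     (AE x in \<mu>. y 0 x = y0 x) \<and> (AE x in \<mu>. dy 0 x = y1 x)"

text \<open>Solution \<open>y \<in> C([0,\<infinity>); D(A)) \<inter> C\<^sup>1([0,\<infinity>); X)\<close> of \<open>\<i> \<partial>\<^sub>t y = -A y\<close> with time derivative \<open>dy\<close>.\<close>

definition schroedinger_solution ::
    "'a measure \<Rightarrow> ('a \<Rightarrow> complex) set \<Rightarrow> (('a \<Rightarrow> complex) \<times> ('a \<Rightarrow> complex)) set
      \<Rightarrow> ('a \<Rightarrow> complex) \<Rightarrow> (real \<Rightarrow> 'a \<Rightarrow> complex) \<Rightarrow> (real \<Rightarrow> 'a \<Rightarrow> complex) \<Rightarrow> bool" where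
  "schroedinger_solution \<mu> X A y0 y dy \<longleftrightarrow>
     (\<exists>f. (\<forall>t\<ge>0. (y t, f t) \<in> A) \<and> L2_continuous \<mu> f \<and>
        (\<forall>t\<ge>0. AE x in \<mu>. \<i> * dy t x = - f t x)) \<and>
     L2_C1 \<mu> y dy \<and> (\<forall>t\<ge>0. dy t \<in> X) \<and> (AE x in \<mu>. y 0 x = y0 x)"

text \<open>In the next two definitions \<open>z = A\<^sup>1\<^sup>/\<^sup>2 y0\<close> and \<open>f = A y0\<close>, respectively.\<close>

definition C_wave ::
    "'a measure \<Rightarrow> ('a \<Rightarrow> complex) set \<Rightarrow> (('a \<Rightarrow> complex) \<times> ('a \<Rightarrow> complex)) set \<Rightarrow> 'a set \<Rightarrow> real" where
  "C_wave \<mu> X A \<omega> = Inf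
     {Lim at_top (\<lambda>T. 1 / T *
        ((LINT t:{0..T}|lborel. (LINT x:\<omega>|\<mu>. (cmod (dy t x))\<^sup>2)) /
         ((l2_norm \<mu> z)\<^sup>2 + (l2_norm \<mu> y1)\<^sup>2))) | y0 y1 z y dy.
      (y0, z) \<in> op_sqrt \<mu> X A \<and> y1 \<in> X \<and>
      \<not> ((AE x in \<mu>. y0 x = 0) \<and> (AE x in \<mu>. y1 x = 0)) \<and>
      wave_solution \<mu> X A y0 y1 y dy}"

definition C_schroedinger ::
    "'a measure \<Rightarrow> ('a \<Rightarrow> complex) set \<Rightarrow> (('a \<Rightarrow> complex) \<times> ('a \<Rightarrow> complex)) set \<Rightarrow> 'a set \<Rightarrow> real" where
  "C_schroedinger \<mu> X A \<omega> = Inf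
     {Lim at_top (\<lambda>T. 1 / T *
        ((LINT t:{0..T}|lborel. (LINT x:\<omega>|\<mu>. (cmod (dy t x))\<^sup>2)) / (l2_norm \<mu> f)\<^sup>2)) | y0 f y dy.
      (y0, f) \<in> A \<and> \<not> (AE x in \<mu>. y0 x = 0) \<and>
      schroedinger_solution \<mu> X A y0 y dy}"

definition J_functional :: "'a measure \<Rightarrow> (nat \<Rightarrow> 'a \<Rightarrow> real) \<Rightarrow> 'a set \<Rightarrow> real" where
  "J_functional \<mu> \<phi> \<omega> = (INF j\<in>{1..}. LINT x:\<omega>|\<mu>. (\<phi> j x)\<^sup>2)"

end

theory Submission
  imports Defs
begin

text \<open>
  In the eigenbasis both equations decouple: the time derivative of a solution has the coordinates
  \<open>a\<^sub>j exp (i \<nu>\<^sub>j t) + b\<^sub>j exp (- i \<nu>\<^sub>j t)\<close>, where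
  \<open>\<nu>\<^sub>j = \<lambda>\<^sub>j\<^sup>2\<close> and \<open>b = 0\<close> for the Schroedinger equation, and \<open>\<nu>\<^sub>j = \<lambda>\<^sub>j\<close> for the wave equation
  (\<open>schroedinger_oscillation\<close>, \<open>wave_oscillation\<close>). In the time mean of its energy over \<open>\<omega>\<close>, the
  product of the coordinates \<open>i\<close> and \<open>j\<close> averages out unless \<open>\<nu>\<^sub>i = \<nu>\<^sub>j\<close>, and the positive frequencies
  do not interact with the negative ones. Hence the mean is \<open>Q(a) + Q(b)\<close>, where
  \<open>Q(c) = \<Sum> c\<^sub>i cnj c\<^sub>j \<integral>\<^sub>\<omega> \<phi>\<^sub>i \<phi>\<^sub>j\<close>, summed over the pairs with \<open>\<lambda>\<^sub>i = \<lambda>\<^sub>j\<close>: the form \<open>Q\<close> is the same for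
  both equations, since \<open>\<lambda>\<^sub>i\<^sup>2 = \<lambda>\<^sub>j\<^sup>2\<close> and \<open>\<lambda>\<^sub>i = \<lambda>\<^sub>j\<close> are equivalent for positive \<open>\<lambda>\<close>.

  The energy of the initial data is \<open>\<parallel>a\<parallel>\<^sup>2\<close> for the Schroedinger equation and \<open>2 (\<parallel>a\<parallel>\<^sup>2 + \<parallel>b\<parallel>\<^sup>2)\<close> for
  the wave equation. So \<open>C_schroedinger\<close> and \<open>2 * C_wave\<close> are both the infimum of the Rayleigh quotients
  \<open>Q(c) / \<parallel>c\<parallel>\<^sup>2\<close> (\<open>C_schroedinger_eq_rayleigh\<close>, \<open>C_wave_eq_half_rayleigh\<close>). The unit vectors have
  the quotients \<open>\<integral>\<^sub>\<omega> \<phi>\<^sub>j\<^sup>2\<close>, so this infimum is at most \<open>J\<close>; when the eigenvalues are simple, \<open>Q\<close> is the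
  diagonal form \<open>\<Sum> \<bar>c\<^sub>j\<bar>\<^sup>2 \<integral>\<^sub>\<omega> \<phi>\<^sub>j\<^sup>2\<close>, and the infimum is \<open>J\<close>.

  Convergence is handled by truncation. Rayleigh quotients are taken over finitely many coordinates.
  Finite data give explicit solutions, which realise every Rayleigh quotient. For arbitrary data the
  part of a solution beyond the first \<open>N\<close> coordinates is small in \<open>L\<^sup>2\<close>, uniformly in time, so that
  the mean exists and is the limit of the means of the truncations (\<open>time_mean_local_energy\<close>); the lower
  bound by the infimum passes to this limit.
\<close>

section \<open>Square integrable functions\<close>

lemma L2_measurable: "f \<in> L2 \<mu> \<Longrightarrow> f \<in> borel_measurable \<mu>"
  by (simp add: L2_def)

lemma L2_integrable: "f \<in> L2 \<mu> \<Longrightarrow> integrable \<mu> (\<lambda>x. (cmod (f x))\<^sup>2)"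
  by (simp add: L2_def)

lemma L2_prod_abs_integrable:
  assumes "f \<in> L2 \<mu>" "g \<in> L2 \<mu>"
  shows "integrable \<mu> (\<lambda>x. cmod (f x) * cmod (g x))"
proof (rule Bochner_Integration.integrable_bound)
  show "integrable \<mu> (\<lambda>x. (cmod (f x))\<^sup>2 + (cmod (g x))\<^sup>2)"
    using assms by (simp add: L2_def)
  show "(\<lambda>x. cmod (f x) * cmod (g x)) \<in> borel_measurable \<mu>"
    using assms[THEN L2_measurable] by measurable
  have "cmod (f x) * cmod (g x) \<le> (cmod (f x))\<^sup>2 + (cmod (g x))\<^sup>2" for x
    using sum_squares_bound[of "cmod (f x)" "cmod (g x)"]
      mult_nonneg_nonneg[OF norm_ge_zero norm_ge_zero, of "f x" "g x"] by linarith
  then show "AE x in \<mu>. norm (cmod (f x) * cmod (g x)) \<le> norm ((cmod (f x))\<^sup>2 + (cmod (g x))\<^sup>2)"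
    by simp
qed

lemma borel_measurable_cnj [measurable]: "cnj \<in> borel_measurable borel"
  by (intro borel_measurable_continuous_onI continuous_intros)

lemma L2_prod_integrable:
  assumes "f \<in> L2 \<mu>" "g \<in> L2 \<mu>"
  shows "integrable \<mu> (\<lambda>x. f x * cnj (g x))"
proof (rule Bochner_Integration.integrable_bound[OF L2_prod_abs_integrable[OF assms]])
  show "(\<lambda>x. f x * cnj (g x)) \<in> borel_measurable \<mu>"
    using assms[THEN L2_measurable] by measurable
qed (simp add: norm_mult)

lemma L2_lin:
  assumes "f \<in> L2 \<mu>" "g \<in> L2 \<mu>"
  shows "(\<lambda>x. a * f x + b * g x) \<in> L2 \<mu>"
proof -
  have "integrable \<mu> (\<lambda>x. (cmod (a * f x + b * g x))\<^sup>2)"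
  proof (rule Bochner_Integration.integrable_bound)
    show "integrable \<mu> (\<lambda>x. 2 * (cmod a)\<^sup>2 * (cmod (f x))\<^sup>2 + 2 * (cmod b)\<^sup>2 * (cmod (g x))\<^sup>2)"
      using assms by (simp add: L2_def)
    show "(\<lambda>x. (cmod (a * f x + b * g x))\<^sup>2) \<in> borel_measurable \<mu>"
      using assms[THEN L2_measurable] by measurable
    have "(cmod (a * f x + b * g x))\<^sup>2
        \<le> 2 * (cmod a)\<^sup>2 * (cmod (f x))\<^sup>2 + 2 * (cmod b)\<^sup>2 * (cmod (g x))\<^sup>2" for x
    proof -
      have "(cmod (a * f x + b * g x))\<^sup>2 \<le> (cmod (a * f x) + cmod (b * g x))\<^sup>2"
        by (intro power_mono norm_triangle_ineq) simp
      also have "\<dots> \<le> 2 * (cmod (a * f x))\<^sup>2 + 2 * (cmod (b * g x))\<^sup>2"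
        using sum_squares_bound[of "cmod (a * f x)" "cmod (b * g x)"] by (simp add: power2_sum)
      finally show ?thesis by (simp add: norm_mult power_mult_distrib)
    qed
    then show "AE x in \<mu>. norm ((cmod (a * f x + b * g x))\<^sup>2)
        \<le> norm (2 * (cmod a)\<^sup>2 * (cmod (f x))\<^sup>2 + 2 * (cmod b)\<^sup>2 * (cmod (g x))\<^sup>2)"
      by (simp add: order.trans[OF _ abs_ge_self])
  qed
  moreover have "(\<lambda>x. a * f x + b * g x) \<in> borel_measurable \<mu>"
    using assms[THEN L2_measurable] by measurable
  ultimately show ?thesis by (simp add: L2_def)
qed

lemma L2_diff: "f \<in> L2 \<mu> \<Longrightarrow> g \<in> L2 \<mu> \<Longrightarrow> (\<lambda>x. f x - g x) \<in> L2 \<mu>"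
  using L2_lin[of f \<mu> g 1 "-1"] by simp

lemma L2_indicator:
  assumes "f \<in> L2 \<mu>" "\<omega> \<in> sets \<mu>"
  shows "(\<lambda>x. indicator \<omega> x * f x) \<in> L2 \<mu>"
proof -
  have m: "(\<lambda>x. indicator \<omega> x * f x) \<in> borel_measurable \<mu>"
    using assms(2) L2_measurable[OF assms(1)] by measurable
  have "integrable \<mu> (\<lambda>x. (cmod (indicator \<omega> x * f x))\<^sup>2)"
    by (rule Bochner_Integration.integrable_bound[OF L2_integrable[OF assms(1)]])
      (use m in \<open>auto simp: indicator_def\<close>)
  with m show ?thesis by (simp add: L2_def)
qed

lemma l2_inner_lin_left:
  assumes "f \<in> L2 \<mu>" "g \<in> L2 \<mu>" "h \<in> L2 \<mu>"
  shows "l2_inner \<mu> (\<lambda>x. a * f x + b * g x) h = a * l2_inner \<mu> f h + b * l2_inner \<mu> g h"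
proof -
  have "l2_inner \<mu> (\<lambda>x. a * f x + b * g x) h
      = (LINT x|\<mu>. a * (f x * cnj (h x)) + b * (g x * cnj (h x)))"
    by (simp add: l2_inner_def algebra_simps)
  also have "\<dots> = a * l2_inner \<mu> f h + b * l2_inner \<mu> g h"
    using assms by (simp add: l2_inner_def L2_prod_integrable)
  finally show ?thesis .
qed

lemma l2_inner_cnj: "l2_inner \<mu> g f = cnj (l2_inner \<mu> f g)"
  by (simp add: l2_inner_def mult.commute flip: Bochner_Integration.integral_cnj)

lemma l2_inner_mult_left: "l2_inner \<mu> (\<lambda>x. a * f x) g = a * l2_inner \<mu> f g"
proof -
  have "l2_inner \<mu> (\<lambda>x. a * f x) g = (LINT x|\<mu>. a * (f x * cnj (g x)))"
    by (simp add: l2_inner_def mult.assoc)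
  also have "\<dots> = a * l2_inner \<mu> f g" unfolding l2_inner_def by (rule integral_mult_right_zero)
  finally show ?thesis .
qed

lemma l2_inner_mult_right: "l2_inner \<mu> f (\<lambda>x. a * g x) = cnj a * l2_inner \<mu> f g"
  using l2_inner_cnj[of \<mu> f "\<lambda>x. a * g x"] l2_inner_cnj[of \<mu> f g]
  by (simp add: l2_inner_mult_left)

lemma l2_norm_nonneg [simp]: "0 \<le> l2_norm \<mu> f"
  by (simp add: l2_norm_def)

lemma l2_norm_sq: "(l2_norm \<mu> f)\<^sup>2 = (LINT x|\<mu>. (cmod (f x))\<^sup>2)"
  by (simp add: l2_norm_def)

lemma l2_inner_self: "l2_inner \<mu> f f = complex_of_real ((l2_norm \<mu> f)\<^sup>2)"
  by (simp add: l2_inner_def l2_norm_sq complex_norm_square[symmetric] integral_complex_of_real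
      del: of_real_power)

lemma l2_norm_eq_0_iff:
  assumes "f \<in> L2 \<mu>"
  shows "l2_norm \<mu> f = 0 \<longleftrightarrow> (AE x in \<mu>. f x = 0)"
  using integral_nonneg_eq_0_iff_AE[OF L2_integrable[OF assms]] by (simp add: l2_norm_def)

lemma l2_norm_mult: "l2_norm \<mu> (\<lambda>x. a * f x) = cmod a * l2_norm \<mu> f"
  by (simp add: l2_norm_def norm_mult power_mult_distrib real_sqrt_mult)

lemma l2_inner_cong_AE:
  assumes "f \<in> L2 \<mu>" "g \<in> L2 \<mu>" "h \<in> L2 \<mu>" "AE x in \<mu>. f x = g x"
  shows "l2_inner \<mu> f h = l2_inner \<mu> g h"
  unfolding l2_inner_def
proof (rule integral_cong_AE)
  show "(\<lambda>x. f x * cnj (h x)) \<in> borel_measurable \<mu>"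
    using assms(1,3)[THEN L2_measurable] by measurable
  show "(\<lambda>x. g x * cnj (h x)) \<in> borel_measurable \<mu>"
    using assms(2,3)[THEN L2_measurable] by measurable
qed (use assms(4) in auto)

text \<open>Young's inequality, after both functions have been normalised, gives the Cauchy-Schwarz
  inequality.\<close>

lemma L2_Cauchy_Schwarz_abs:
  assumes "f \<in> L2 \<mu>" "g \<in> L2 \<mu>"
  shows "(LINT x|\<mu>. cmod (f x) * cmod (g x)) \<le> l2_norm \<mu> f * l2_norm \<mu> g"
proof (cases "l2_norm \<mu> f = 0 \<or> l2_norm \<mu> g = 0")
  case True
  then have "AE x in \<mu>. cmod (f x) * cmod (g x) = 0"
    using assms by (auto simp: l2_norm_eq_0_iff)
  then have "(LINT x|\<mu>. cmod (f x) * cmod (g x)) = 0"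
    by (rule integral_eq_zero_AE)
  then show ?thesis by simp
next
  case False
  define F G where "F = l2_norm \<mu> f" and "G = l2_norm \<mu> g"
  have pos: "F > 0" "G > 0"
    using False unfolding F_def G_def by (metis l2_norm_nonneg less_eq_real_def)+
  have "(LINT x|\<mu>. cmod (f x) * cmod (g x))
      \<le> (LINT x|\<mu>. (G / (2 * F)) * (cmod (f x))\<^sup>2 + (F / (2 * G)) * (cmod (g x))\<^sup>2)"
  proof (rule integral_mono)
    show "integrable \<mu> (\<lambda>x. cmod (f x) * cmod (g x))"
      by (rule L2_prod_abs_integrable[OF assms])
    show "integrable \<mu> (\<lambda>x. (G / (2 * F)) * (cmod (f x))\<^sup>2 + (F / (2 * G)) * (cmod (g x))\<^sup>2)"
      using assms[THEN L2_integrable] by simp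
    show "cmod (f x) * cmod (g x) \<le> (G / (2 * F)) * (cmod (f x))\<^sup>2 + (F / (2 * G)) * (cmod (g x))\<^sup>2"
      for x
    proof -
      have "0 \<le> (G * cmod (f x) - F * cmod (g x))\<^sup>2 / (2 * F * G)" using pos by simp
      also have "\<dots> = (G / (2 * F)) * (cmod (f x))\<^sup>2 + (F / (2 * G)) * (cmod (g x))\<^sup>2
          - cmod (f x) * cmod (g x)"
        using pos by (simp add: field_simps power2_eq_square)
      finally show ?thesis by simp
    qed
  qed
  also have "\<dots> = (G / (2 * F)) * F\<^sup>2 + (F / (2 * G)) * G\<^sup>2"
    using assms[THEN L2_integrable] by (simp add: F_def G_def l2_norm_sq)
  also have "\<dots> = F * G" using pos by (simp add: field_simps power2_eq_square)
  finally show ?thesis by (simp add: F_def G_def)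
qed

lemma L2_Cauchy_Schwarz:
  assumes "f \<in> L2 \<mu>" "g \<in> L2 \<mu>"
  shows "cmod (l2_inner \<mu> f g) \<le> l2_norm \<mu> f * l2_norm \<mu> g"
proof -
  have "cmod (l2_inner \<mu> f g) \<le> (LINT x|\<mu>. cmod (f x * cnj (g x)))"
    unfolding l2_inner_def by (rule integral_norm_bound)
  also have "\<dots> \<le> l2_norm \<mu> f * l2_norm \<mu> g"
    using L2_Cauchy_Schwarz_abs[OF assms] by (simp add: norm_mult)
  finally show ?thesis .
qed

lemma local_energy_eq_inner:
  "complex_of_real (LINT x:\<omega>|\<mu>. (cmod (f x))\<^sup>2) = l2_inner \<mu> (\<lambda>x. indicator \<omega> x * f x) f"
proof -
  have "complex_of_real (indicator \<omega> x *\<^sub>R (cmod (f x))\<^sup>2) = indicator \<omega> x * f x * cnj (f x)" for x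
  proof (cases "x \<in> \<omega>")
    case True
    then show ?thesis using complex_norm_square[of "f x"] by simp
  qed simp
  then show ?thesis
    unfolding set_lebesgue_integral_def l2_inner_def integral_complex_of_real[symmetric]
    by (simp only:)
qed

lemma local_energy_nonneg: "0 \<le> (LINT x:\<omega>|\<mu>. (cmod (f x))\<^sup>2)"
  by (simp add: set_lebesgue_integral_def)

text \<open>The local energy is continuous along \<open>L\<^sup>2\<close> convergence, with a modulus that depends only on
  norms. This makes it continuous in time along a solution, and stable under truncation.\<close>

lemma local_energy_diff_le:
  assumes f: "f \<in> L2 \<mu>" and g: "g \<in> L2 \<mu>" and \<omega>: "\<omega> \<in> sets \<mu>"
  shows "\<bar>(LINT x:\<omega>|\<mu>. (cmod (f x))\<^sup>2) - (LINT x:\<omega>|\<mu>. (cmod (g x))\<^sup>2)\<bar>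
      \<le> l2_norm \<mu> (\<lambda>x. f x - g x) * (l2_norm \<mu> f + l2_norm \<mu> g)"
proof -
  have si: "set_integrable \<mu> \<omega> (\<lambda>x. (cmod (h x))\<^sup>2)" if "h \<in> L2 \<mu>" for h
    unfolding set_integrable_def
    using integrable_mult_indicator[OF \<omega> L2_integrable[OF that]] .
  have d: "(\<lambda>x. f x - g x) \<in> L2 \<mu>" by (rule L2_diff[OF f g])
  have "\<bar>(LINT x:\<omega>|\<mu>. (cmod (f x))\<^sup>2) - (LINT x:\<omega>|\<mu>. (cmod (g x))\<^sup>2)\<bar>
      = \<bar>LINT x:\<omega>|\<mu>. ((cmod (f x))\<^sup>2 - (cmod (g x))\<^sup>2)\<bar>"
    using si[OF f] si[OF g] by (simp add: set_integral_diff)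
  also have "\<dots> \<le> (LINT x|\<mu>. \<bar>indicator \<omega> x * ((cmod (f x))\<^sup>2 - (cmod (g x))\<^sup>2)\<bar>)"
    unfolding set_lebesgue_integral_def real_scaleR_def by (rule integral_abs_bound)
  also have "\<dots> \<le> (LINT x|\<mu>. cmod (f x - g x) * cmod (f x) + cmod (f x - g x) * cmod (g x))"
  proof (rule integral_mono)
    show "integrable \<mu> (\<lambda>x. \<bar>indicator \<omega> x * ((cmod (f x))\<^sup>2 - (cmod (g x))\<^sup>2)\<bar>)"
      using set_integral_diff(1)[OF si[OF f] si[OF g]] by (simp add: set_integrable_def)
    show "integrable \<mu> (\<lambda>x. cmod (f x - g x) * cmod (f x) + cmod (f x - g x) * cmod (g x))"
      by (intro Bochner_Integration.integrable_add L2_prod_abs_integrable d f g)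
    fix x
    have "\<bar>indicator \<omega> x * ((cmod (f x))\<^sup>2 - (cmod (g x))\<^sup>2)\<bar> \<le> \<bar>(cmod (f x))\<^sup>2 - (cmod (g x))\<^sup>2\<bar>"
      by (simp add: indicator_def)
    also have "\<dots> = \<bar>cmod (f x) - cmod (g x)\<bar> * (cmod (f x) + cmod (g x))"
      by (simp add: power2_eq_square square_diff_square_factored abs_mult mult.commute)
    also have "\<dots> \<le> cmod (f x - g x) * (cmod (f x) + cmod (g x))"
      by (intro mult_right_mono norm_triangle_ineq3) simp
    finally show "\<bar>indicator \<omega> x * ((cmod (f x))\<^sup>2 - (cmod (g x))\<^sup>2)\<bar>
        \<le> cmod (f x - g x) * cmod (f x) + cmod (f x - g x) * cmod (g x)"
      by (simp add: distrib_left)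
  qed
  also have "\<dots> \<le> l2_norm \<mu> (\<lambda>x. f x - g x) * l2_norm \<mu> f + l2_norm \<mu> (\<lambda>x. f x - g x) * l2_norm \<mu> g"
    using L2_Cauchy_Schwarz_abs[OF d f] L2_Cauchy_Schwarz_abs[OF d g]
    by (simp add: L2_prod_abs_integrable d f g)
  finally show ?thesis by (simp add: distrib_left)
qed

text \<open>The factors \<open>1/2\<close> and \<open>\<plusminus>\<i>/2\<close> are those that split a wave with initial velocity \<open>f\<close> and
  \<open>A\<^sup>1\<^sup>/\<^sup>2 y0 = g\<close> into its parts of positive and of negative frequency.\<close>

lemma l2_norm_parallelogram:
  assumes "f \<in> L2 \<mu>" "g \<in> L2 \<mu>"
  shows "(l2_norm \<mu> (\<lambda>x. 1 / 2 * f x + \<i> / 2 * g x))\<^sup>2 + (l2_norm \<mu> (\<lambda>x. 1 / 2 * f x + (- \<i> / 2) * g x))\<^sup>2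
    = ((l2_norm \<mu> f)\<^sup>2 + (l2_norm \<mu> g)\<^sup>2) / 2"
proof -
  have eq: "(cmod (1 / 2 * p + \<i> / 2 * q))\<^sup>2 + (cmod (1 / 2 * p + (- \<i> / 2) * q))\<^sup>2
      = (1 / 2) * (cmod p)\<^sup>2 + (1 / 2) * (cmod q)\<^sup>2" for p q
    unfolding cmod_power2 by (simp add: field_simps power2_eq_square)
  have "(l2_norm \<mu> (\<lambda>x. 1 / 2 * f x + \<i> / 2 * g x))\<^sup>2 + (l2_norm \<mu> (\<lambda>x. 1 / 2 * f x + (- \<i> / 2) * g x))\<^sup>2
      = (LINT x|\<mu>. (cmod (1 / 2 * f x + \<i> / 2 * g x))\<^sup>2 + (cmod (1 / 2 * f x + (- \<i> / 2) * g x))\<^sup>2)"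
    unfolding l2_norm_sq
    by (intro Bochner_Integration.integral_add[symmetric] L2_integrable L2_lin assms)
  also have "\<dots> = (1 / 2) * (l2_norm \<mu> f)\<^sup>2 + (1 / 2) * (l2_norm \<mu> g)\<^sup>2"
    unfolding eq l2_norm_sq using assms[THEN L2_integrable] by simp
  finally show ?thesis by simp
qed

section \<open>Coordinates in a Hilbert basis\<close>

locale hilbert_space_with_basis =
  fixes \<mu> :: "'a measure" and X :: "('a \<Rightarrow> complex) set" and \<phi> :: "nat \<Rightarrow> 'a \<Rightarrow> real"
  assumes subspace: "hilbert_subspace \<mu> X"
    and basis: "hilbert_basis \<mu> X (\<lambda>j x. complex_of_real (\<phi> j x))"
begin

abbreviation e :: "nat \<Rightarrow> 'a \<Rightarrow> complex" where
  "e j \<equiv> \<lambda>x. complex_of_real (\<phi> j x)"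

text \<open>Coordinates are indexed by \<open>j \<ge> 1\<close>, as in \<open>hilbert_basis\<close>; the coordinate \<open>0\<close> has no meaning.\<close>

definition coef :: "('a \<Rightarrow> complex) \<Rightarrow> nat \<Rightarrow> complex" where
  "coef u j = l2_inner \<mu> u (e j)"

definition comb :: "(nat \<Rightarrow> complex) \<Rightarrow> nat \<Rightarrow> 'a \<Rightarrow> complex" where
  "comb c N = (\<lambda>x. \<Sum>j=1..N. c j * e j x)"

lemma X_L2: "u \<in> X \<Longrightarrow> u \<in> L2 \<mu>"
  using subspace by (auto simp: hilbert_subspace_def)

lemma X_lin: "u \<in> X \<Longrightarrow> v \<in> X \<Longrightarrow> (\<lambda>x. a * u x + b * v x) \<in> X"
  using subspace by (auto simp: hilbert_subspace_def)

lemma zero_X: "(\<lambda>x. 0) \<in> X"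
  using subspace by (auto simp: hilbert_subspace_def)

lemma X_complete:
  "(\<And>k. u k \<in> X) \<Longrightarrow>
    (\<And>r. r > 0 \<Longrightarrow> \<exists>N. \<forall>k\<ge>N. \<forall>l\<ge>N. l2_norm \<mu> (\<lambda>x. u k x - u l x) < r) \<Longrightarrow>
    \<exists>f\<in>X. L2_tendsto \<mu> u f"
  using subspace by (simp add: hilbert_subspace_def)

lemma X_mult: "u \<in> X \<Longrightarrow> (\<lambda>x. a * u x) \<in> X"
  using X_lin[of u u a 0] by simp

lemma e_X: "j \<ge> 1 \<Longrightarrow> e j \<in> X"
  using basis by (simp add: hilbert_basis_def)

lemma e_L2: "j \<ge> 1 \<Longrightarrow> e j \<in> L2 \<mu>"
  by (intro X_L2 e_X)

lemma e_orthonormal: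
  "i \<ge> 1 \<Longrightarrow> j \<ge> 1 \<Longrightarrow> l2_inner \<mu> (e i) (e j) = (if i = j then 1 else 0)"
  using basis by (simp add: hilbert_basis_def)

lemma coef_lin:
  "u \<in> L2 \<mu> \<Longrightarrow> v \<in> L2 \<mu> \<Longrightarrow> j \<ge> 1 \<Longrightarrow>
    coef (\<lambda>x. a * u x + b * v x) j = a * coef u j + b * coef v j"
  unfolding coef_def by (intro l2_inner_lin_left e_L2)

lemma coef_mult: "u \<in> L2 \<mu> \<Longrightarrow> j \<ge> 1 \<Longrightarrow> coef (\<lambda>x. a * u x) j = a * coef u j"
  using coef_lin[of u u j a 0] by simp

lemma coef_cong_AE:
  "u \<in> L2 \<mu> \<Longrightarrow> v \<in> L2 \<mu> \<Longrightarrow> AE x in \<mu>. u x = v x \<Longrightarrow> j \<ge> 1 \<Longrightarrow> coef u j = coef v j"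
  unfolding coef_def by (intro l2_inner_cong_AE e_L2)

lemma coef_e: "i \<ge> 1 \<Longrightarrow> j \<ge> 1 \<Longrightarrow> coef (e i) j = (if i = j then 1 else 0)"
  by (simp add: coef_def e_orthonormal)

lemma norm_e: "j \<ge> 1 \<Longrightarrow> l2_norm \<mu> (e j) = 1"
  using e_orthonormal[of j j] l2_inner_self[of \<mu> "e j"] l2_norm_nonneg[of \<mu> "e j"]
  by (simp add: power2_eq_1_iff flip: of_real_power)

lemma coef_le_norm: "u \<in> L2 \<mu> \<Longrightarrow> j \<ge> 1 \<Longrightarrow> cmod (coef u j) \<le> l2_norm \<mu> u"
  using L2_Cauchy_Schwarz[of u \<mu> "e j"] by (simp add: coef_def norm_e X_L2 e_X)

lemma comb_0: "comb c 0 = (\<lambda>x. 0)"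
  by (simp add: comb_def)

lemma comb_Suc: "comb c (Suc N) = (\<lambda>x. 1 * comb c N x + c (Suc N) * e (Suc N) x)"
  by (simp add: comb_def)

lemma comb_X: "comb c N \<in> X"
  by (induction N) (auto simp only: comb_0 comb_Suc intro!: zero_X X_lin e_X)

lemma comb_L2: "comb c N \<in> L2 \<mu>"
  by (rule X_L2[OF comb_X])

lemma comb_diff: "comb c N x - comb d N x = comb (\<lambda>j. c j - d j) N x"
  by (simp add: comb_def sum_subtractf algebra_simps)

lemma comb_mult: "a * comb c N x = comb (\<lambda>j. a * c j) N x"
  by (simp add: comb_def sum_distrib_left mult.assoc)

lemma inner_comb_left:
  assumes "v \<in> L2 \<mu>"
  shows "l2_inner \<mu> (comb c N) v = (\<Sum>j=1..N. c j * cnj (coef v j))"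
proof (induction N)
  case 0
  show ?case by (simp add: comb_0 l2_inner_def)
next
  case (Suc N)
  have "l2_inner \<mu> (comb c (Suc N)) v
      = 1 * l2_inner \<mu> (comb c N) v + c (Suc N) * l2_inner \<mu> (e (Suc N)) v"
    unfolding comb_Suc by (intro l2_inner_lin_left comb_L2 e_L2 assms) simp
  also have "l2_inner \<mu> (e (Suc N)) v = cnj (coef v (Suc N))"
    unfolding coef_def by (rule l2_inner_cnj)
  finally show ?case using Suc by simp
qed

lemma coef_comb:
  assumes "j \<ge> 1"
  shows "coef (comb c N) j = (if j \<le> N then c j else 0)"
proof -
  have "coef (comb c N) j = (\<Sum>i=1..N. c i * (if i = j then 1 else 0))"
    unfolding coef_def
    by (subst inner_comb_left) (use assms in \<open>auto simp: coef_e intro!: X_L2 e_X sum.cong\<close>)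
  also have "\<dots> = (if j \<le> N then c j else 0)"
    using assms by (simp add: if_distrib[of "(*) _"] cong: if_cong)
  finally show ?thesis .
qed

lemma norm_comb: "(l2_norm \<mu> (comb c N))\<^sup>2 = (\<Sum>j=1..N. (cmod (c j))\<^sup>2)"
proof -
  have "complex_of_real ((l2_norm \<mu> (comb c N))\<^sup>2) = (\<Sum>j=1..N. c j * cnj (coef (comb c N) j))"
    unfolding l2_inner_self[symmetric] by (rule inner_comb_left[OF comb_L2])
  also have "\<dots> = (\<Sum>j=1..N. complex_of_real ((cmod (c j))\<^sup>2))"
    by (intro sum.cong) (auto simp: coef_comb complex_norm_square simp del: of_real_power)
  also have "\<dots> = complex_of_real (\<Sum>j=1..N. (cmod (c j))\<^sup>2)"
    by simp
  finally show ?thesis by (simp only: of_real_eq_iff)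
qed

lemma basis_expansion:
  "u \<in> X \<Longrightarrow> L2_tendsto \<mu> (comb (coef u)) u"
  using basis by (simp add: hilbert_basis_def comb_def[abs_def] coef_def)

lemma Bessel_equality:
  assumes u: "u \<in> L2 \<mu>"
  shows "(l2_norm \<mu> (\<lambda>x. u x - comb (coef u) N x))\<^sup>2
      = (l2_norm \<mu> u)\<^sup>2 - (\<Sum>j=1..N. (cmod (coef u j))\<^sup>2)"
proof -
  define s where "s = comb (coef u) N"
  have s: "s \<in> L2 \<mu>" by (simp add: s_def comb_L2)
  have d: "(\<lambda>x. u x - s x) \<in> L2 \<mu>" by (rule L2_diff[OF u s])
  have S: "(\<Sum>j=1..N. (cmod (coef u j))\<^sup>2) = (l2_norm \<mu> s)\<^sup>2"
    by (simp add: s_def norm_comb)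
  have su: "l2_inner \<mu> s u = complex_of_real ((l2_norm \<mu> s)\<^sup>2)"
    unfolding S[symmetric] unfolding s_def inner_comb_left[OF u]
    by (simp add: complex_norm_square del: of_real_power)
  have us: "l2_inner \<mu> u s = complex_of_real ((l2_norm \<mu> s)\<^sup>2)"
    using l2_inner_cnj[of \<mu> u s] su by simp
  have diff: "l2_inner \<mu> (\<lambda>x. u x - s x) h = l2_inner \<mu> u h - l2_inner \<mu> s h" if "h \<in> L2 \<mu>" for h
    using l2_inner_lin_left[OF u s that, of 1 "-1"] by simp
  have "l2_inner \<mu> (\<lambda>x. u x - s x) (\<lambda>x. u x - s x)
      = l2_inner \<mu> u (\<lambda>x. u x - s x) - l2_inner \<mu> s (\<lambda>x. u x - s x)"
    by (rule diff[OF d])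
  also have "l2_inner \<mu> u (\<lambda>x. u x - s x) = cnj (l2_inner \<mu> u u - l2_inner \<mu> s u)"
    using l2_inner_cnj[of \<mu> u "\<lambda>x. u x - s x"] diff[OF u] by simp
  also have "l2_inner \<mu> s (\<lambda>x. u x - s x) = cnj (l2_inner \<mu> u s - l2_inner \<mu> s s)"
    using l2_inner_cnj[of \<mu> s "\<lambda>x. u x - s x"] diff[OF s] by simp
  finally have "complex_of_real ((l2_norm \<mu> (\<lambda>x. u x - s x))\<^sup>2)
      = complex_of_real ((l2_norm \<mu> u)\<^sup>2 - (l2_norm \<mu> s)\<^sup>2)"
    by (simp add: l2_inner_self su us)
  then have "(l2_norm \<mu> (\<lambda>x. u x - s x))\<^sup>2 = (l2_norm \<mu> u)\<^sup>2 - (l2_norm \<mu> s)\<^sup>2"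
    by (simp only: of_real_eq_iff)
  then show ?thesis unfolding S s_def .
qed

lemma L2_tendsto_inner:
  assumes "L2_tendsto \<mu> f u" "v \<in> L2 \<mu>"
  shows "(\<lambda>N. l2_inner \<mu> (f N) v) \<longlonglongrightarrow> l2_inner \<mu> u v"
proof -
  have f: "\<And>N. f N \<in> L2 \<mu>" and u: "u \<in> L2 \<mu>"
    and lim: "(\<lambda>N. l2_norm \<mu> (\<lambda>x. f N x - u x)) \<longlonglongrightarrow> 0"
    using assms(1) by (auto simp: L2_tendsto_def)
  have "cmod (l2_inner \<mu> (f N) v - l2_inner \<mu> u v)
      \<le> l2_norm \<mu> (\<lambda>x. f N x - u x) * l2_norm \<mu> v" for N
    using L2_Cauchy_Schwarz[OF L2_diff[OF f u] assms(2), of N]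
      l2_inner_lin_left[OF f u assms(2), of 1 N "-1"] by simp
  then have "(\<lambda>N. l2_inner \<mu> (f N) v - l2_inner \<mu> u v) \<longlonglongrightarrow> 0"
    by (intro Lim_null_comparison[OF _ tendsto_mult_left_zero[OF lim, of "l2_norm \<mu> v"]]) simp
  then show ?thesis by (simp only: LIM_zero_iff)
qed

lemma Parseval_inner:
  assumes "u \<in> X" "v \<in> L2 \<mu>"
  shows "(\<lambda>N. \<Sum>j=1..N. coef u j * cnj (coef v j)) \<longlonglongrightarrow> l2_inner \<mu> u v"
  using L2_tendsto_inner[OF basis_expansion[OF assms(1)] assms(2)]
  by (simp add: inner_comb_left[OF assms(2)])

lemma Parseval_norm:
  assumes "u \<in> X"
  shows "(\<lambda>N. \<Sum>j=1..N. (cmod (coef u j))\<^sup>2) \<longlonglongrightarrow> (l2_norm \<mu> u)\<^sup>2"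
proof -
  have "(\<lambda>N. complex_of_real (\<Sum>j=1..N. (cmod (coef u j))\<^sup>2)) \<longlonglongrightarrow> complex_of_real ((l2_norm \<mu> u)\<^sup>2)"
    using Parseval_inner[OF assms X_L2[OF assms]]
    by (simp add: complex_norm_square l2_inner_self del: of_real_power)
  then show ?thesis by (simp only: tendsto_of_real_iff)
qed

lemma Bessel_inequality:
  assumes "u \<in> L2 \<mu>"
  shows "(\<Sum>j=1..N. (cmod (coef u j))\<^sup>2) \<le> (l2_norm \<mu> u)\<^sup>2"
  using Bessel_equality[OF assms, of N] zero_le_power2[of "l2_norm \<mu> (\<lambda>x. u x - comb (coef u) N x)"]
  by linarith

lemma norm_zero_if_coef_zero:
  assumes "u \<in> X" "\<And>j. j \<ge> 1 \<Longrightarrow> coef u j = 0"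
  shows "l2_norm \<mu> u = 0"
proof -
  have "(\<lambda>N::nat. 0) \<longlonglongrightarrow> (l2_norm \<mu> u)\<^sup>2"
    using Parseval_norm[OF assms(1)] by (simp add: assms(2))
  then show ?thesis by (simp add: LIMSEQ_const_iff)
qed

text \<open>Riesz-Fischer: the partial sums are Cauchy in the complete space \<open>X\<close>.\<close>

lemma Riesz_Fischer:
  assumes bdd: "\<And>N. (\<Sum>j=1..N. (cmod (c j))\<^sup>2) \<le> K"
  obtains v where "v \<in> X" "\<And>j. j \<ge> 1 \<Longrightarrow> coef v j = c j"
proof -
  define s where "s N = (\<Sum>j=1..N. (cmod (c j))\<^sup>2)" for N
  have "incseq s" by (rule incseq_SucI) (simp add: s_def)
  then have "convergent s"
    using bdd by (intro Bseq_monoseq_convergent BseqI'[of _ K])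
      (auto simp: s_def sum_nonneg monoseq_iff)
  then have Cs: "Cauchy s" by (rule convergent_Cauchy)
  have tail: "(l2_norm \<mu> (\<lambda>x. comb c k x - comb c l x))\<^sup>2 = s k - s l" if "l \<le> k" for k l
  proof -
    have "comb c l x = comb (\<lambda>j. if j \<le> l then c j else 0) k x" for x
      unfolding comb_def by (intro sum.mono_neutral_cong_left) (use that in auto)
    then have "(\<lambda>x. comb c k x - comb c l x) = comb (\<lambda>j. c j - (if j \<le> l then c j else 0)) k"
      by (simp add: fun_eq_iff comb_diff)
    then have "(l2_norm \<mu> (\<lambda>x. comb c k x - comb c l x))\<^sup>2
        = (\<Sum>j=1..k. (cmod (c j))\<^sup>2 - (if j \<le> l then (cmod (c j))\<^sup>2 else 0))"
      by (auto simp: norm_comb intro!: sum.cong)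
    also have "\<dots> = s k - (\<Sum>j=1..k. if j \<le> l then (cmod (c j))\<^sup>2 else 0)"
      by (simp only: sum_subtractf s_def)
    also have "(\<Sum>j=1..k. if j \<le> l then (cmod (c j))\<^sup>2 else 0) = s l"
      unfolding s_def by (intro sum.mono_neutral_cong_right) (use that in auto)
    finally show ?thesis .
  qed
  have swap: "l2_norm \<mu> (\<lambda>x. comb c k x - comb c l x) = l2_norm \<mu> (\<lambda>x. comb c l x - comb c k x)" for k l
    by (simp add: l2_norm_def norm_minus_commute)
  have tail': "(l2_norm \<mu> (\<lambda>x. comb c k x - comb c l x))\<^sup>2 = \<bar>s k - s l\<bar>" for k l
    using tail[of l k] tail[of k l] swap[of k l] incseqD[OF \<open>incseq s\<close>, of k l]
      incseqD[OF \<open>incseq s\<close>, of l k]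
    by (cases "l \<le> k") auto
  have "\<exists>N. \<forall>k\<ge>N. \<forall>l\<ge>N. l2_norm \<mu> (\<lambda>x. comb c k x - comb c l x) < r" if "r > 0" for r
  proof -
    obtain N where N: "\<And>k l. k \<ge> N \<Longrightarrow> l \<ge> N \<Longrightarrow> \<bar>s k - s l\<bar> < r\<^sup>2"
      using CauchyD[OF Cs, of "r\<^sup>2"] \<open>r > 0\<close> by auto
    have "l2_norm \<mu> (\<lambda>x. comb c k x - comb c l x) < r" if "k \<ge> N" "l \<ge> N" for k l
      using N[OF that] tail'[of k l] \<open>r > 0\<close> by (metis less_eq_real_def power_less_imp_less_base)
    then show ?thesis by blast
  qed
  then have "\<exists>v\<in>X. L2_tendsto \<mu> (comb c) v"
    by (intro X_complete allI impI comb_X)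
  then obtain v where v: "v \<in> X" and lim: "L2_tendsto \<mu> (comb c) v" by blast
  have "coef v j = c j" if "j \<ge> 1" for j
  proof (rule LIMSEQ_unique)
    show "(\<lambda>N. coef (comb c N) j) \<longlonglongrightarrow> coef v j"
      unfolding coef_def by (intro L2_tendsto_inner[OF lim] e_L2 that)
    show "(\<lambda>N. coef (comb c N) j) \<longlonglongrightarrow> c j"
      by (rule tendsto_eventually, rule eventually_sequentiallyI[of j])
        (simp only: coef_comb[OF that] if_True)
  qed
  with v that show thesis by blast
qed

end

section \<open>Diagonal operators and the square root of the Laplacian\<close>

lemma positive_selfadjointD:
  assumes "positive_selfadjoint \<mu> X S" "(u, w) \<in> S"
  shows "u \<in> X" "w \<in> X" "\<And>v z. (v, z) \<in> S \<Longrightarrow> l2_inner \<mu> u z = l2_inner \<mu> w v"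
    "0 \<le> Re (l2_inner \<mu> w u)"
  using assms unfolding positive_selfadjoint_def by blast+

lemma positive_selfadjointI_mem:
  assumes "positive_selfadjoint \<mu> X S" "u \<in> X" "w \<in> X"
    "\<And>v z. (v, z) \<in> S \<Longrightarrow> l2_inner \<mu> u z = l2_inner \<mu> w v"
  shows "(u, w) \<in> S"
  using assms unfolding positive_selfadjoint_def by blast

text \<open>Enlarging a selfadjoint operator shrinks its adjoint, so that a selfadjoint operator has no
  proper symmetric extension. It is enough to compare graphs in one direction.\<close>

lemma positive_selfadjoint_maximal:
  assumes S: "positive_selfadjoint \<mu> X S" and T: "positive_selfadjoint \<mu> X T" and "S \<subseteq> T"
  shows "S = T"
proof (intro equalityI subrelI)
  fix u w assume uw: "(u, w) \<in> T"
  show "(u, w) \<in> S"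
    using positive_selfadjointD[OF T uw] \<open>S \<subseteq> T\<close> by (intro positive_selfadjointI_mem[OF S]) auto
qed (use assms in blast)

context hilbert_space_with_basis
begin

definition diag_op :: "(nat \<Rightarrow> real) \<Rightarrow> (('a \<Rightarrow> complex) \<times> ('a \<Rightarrow> complex)) set" where
  "diag_op \<kappa> = {(u, w). u \<in> X \<and> w \<in> X \<and>
    (\<forall>j\<ge>1. coef w j = complex_of_real (\<kappa> j) * coef u j)}"

lemma comb_diag_op:
  "(\<And>j. j \<ge> 1 \<Longrightarrow> d j = complex_of_real (\<kappa> j) * c j) \<Longrightarrow> (comb c N, comb d N) \<in> diag_op \<kappa>"
  by (auto simp: diag_op_def comb_X coef_comb)

text \<open>By Parseval the inner products \<open>\<langle>u, D v\<rangle>\<close> and \<open>\<langle>D u, v\<rangle>\<close> have the same terms because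
  \<open>\<kappa>\<close> is real. Conversely, testing the symmetry relation with \<open>e\<^sub>j\<close> gives the coordinate \<open>j\<close> of the
  image.\<close>

lemma positive_selfadjoint_diag_op:
  assumes nonneg: "\<And>j. j \<ge> 1 \<Longrightarrow> 0 \<le> \<kappa> j"
  shows "positive_selfadjoint \<mu> X (diag_op \<kappa>)"
  unfolding positive_selfadjoint_def
proof (intro conjI ballI)
  show "hilbert_subspace \<mu> X" by (rule subspace)
  show "diag_op \<kappa> \<subseteq> X \<times> X" by (auto simp: diag_op_def)
next
  fix f assume "f \<in> X"
  moreover have "comb c k \<in> Domain (diag_op \<kappa>)" for c k
    using comb_diag_op[of "\<lambda>j. complex_of_real (\<kappa> j) * c j"] by blast
  ultimately show "\<exists>u. (\<forall>k. u k \<in> Domain (diag_op \<kappa>)) \<and> L2_tendsto \<mu> u f"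
    using basis_expansion by blast
next
  fix u w assume u: "u \<in> X" and w: "w \<in> X"
  show "(u, w) \<in> diag_op \<kappa> \<longleftrightarrow> (\<forall>(v, z)\<in>diag_op \<kappa>. l2_inner \<mu> u z = l2_inner \<mu> w v)"
  proof (intro iffI ballI)
    fix p assume uw: "(u, w) \<in> diag_op \<kappa>" and "p \<in> diag_op \<kappa>"
    then obtain v z where p: "p = (v, z)" and vz: "(v, z) \<in> diag_op \<kappa>" by (cases p) auto
    then have v: "v \<in> X" and z: "z \<in> X" by (auto simp: diag_op_def)
    have "coef u j * cnj (coef z j) = coef w j * cnj (coef v j)" if "j \<in> {1..N}" for j N
      using uw vz that by (simp add: diag_op_def)
    then have "(\<lambda>N. \<Sum>j=1..N. coef u j * cnj (coef z j)) = (\<lambda>N. \<Sum>j=1..N. coef w j * cnj (coef v j))"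
      by (intro ext sum.cong refl)
    then show "case p of (v, z) \<Rightarrow> l2_inner \<mu> u z = l2_inner \<mu> w v"
      using LIMSEQ_unique[OF Parseval_inner[OF u X_L2[OF z]]] Parseval_inner[OF w X_L2[OF v]]
      by (simp add: p)
  next
    assume all: "\<forall>(v, z)\<in>diag_op \<kappa>. l2_inner \<mu> u z = l2_inner \<mu> w v"
    have "coef w j = complex_of_real (\<kappa> j) * coef u j" if j: "j \<ge> 1" for j
    proof -
      have "(e j, \<lambda>x. complex_of_real (\<kappa> j) * e j x) \<in> diag_op \<kappa>"
        using j by (auto simp: diag_op_def coef_mult coef_e e_L2 intro!: e_X X_mult)
      then have "coef w j = l2_inner \<mu> u (\<lambda>x. complex_of_real (\<kappa> j) * e j x)"
        using all by (auto simp: coef_def)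
      also have "\<dots> = complex_of_real (\<kappa> j) * coef u j"
        by (simp add: l2_inner_mult_right coef_def)
      finally show ?thesis .
    qed
    then show "(u, w) \<in> diag_op \<kappa>" using u w by (simp add: diag_op_def)
  qed
next
  fix p assume "p \<in> diag_op \<kappa>"
  then obtain u w where p: "p = (u, w)" and uw: "(u, w) \<in> diag_op \<kappa>" by (cases p) auto
  then have u: "u \<in> X" and w: "w \<in> X" by (auto simp: diag_op_def)
  have "0 \<le> (\<Sum>j=1..N. Re (coef w j * cnj (coef u j)))" for N
  proof (rule sum_nonneg)
    fix j assume "j \<in> {1..N}"
    then have "coef w j * cnj (coef u j) = complex_of_real (\<kappa> j * (cmod (coef u j))\<^sup>2)"
      using uw by (simp add: diag_op_def complex_norm_square mult.assoc del: of_real_power)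
    then show "0 \<le> Re (coef w j * cnj (coef u j))"
      using nonneg[of j] \<open>j \<in> {1..N}\<close> by simp
  qed
  then have "0 \<le> Re (l2_inner \<mu> w u)"
    using tendsto_Re[OF Parseval_inner[OF w X_L2[OF u]]]
    by (intro LIMSEQ_le_const) (auto simp: Re_sum)
  then show "case p of (u, w) \<Rightarrow> 0 \<le> Re (l2_inner \<mu> w u)" by (simp add: p)
qed

text \<open>Symmetry against the eigenvectors forces the coordinates of the image, hence \<open>S\<close> is contained
  in a diagonal operator; the rest is maximality. The eigenvector equation is only required almost
  everywhere, because the graph of \<open>S\<close> contains representatives and not classes.\<close>

lemma eq_diag_op:
  assumes S: "positive_selfadjoint \<mu> X S"
    and nonneg: "\<And>j. j \<ge> 1 \<Longrightarrow> 0 \<le> \<kappa> j"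
    and eig: "\<And>j. j \<ge> 1 \<Longrightarrow> \<exists>w. (e j, w) \<in> S \<and> (AE x in \<mu>. w x = complex_of_real (\<kappa> j) * e j x)"
  shows "S = diag_op \<kappa>"
proof (rule positive_selfadjoint_maximal[OF S positive_selfadjoint_diag_op[OF nonneg]])
  show "S \<subseteq> diag_op \<kappa>"
  proof (rule subrelI)
    fix u w assume uw: "(u, w) \<in> S"
    note X = positive_selfadjointD(1,2)[OF S uw]
    have "coef w j = complex_of_real (\<kappa> j) * coef u j" if j: "j \<ge> 1" for j
    proof -
      obtain v where v: "(e j, v) \<in> S" and ae: "AE x in \<mu>. v x = complex_of_real (\<kappa> j) * e j x"
        using eig[OF j] by blast
      have "coef w j = l2_inner \<mu> u v"
        using positive_selfadjointD(3)[OF S uw v] by (simp add: coef_def)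
      also have "\<dots> = cnj (l2_inner \<mu> v u)" by (rule l2_inner_cnj)
      also have "l2_inner \<mu> v u = l2_inner \<mu> (\<lambda>x. complex_of_real (\<kappa> j) * e j x) u"
        by (intro l2_inner_cong_AE ae X_L2 X_mult e_X j X positive_selfadjointD(2)[OF S v])
      also have "cnj \<dots> = complex_of_real (\<kappa> j) * coef u j"
        using l2_inner_cnj[of \<mu> u "e j"] by (simp add: l2_inner_mult_left coef_def)
      finally show ?thesis .
    qed
    then show "(u, w) \<in> diag_op \<kappa>" using X by (simp add: diag_op_def)
  qed
qed

text \<open>The intermediate element exists because \<open>(\<kappa>\<^sub>j \<bar>u\<^sub>j\<bar>)\<^sup>2 = \<bar>\<kappa>\<^sub>j\<^sup>2 u\<^sub>j\<bar> \<bar>u\<^sub>j\<bar>\<close> is summable whenever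
  \<open>u\<^sub>j\<close> and \<open>\<kappa>\<^sub>j\<^sup>2 u\<^sub>j\<close> are square summable.\<close>

lemma diag_op_comp_self:
  "diag_op \<kappa> O diag_op \<kappa> = diag_op (\<lambda>j. (\<kappa> j)\<^sup>2)"
proof (intro equalityI subrelI)
  fix u w assume "(u, w) \<in> diag_op \<kappa> O diag_op \<kappa>"
  then show "(u, w) \<in> diag_op (\<lambda>j. (\<kappa> j)\<^sup>2)"
    by (auto simp: diag_op_def power2_eq_square)
next
  fix u w assume uw: "(u, w) \<in> diag_op (\<lambda>j. (\<kappa> j)\<^sup>2)"
  then have u: "u \<in> X" and w: "w \<in> X" by (auto simp: diag_op_def)
  have "(\<Sum>j=1..N. (cmod (complex_of_real (\<kappa> j) * coef u j))\<^sup>2) \<le> (l2_norm \<mu> w)\<^sup>2 + (l2_norm \<mu> u)\<^sup>2" for N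
  proof -
    have "(cmod (complex_of_real (\<kappa> j) * coef u j))\<^sup>2 \<le> (cmod (coef w j))\<^sup>2 + (cmod (coef u j))\<^sup>2"
      if "j \<in> {1..N}" for j
    proof -
      have "(cmod (complex_of_real (\<kappa> j) * coef u j))\<^sup>2 = cmod (coef w j) * cmod (coef u j)"
        using uw that by (simp add: diag_op_def norm_mult power_mult_distrib norm_power power2_eq_square)
      then show ?thesis
        using sum_squares_bound[of "cmod (coef w j)" "cmod (coef u j)"]
          mult_nonneg_nonneg[OF norm_ge_zero norm_ge_zero, of "coef w j" "coef u j"] by linarith
    qed
    then have "(\<Sum>j=1..N. (cmod (complex_of_real (\<kappa> j) * coef u j))\<^sup>2)
        \<le> (\<Sum>j=1..N. (cmod (coef w j))\<^sup>2 + (cmod (coef u j))\<^sup>2)"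
      by (rule sum_mono)
    also have "\<dots> \<le> (l2_norm \<mu> w)\<^sup>2 + (l2_norm \<mu> u)\<^sup>2"
      unfolding sum.distrib by (intro add_mono Bessel_inequality X_L2 u w)
    finally show ?thesis .
  qed
  then obtain v where v: "v \<in> X" "\<And>j. j \<ge> 1 \<Longrightarrow> coef v j = complex_of_real (\<kappa> j) * coef u j"
    by (rule Riesz_Fischer) blast
  then have "(u, v) \<in> diag_op \<kappa>" "(v, w) \<in> diag_op \<kappa>"
    using uw by (auto simp: diag_op_def power2_eq_square)
  then show "(u, w) \<in> diag_op \<kappa> O diag_op \<kappa>" by blast
qed

end

locale laplacian_eigenbasis = hilbert_space_with_basis \<mu> X \<phi>
  for \<mu> :: "'a measure" and X :: "('a \<Rightarrow> complex) set" and \<phi> :: "nat \<Rightarrow> 'a \<Rightarrow> real" +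
  fixes A :: "(('a \<Rightarrow> complex) \<times> ('a \<Rightarrow> complex)) set" and lam :: "nat \<Rightarrow> real"
  assumes selfadjoint: "positive_selfadjoint \<mu> X A"
    and lam_pos: "\<And>j. j \<ge> 1 \<Longrightarrow> lam j > 0"
    and eigen: "\<And>j. j \<ge> 1 \<Longrightarrow>
      (\<lambda>x. complex_of_real (\<phi> j x), \<lambda>x. complex_of_real ((lam j)\<^sup>2 * \<phi> j x)) \<in> A"
begin

lemma A_eq_diag_op: "A = diag_op (\<lambda>j. (lam j)\<^sup>2)"
proof (rule eq_diag_op[OF selfadjoint])
  fix j :: nat assume "j \<ge> 1"
  then show "\<exists>w. (e j, w) \<in> A \<and> (AE x in \<mu>. w x = complex_of_real ((lam j)\<^sup>2) * e j x)"
    using eigen[of j] by (intro exI[of _ "\<lambda>x. complex_of_real ((lam j)\<^sup>2 * \<phi> j x)"]) simp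
qed simp

text \<open>If \<open>S\<^sup>2 = A\<close> and \<open>S e\<^sub>j = v\<close>, then \<open>d = v - \<lambda>\<^sub>j e\<^sub>j\<close> satisfies \<open>S d = - \<lambda>\<^sub>j d\<close>, so
  that \<open>d = 0\<close> by positivity of \<open>S\<close>.\<close>

lemma sqrt_eigen:
  assumes S: "positive_selfadjoint \<mu> X S" and SS: "S O S = A" and j: "j \<ge> 1"
  shows "\<exists>v. (e j, v) \<in> S \<and> (AE x in \<mu>. v x = complex_of_real (lam j) * e j x)"
proof -
  define l where "l = complex_of_real (lam j)"
  have "(e j, \<lambda>x. complex_of_real ((lam j)\<^sup>2 * \<phi> j x)) \<in> S O S" using eigen[OF j] SS by simp
  then obtain v where v: "(e j, v) \<in> S" and vw: "(v, \<lambda>x. l\<^sup>2 * e j x) \<in> S"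
    by (auto simp: l_def)
  have vX: "v \<in> X" by (rule positive_selfadjointD[OF S v])
  define d where "d = (\<lambda>x. 1 * v x + (-l) * e j x)"
  have dX: "d \<in> X" unfolding d_def by (intro X_lin vX e_X j)
  have "(d, \<lambda>x. - l * d x) \<in> S"
  proof (rule positive_selfadjointI_mem[OF S dX X_mult[OF dX]])
    fix p q assume pq: "(p, q) \<in> S"
    note pX = positive_selfadjointD(1,2)[OF S pq, THEN X_L2]
    have "l2_inner \<mu> d q = l2_inner \<mu> v q - l * l2_inner \<mu> (e j) q"
      unfolding d_def by (subst l2_inner_lin_left) (auto intro: X_L2 vX e_L2[OF j] pX)
    also have "\<dots> = l2_inner \<mu> (\<lambda>x. l\<^sup>2 * e j x) p - l * l2_inner \<mu> v p"
      using positive_selfadjointD(3)[OF S vw pq] positive_selfadjointD(3)[OF S v pq] by simp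
    also have "\<dots> = - l * (1 * l2_inner \<mu> v p + (- l) * l2_inner \<mu> (e j) p)"
      by (simp add: l2_inner_mult_left algebra_simps power2_eq_square)
    also have "\<dots> = - l * l2_inner \<mu> d p"
      unfolding d_def by (subst l2_inner_lin_left) (auto intro: X_L2 vX e_L2[OF j] pX)
    also have "\<dots> = l2_inner \<mu> (\<lambda>x. - l * d x) p"
      using l2_inner_mult_left[of \<mu> "- l" d p] by simp
    finally show "l2_inner \<mu> d q = l2_inner \<mu> (\<lambda>x. - l * d x) p" .
  qed
  from positive_selfadjointD(4)[OF S this]
  have "0 \<le> Re (- l * l2_inner \<mu> d d)" using l2_inner_mult_left[of \<mu> "- l" d d] by simp
  then have "lam j * (l2_norm \<mu> d)\<^sup>2 \<le> 0" by (simp add: l_def l2_inner_self del: of_real_power)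
  then have "l2_norm \<mu> d = 0" using lam_pos[OF j] by (simp add: mult_le_0_iff)
  then have "AE x in \<mu>. d x = 0" by (simp add: l2_norm_eq_0_iff X_L2[OF dX])
  then have "AE x in \<mu>. v x = l * e j x" by (simp add: d_def)
  with v show ?thesis by (auto simp: l_def)
qed

text \<open>The union in the definition of \<open>op_sqrt\<close> has a single member, by existence and uniqueness of
  the positive square root.\<close>

lemma op_sqrt_eq_diag_op: "op_sqrt \<mu> X A = diag_op lam"
proof -
  have nonneg: "0 \<le> lam j" if "j \<ge> 1" for j using lam_pos[OF that] by simp
  have "S = diag_op lam" if "positive_selfadjoint \<mu> X S" "S O S = A" for S
    by (rule eq_diag_op[OF that(1) nonneg sqrt_eigen[OF that]])
  moreover have "positive_selfadjoint \<mu> X (diag_op lam)"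
    by (rule positive_selfadjoint_diag_op[OF nonneg])
  moreover have "diag_op lam O diag_op lam = A"
    unfolding A_eq_diag_op by (rule diag_op_comp_self)
  ultimately have "{S. positive_selfadjoint \<mu> X S \<and> S O S = A} = {diag_op lam}" by blast
  then show ?thesis by (simp add: op_sqrt_def)
qed

end

section \<open>Time means\<close>

text \<open>Integrability is part of the definition because the integral of a function that is not integrable
  is \<open>0\<close>, which would break additivity.\<close>

definition has_time_mean :: "(real \<Rightarrow> 'b::{banach, second_countable_topology}) \<Rightarrow> 'b \<Rightarrow> bool" where
  "has_time_mean h m \<longleftrightarrow> (\<forall>T\<ge>0. set_integrable lborel {0..T} h) \<and>
     ((\<lambda>T. (1 / T) *\<^sub>R (LINT t:{0..T}|lborel. h t)) \<longlongrightarrow> m) at_top"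

lemma has_time_mean_0: "has_time_mean (\<lambda>t. 0) 0"
  by (simp add: has_time_mean_def set_integrable_def)

lemma has_time_mean_add:
  assumes "has_time_mean f a" "has_time_mean g b"
  shows "has_time_mean (\<lambda>t. f t + g t) (a + b)"
  unfolding has_time_mean_def
proof (intro conjI allI impI)
  have i: "T \<ge> 0 \<Longrightarrow> set_integrable lborel {0..T} f" "T \<ge> 0 \<Longrightarrow> set_integrable lborel {0..T} g" for T
    using assms by (auto simp: has_time_mean_def)
  show "T \<ge> 0 \<Longrightarrow> set_integrable lborel {0..T} (\<lambda>t. f t + g t)" for T
    using i by (intro set_integral_add) auto
  have "((\<lambda>T. (1 / T) *\<^sub>R (LINT t:{0..T}|lborel. f t) + (1 / T) *\<^sub>R (LINT t:{0..T}|lborel. g t))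
      \<longlongrightarrow> a + b) at_top"
    using assms by (intro tendsto_add) (auto simp: has_time_mean_def)
  moreover have "\<forall>\<^sub>F T in at_top. (1 / T) *\<^sub>R (LINT t:{0..T}|lborel. f t)
      + (1 / T) *\<^sub>R (LINT t:{0..T}|lborel. g t) = (1 / T) *\<^sub>R (LINT t:{0..T}|lborel. f t + g t)"
    using eventually_ge_at_top[of 0]
    by eventually_elim (simp add: set_integral_add(2) i scaleR_add_right)
  ultimately show "((\<lambda>T. (1 / T) *\<^sub>R (LINT t:{0..T}|lborel. f t + g t)) \<longlongrightarrow> a + b) at_top"
    by (rule Lim_transform_eventually)
qed

lemma has_time_mean_sum:
  "finite I \<Longrightarrow> (\<And>i. i \<in> I \<Longrightarrow> has_time_mean (f i) (a i)) \<Longrightarrow>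
    has_time_mean (\<lambda>t. \<Sum>i\<in>I. f i t) (\<Sum>i\<in>I. a i)"
  by (induction I rule: finite_induct) (auto simp: has_time_mean_0 has_time_mean_add)

lemma has_time_mean_cmult:
  fixes f :: "real \<Rightarrow> complex"
  assumes "has_time_mean f a"
  shows "has_time_mean (\<lambda>t. c * f t) (c * a)"
  unfolding has_time_mean_def
proof (intro conjI allI impI)
  show "T \<ge> 0 \<Longrightarrow> set_integrable lborel {0..T} (\<lambda>t. c * f t)" for T
    using assms by (intro set_integrable_mult_right) (auto simp: has_time_mean_def)
  have "((\<lambda>T. c * ((1 / T) *\<^sub>R (LINT t:{0..T}|lborel. f t))) \<longlongrightarrow> c * a) at_top"
    using assms by (intro tendsto_mult tendsto_const) (auto simp: has_time_mean_def)
  then show "((\<lambda>T. (1 / T) *\<^sub>R (LINT t:{0..T}|lborel. c * f t)) \<longlongrightarrow> c * a) at_top"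
    by simp
qed

lemma has_time_mean_Re:
  assumes "has_time_mean f m"
  shows "has_time_mean (\<lambda>t. Re (f t)) (Re m)"
  unfolding has_time_mean_def
proof (intro conjI allI impI)
  have int: "integrable lborel (\<lambda>t. indicator {0..T} t *\<^sub>R f t)" if "T \<ge> 0" for T
    using assms that by (simp add: has_time_mean_def set_integrable_def)
  show "T \<ge> 0 \<Longrightarrow> set_integrable lborel {0..T} (\<lambda>t. Re (f t))" for T
    using integrable_Re[OF int] by (simp add: set_integrable_def)
  have "((\<lambda>T. Re ((1 / T) *\<^sub>R (LINT t:{0..T}|lborel. f t))) \<longlongrightarrow> Re m) at_top"
    using assms by (intro tendsto_Re) (auto simp: has_time_mean_def)
  moreover have "\<forall>\<^sub>F T in at_top. Re ((1 / T) *\<^sub>R (LINT t:{0..T}|lborel. f t))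
      = (1 / T) *\<^sub>R (LINT t:{0..T}|lborel. Re (f t))"
    using eventually_ge_at_top[of 0]
  proof eventually_elim
    case (elim T)
    then show ?case using integral_Re[OF int[OF elim]] by (simp add: set_lebesgue_integral_def)
  qed
  ultimately show "((\<lambda>T. (1 / T) *\<^sub>R (LINT t:{0..T}|lborel. Re (f t))) \<longlongrightarrow> Re m) at_top"
    by (rule Lim_transform_eventually)
qed

text \<open>For \<open>\<theta> \<noteq> 0\<close> the integral over \<open>[0, T]\<close> is bounded by \<open>2 / \<bar>\<theta>\<bar>\<close>, uniformly in \<open>T\<close>.\<close>

lemma has_time_mean_exp:
  fixes \<theta> :: real
  shows "has_time_mean (\<lambda>t. exp (\<i> * complex_of_real (\<theta> * t))) (if \<theta> = 0 then 1 else 0)"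
  unfolding has_time_mean_def
proof (intro conjI allI impI)
  fix T :: real assume "T \<ge> 0"
  show "set_integrable lborel {0..T} (\<lambda>t. exp (\<i> * complex_of_real (\<theta> * t)))"
    by (intro borel_integrable_atLeastAtMost' continuous_intros)
next
  show "((\<lambda>T. (1 / T) *\<^sub>R (LINT t:{0..T}|lborel. exp (\<i> * complex_of_real (\<theta> * t))))
      \<longlongrightarrow> (if \<theta> = 0 then 1 else 0)) at_top"
  proof (cases "\<theta> = 0")
    case True
    have "\<forall>\<^sub>F T::real in at_top. 1 = (1 / T) *\<^sub>R (LINT t:{0..T}|lborel. exp (\<i> * complex_of_real (\<theta> * t)))"
      using eventually_gt_at_top[of 0]
      by eventually_elim (simp add: True set_lebesgue_integral_def scaleR_conv_of_real)
    then show ?thesis using True by (intro tendsto_eventually) (auto elim: eventually_mono)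
  next
    case False
    define F where "F t = exp (\<i> * complex_of_real (\<theta> * t)) / (\<i> * complex_of_real \<theta>)" for t :: real
    have int: "(LINT t:{0..T}|lborel. exp (\<i> * complex_of_real (\<theta> * t))) = F T - F 0" if "T \<ge> 0" for T
      unfolding set_lebesgue_integral_def
    proof (rule integral_FTC_atLeastAtMost[OF that])
      fix t
      have "((\<lambda>z. exp (\<i> * of_real \<theta> * z) / (\<i> * of_real \<theta>)) has_field_derivative
          exp (\<i> * of_real \<theta> * of_real t)) (at (complex_of_real t))"
        using False by (auto intro!: derivative_eq_intros)
      from has_vector_derivative_real_field[OF this]
      show "(F has_vector_derivative exp (\<i> * complex_of_real (\<theta> * t))) (at t within {0..T})"
        by (simp add: F_def[abs_def] mult.assoc)
    qed (intro continuous_intros)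
    have bound: "norm ((1 / T) *\<^sub>R (LINT t:{0..T}|lborel. exp (\<i> * complex_of_real (\<theta> * t))))
        \<le> (2 / \<bar>\<theta>\<bar>) * (1 / T)" if "T > 0" for T
    proof -
      have "norm (F t) = 1 / \<bar>\<theta>\<bar>" for t by (simp add: F_def norm_divide norm_mult)
      then have "norm (F T - F 0) \<le> 2 / \<bar>\<theta>\<bar>"
        using norm_triangle_ineq4[of "F T" "F 0"] by simp
      then have "norm (F T - F 0) / T \<le> (2 / \<bar>\<theta>\<bar>) / T" using that by (intro divide_right_mono) auto
      then show ?thesis
        unfolding int[OF less_imp_le[OF that]] using that by simp
    qed
    have "((\<lambda>T::real. (2 / \<bar>\<theta>\<bar>) * (1 / T)) \<longlongrightarrow> (2 / \<bar>\<theta>\<bar>) * 0) at_top"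
      by (intro tendsto_mult tendsto_const) (simp add: tendsto_inverse_0_at_top filterlim_ident flip: inverse_eq_divide)
    then have "((\<lambda>T. (1 / T) *\<^sub>R (LINT t:{0..T}|lborel. exp (\<i> * complex_of_real (\<theta> * t)))) \<longlongrightarrow> 0) at_top"
      by (intro Lim_null_comparison[OF eventually_mono[OF eventually_gt_at_top[of 0] bound]])
        simp_all
    then show ?thesis using False by simp
  qed
qed

lemma has_time_mean_cis:
  fixes \<theta> :: real
  shows "has_time_mean (\<lambda>t. cis (\<theta> * t)) (if \<theta> = 0 then 1 else 0)"
  using has_time_mean_exp[of \<theta>] by (simp add: cis_conv_exp)

lemma Lim_time_average_quotient:
  fixes h :: "real \<Rightarrow> real"
  assumes "has_time_mean h L"
  shows "Lim at_top (\<lambda>T. 1 / T * ((LINT t:{0..T}|lborel. h t) / K)) = L / K"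
proof (rule tendsto_Lim)
  have "((\<lambda>T. (1 / T) *\<^sub>R (LINT t:{0..T}|lborel. h t) / K) \<longlongrightarrow> L / K) at_top"
  proof (cases "K = 0")
    case False
    then show ?thesis using assms by (intro tendsto_divide tendsto_const) (auto simp: has_time_mean_def)
  qed simp
  then show "((\<lambda>T. 1 / T * ((LINT t:{0..T}|lborel. h t) / K)) \<longlongrightarrow> L / K) at_top" by simp
qed simp

lemma time_average_diff_le:
  fixes f g :: "real \<Rightarrow> real"
  assumes f: "set_integrable lborel {0..T} f" and g: "set_integrable lborel {0..T} g" and T: "T > 0"
    and le: "\<And>t. t \<ge> 0 \<Longrightarrow> \<bar>f t - g t\<bar> \<le> \<epsilon>"
  shows "\<bar>(1 / T) *\<^sub>R (LINT t:{0..T}|lborel. f t) - (1 / T) *\<^sub>R (LINT t:{0..T}|lborel. g t)\<bar> \<le> \<epsilon>"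
proof -
  have d: "set_integrable lborel {0..T} (\<lambda>t. f t - g t)" by (rule set_integral_diff(1)[OF f g])
  have "\<bar>LINT t:{0..T}|lborel. f t - g t\<bar> \<le> (LINT t:{0..T}|lborel. \<bar>f t - g t\<bar>)"
    using set_integral_norm_bound[OF d] by simp
  also have "\<dots> \<le> (LINT t:{0..T}|lborel. \<epsilon>)"
  proof (rule set_integral_mono)
    show "set_integrable lborel {0..T} (\<lambda>t. \<bar>f t - g t\<bar>)" using set_integrable_abs[OF d] .
    show "set_integrable lborel {0..T} (\<lambda>t. \<epsilon>)"
      by (intro borel_integrable_atLeastAtMost' continuous_intros)
  qed (use le in auto)
  also have "\<dots> = T * \<epsilon>" using T by (simp add: set_lebesgue_integral_def)
  finally have "\<bar>LINT t:{0..T}|lborel. f t - g t\<bar> / T \<le> \<epsilon>" using T by (simp add: field_simps)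
  then show ?thesis
    using T by (simp add: set_integral_diff(2)[OF f g] diff_divide_distrib[symmetric])
qed

text \<open>Averaging does not increase the sup norm. So the means form a Cauchy sequence, and the averages
  converge uniformly in \<open>T\<close>, which allows the two limits to be exchanged.\<close>

lemma has_time_mean_uniform_limit:
  fixes h :: "real \<Rightarrow> real"
  assumes mean: "\<And>N::nat. has_time_mean (hN N) (m N)"
    and h: "\<And>T. T \<ge> 0 \<Longrightarrow> set_integrable lborel {0..T} h"
    and le: "\<And>N t. t \<ge> 0 \<Longrightarrow> \<bar>hN N t - h t\<bar> \<le> \<epsilon> N"
    and \<epsilon>: "\<epsilon> \<longlonglongrightarrow> 0"
  obtains L where "m \<longlonglongrightarrow> L" "has_time_mean h L"
proof -
  define av where "av f T = (1 / T) *\<^sub>R (LINT t:{0..T}|lborel. f t)" for f :: "real \<Rightarrow> real" and T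
  have lim: "(av (hN N) \<longlongrightarrow> m N) at_top" and int: "T \<ge> 0 \<Longrightarrow> set_integrable lborel {0..T} (hN N)" for N T
    using mean[of N] by (auto simp: has_time_mean_def av_def[abs_def])
  have avle: "\<bar>av (hN N) T - av h T\<bar> \<le> \<epsilon> N" if "T > 0" for N T
    unfolding av_def using that by (intro time_average_diff_le int h le) auto
  have "\<bar>m N - m M\<bar> \<le> \<epsilon> N + \<epsilon> M" for N M
  proof (rule tendsto_upperbound)
    show "((\<lambda>T. \<bar>av (hN N) T - av (hN M) T\<bar>) \<longlongrightarrow> \<bar>m N - m M\<bar>) at_top"
      by (intro tendsto_intros lim)
    show "\<forall>\<^sub>F T in at_top. \<bar>av (hN N) T - av (hN M) T\<bar> \<le> \<epsilon> N + \<epsilon> M"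
      using eventually_gt_at_top[of 0]
    proof eventually_elim
      case (elim T)
      show ?case using avle[OF elim, of N] avle[OF elim, of M] by linarith
    qed
  qed simp
  note mm = this
  have "Cauchy m"
  proof (rule metric_CauchyI)
    fix r :: real assume "r > 0"
    then obtain K where K: "\<And>N. N \<ge> K \<Longrightarrow> \<bar>\<epsilon> N\<bar> < r / 2"
      using LIMSEQ_D[OF \<epsilon>, of "r / 2"] by auto
    have "dist (m N) (m M) < r" if "N \<ge> K" "M \<ge> K" for N M
      using mm[of N M] K[OF that(1)] K[OF that(2)] by (simp add: dist_real_def)
    then show "\<exists>K. \<forall>N\<ge>K. \<forall>M\<ge>K. dist (m N) (m M) < r" by blast
  qed
  then obtain L where L: "m \<longlonglongrightarrow> L" using real_Cauchy_convergent convergent_def by blast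
  have unif: "uniform_limit {0<..} (\<lambda>N. av (hN N)) (av h) sequentially"
  proof (rule uniform_limitI)
    fix r :: real assume "r > 0"
    then have "\<forall>\<^sub>F N in sequentially. \<epsilon> N < r" by (rule order_tendstoD(2)[OF \<epsilon>])
    then show "\<forall>\<^sub>F N in sequentially. \<forall>T\<in>{0<..}. dist (av (hN N) T) (av h T) < r"
    proof eventually_elim
      case (elim N)
      show ?case using le_less_trans[OF avle elim] by (simp add: dist_real_def)
    qed
  qed
  have "(av h \<longlongrightarrow> L) at_top"
  proof (rule swap_uniform_limit'[OF _ L unif])
    show "\<forall>\<^sub>F N in sequentially. (av (hN N) \<longlongrightarrow> m N) at_top" by (simp add: lim)
  qed (simp_all add: eventually_gt_at_top)
  then have "has_time_mean h L" using h by (simp add: has_time_mean_def av_def[abs_def])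
  with L that show thesis by blast
qed

section \<open>Mean local energy of an oscillation\<close>

context hilbert_space_with_basis
begin

text \<open>The Gram matrix of the eigenfunctions in \<open>L\<^sup>2(\<omega>)\<close>.\<close>

definition gram :: "'a set \<Rightarrow> nat \<Rightarrow> nat \<Rightarrow> complex" where
  "gram \<omega> i j = l2_inner \<mu> (\<lambda>x. indicator \<omega> x * e i x) (e j)"

lemma gram_diag: "gram \<omega> j j = complex_of_real (LINT x:\<omega>|\<mu>. (\<phi> j x)\<^sup>2)"
  using local_energy_eq_inner[where f = "e j" and \<mu> = \<mu> and \<omega> = \<omega>] by (simp add: gram_def)

lemma local_energy_comb:
  assumes \<omega>: "\<omega> \<in> sets \<mu>"
  shows "complex_of_real (LINT x:\<omega>|\<mu>. (cmod (comb c N x))\<^sup>2)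
    = (\<Sum>i=1..N. \<Sum>j=1..N. c i * cnj (c j) * gram \<omega> i j)"
proof -
  have indL2: "(\<lambda>x. indicator \<omega> x * u x) \<in> L2 \<mu>" if "u \<in> L2 \<mu>" for u
    by (rule L2_indicator[OF that \<omega>])
  have ind: "l2_inner \<mu> (\<lambda>x. indicator \<omega> x * u x) v = l2_inner \<mu> u (\<lambda>x. indicator \<omega> x * v x)" for u v
    unfolding l2_inner_def
    by (intro Bochner_Integration.integral_cong) (auto simp: indicator_def)
  have gram_eq: "gram \<omega> i j = l2_inner \<mu> (e i) (\<lambda>x. indicator \<omega> x * e j x)" for i j
    by (simp only: gram_def ind)
  have c1: "coef (\<lambda>x. indicator \<omega> x * comb c N x) j = (\<Sum>i=1..N. c i * gram \<omega> i j)" if "j \<ge> 1" for j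
  proof -
    have "coef (\<lambda>x. indicator \<omega> x * comb c N x) j = l2_inner \<mu> (comb c N) (\<lambda>x. indicator \<omega> x * e j x)"
      by (simp only: coef_def ind)
    also have "\<dots> = (\<Sum>i=1..N. c i * cnj (coef (\<lambda>x. indicator \<omega> x * e j x) i))"
      by (rule inner_comb_left[OF indL2[OF e_L2[OF that]]])
    also have "\<dots> = (\<Sum>i=1..N. c i * gram \<omega> i j)"
      unfolding coef_def gram_eq by (simp only: l2_inner_cnj[symmetric])
    finally show ?thesis .
  qed
  have "complex_of_real (LINT x:\<omega>|\<mu>. (cmod (comb c N x))\<^sup>2)
      = cnj (l2_inner \<mu> (comb c N) (\<lambda>x. indicator \<omega> x * comb c N x))"
    unfolding local_energy_eq_inner by (rule l2_inner_cnj)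
  also have "\<dots> = (\<Sum>j=1..N. cnj (c j) * coef (\<lambda>x. indicator \<omega> x * comb c N x) j)"
    by (simp add: inner_comb_left[OF indL2[OF comb_L2]])
  also have "\<dots> = (\<Sum>j=1..N. \<Sum>i=1..N. c i * cnj (c j) * gram \<omega> i j)"
    by (intro sum.cong refl) (simp add: c1 sum_distrib_left mult_ac)
  also have "\<dots> = (\<Sum>i=1..N. \<Sum>j=1..N. c i * cnj (c j) * gram \<omega> i j)"
    by (rule sum.swap)
  finally show ?thesis .
qed

text \<open>Grouped by frequency, this is the sum over the distinct values of \<open>\<nu>\<close> of the energies over
  \<open>\<omega>\<close> of the corresponding parts of \<open>\<Sum> c\<^sub>j e\<^sub>j\<close>. As a double sum it can be compared directly with
  the expansion of a local energy.\<close>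

definition resonant_energy :: "'a set \<Rightarrow> (nat \<Rightarrow> real) \<Rightarrow> (nat \<Rightarrow> complex) \<Rightarrow> nat \<Rightarrow> real" where
  "resonant_energy \<omega> \<nu> c N =
     Re (\<Sum>i=1..N. \<Sum>j=1..N. if \<nu> i = \<nu> j then c i * cnj (c j) * gram \<omega> i j else 0)"

definition oscillation ::
  "(nat \<Rightarrow> real) \<Rightarrow> (nat \<Rightarrow> complex) \<Rightarrow> (nat \<Rightarrow> complex) \<Rightarrow> real \<Rightarrow> nat \<Rightarrow> complex" where
  "oscillation \<nu> a b t j = a j * cis (\<nu> j * t) + b j * cis (- (\<nu> j * t))"

text \<open>The four products have the frequencies \<open>\<plusminus>(\<nu>\<^sub>i - \<nu>\<^sub>j)\<close> and \<open>\<plusminus>(\<nu>\<^sub>i + \<nu>\<^sub>j)\<close>. The latter never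
  vanish, which is why \<open>a\<close> and \<open>b\<close> do not interact.\<close>

lemma has_time_mean_oscillation_prod:
  assumes "\<nu> i > 0" "\<nu> j > 0"
  shows "has_time_mean (\<lambda>t. oscillation \<nu> a b t i * cnj (oscillation \<nu> a b t j))
    (if \<nu> i = \<nu> j then a i * cnj (a j) + b i * cnj (b j) else 0)"
proof -
  have eq: "oscillation \<nu> a b t i * cnj (oscillation \<nu> a b t j)
      = a i * cnj (a j) * cis ((\<nu> i - \<nu> j) * t) + a i * cnj (b j) * cis ((\<nu> i + \<nu> j) * t)
      + (b i * cnj (a j) * cis (- (\<nu> i + \<nu> j) * t) + b i * cnj (b j) * cis ((\<nu> j - \<nu> i) * t))" for t
    by (simp add: oscillation_def cis_cnj algebra_simps cis_mult)
  have "has_time_mean (\<lambda>t. oscillation \<nu> a b t i * cnj (oscillation \<nu> a b t j))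
      (a i * cnj (a j) * (if \<nu> i - \<nu> j = 0 then 1 else 0)
        + a i * cnj (b j) * (if \<nu> i + \<nu> j = 0 then 1 else 0)
        + (b i * cnj (a j) * (if - (\<nu> i + \<nu> j) = 0 then 1 else 0)
        + b i * cnj (b j) * (if \<nu> j - \<nu> i = 0 then 1 else 0)))"
    unfolding eq by (intro has_time_mean_add has_time_mean_cmult has_time_mean_cis)
  then show ?thesis using assms by (auto split: if_splits)
qed

lemma has_time_mean_comb:
  assumes \<omega>: "\<omega> \<in> sets \<mu>" and \<nu>: "\<And>j. j \<ge> 1 \<Longrightarrow> \<nu> j > 0"
  shows "has_time_mean (\<lambda>t. LINT x:\<omega>|\<mu>. (cmod (comb (oscillation \<nu> a b t) N x))\<^sup>2)
    (resonant_energy \<omega> \<nu> a N + resonant_energy \<omega> \<nu> b N)"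
proof -
  define m where "m i j = (if \<nu> i = \<nu> j then a i * cnj (a j) + b i * cnj (b j) else 0)" for i j
  have "has_time_mean (\<lambda>t. \<Sum>i=1..N. \<Sum>j=1..N.
      gram \<omega> i j * (oscillation \<nu> a b t i * cnj (oscillation \<nu> a b t j)))
      (\<Sum>i=1..N. \<Sum>j=1..N. gram \<omega> i j * m i j)"
    unfolding m_def
    by (intro has_time_mean_sum has_time_mean_cmult has_time_mean_oscillation_prod \<nu>) auto
  from has_time_mean_Re[OF this]
  have "has_time_mean (\<lambda>t. Re (complex_of_real (LINT x:\<omega>|\<mu>. (cmod (comb (oscillation \<nu> a b t) N x))\<^sup>2)))
      (Re (\<Sum>i=1..N. \<Sum>j=1..N. gram \<omega> i j * m i j))"
    unfolding local_energy_comb[OF \<omega>] by (simp only: mult.commute)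
  moreover have "Re (\<Sum>i=1..N. \<Sum>j=1..N. gram \<omega> i j * m i j)
      = resonant_energy \<omega> \<nu> a N + resonant_energy \<omega> \<nu> b N"
    unfolding resonant_energy_def plus_complex.sel[symmetric] sum.distrib[symmetric]
    by (intro arg_cong[of _ _ Re] sum.cong refl) (simp add: m_def algebra_simps)
  ultimately show ?thesis by simp
qed

lemma cmod_oscillation_le:
  "(cmod (oscillation \<nu> a b t j))\<^sup>2 \<le> 2 * ((cmod (a j))\<^sup>2 + (cmod (b j))\<^sup>2)"
proof -
  have "cmod (oscillation \<nu> a b t j) \<le> cmod (a j) + cmod (b j)"
    unfolding oscillation_def by (rule norm_triangle_le) (simp add: norm_mult)
  then have "(cmod (oscillation \<nu> a b t j))\<^sup>2 \<le> (cmod (a j) + cmod (b j))\<^sup>2"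
    by (rule power_mono) simp
  also have "\<dots> \<le> 2 * ((cmod (a j))\<^sup>2 + (cmod (b j))\<^sup>2)"
    using sum_squares_bound[of "cmod (a j)" "cmod (b j)"] by (simp add: power2_sum)
  finally show ?thesis .
qed

text \<open>The right-hand side does not depend on \<open>t\<close>: this is the uniformity in time that the passage
  from finite sums to all data needs.\<close>

lemma oscillation_tail_le:
  assumes u: "u \<in> X" and a: "a \<in> X" and b: "b \<in> X"
    and osc: "\<And>j. j \<ge> 1 \<Longrightarrow> coef u j = oscillation \<nu> (coef a) (coef b) t j"
  shows "(l2_norm \<mu> u)\<^sup>2 - (\<Sum>j=1..N. (cmod (coef u j))\<^sup>2)
    \<le> 2 * ((l2_norm \<mu> a)\<^sup>2 - (\<Sum>j=1..N. (cmod (coef a j))\<^sup>2)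
        + ((l2_norm \<mu> b)\<^sup>2 - (\<Sum>j=1..N. (cmod (coef b j))\<^sup>2)))"
proof -
  define s where "s v M = (\<Sum>j=1..M. (cmod (coef v j))\<^sup>2)" for v M
  have tail: "s v M - s v N = (\<Sum>j\<in>{N<..M}. (cmod (coef v j))\<^sup>2)" if "N \<le> M" for v M
  proof -
    have "{1..M} = {1..N} \<union> {N<..M}" "{1..N} \<inter> {N<..M} = {}" using that by auto
    then show ?thesis by (simp add: s_def sum.union_disjoint)
  qed
  have "s u M \<le> s u N + 2 * ((l2_norm \<mu> a)\<^sup>2 - s a N + ((l2_norm \<mu> b)\<^sup>2 - s b N))" if "N \<le> M" for M
  proof -
    have "s u M - s u N \<le> (\<Sum>j\<in>{N<..M}. 2 * ((cmod (coef a j))\<^sup>2 + (cmod (coef b j))\<^sup>2))"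
      unfolding tail[OF that]
    proof (rule sum_mono)
      fix j assume "j \<in> {N<..M}"
      then have "j \<ge> 1" by simp
      show "(cmod (coef u j))\<^sup>2 \<le> 2 * ((cmod (coef a j))\<^sup>2 + (cmod (coef b j))\<^sup>2)"
        unfolding osc[OF \<open>j \<ge> 1\<close>] by (rule cmod_oscillation_le)
    qed
    also have "\<dots> = 2 * ((s a M - s a N) + (s b M - s b N))"
      unfolding tail[OF that] by (simp only: sum.distrib sum_distrib_left[symmetric])
    also have "\<dots> \<le> 2 * ((l2_norm \<mu> a)\<^sup>2 - s a N + ((l2_norm \<mu> b)\<^sup>2 - s b N))"
      using Bessel_inequality[OF X_L2[OF a], of M] Bessel_inequality[OF X_L2[OF b], of M]
      by (simp add: s_def)
    finally show ?thesis by simp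
  qed
  then have "(l2_norm \<mu> u)\<^sup>2 \<le> s u N + 2 * ((l2_norm \<mu> a)\<^sup>2 - s a N + ((l2_norm \<mu> b)\<^sup>2 - s b N))"
    using Parseval_norm[OF u] by (intro LIMSEQ_le_const2) (auto simp: s_def)
  then show ?thesis by (simp add: s_def)
qed

text \<open>Truncation at \<open>N\<close> changes the local energy by at most \<open>2 K\<close> times the square root of the tail,
  where \<open>K\<close> bounds the norm of \<open>u t\<close> for all times; \<open>has_time_mean_uniform_limit\<close> then applies.\<close>

lemma time_mean_local_energy:
  assumes \<omega>: "\<omega> \<in> sets \<mu>" and \<nu>: "\<And>j. j \<ge> 1 \<Longrightarrow> \<nu> j > 0"
    and cont: "L2_continuous \<mu> u" and u: "\<And>t. t \<ge> 0 \<Longrightarrow> u t \<in> X"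
    and a: "a \<in> X" and b: "b \<in> X"
    and osc: "\<And>t j. t \<ge> 0 \<Longrightarrow> j \<ge> 1 \<Longrightarrow> coef (u t) j = oscillation \<nu> (coef a) (coef b) t j"
  obtains L where
    "(\<lambda>N. resonant_energy \<omega> \<nu> (coef a) N + resonant_energy \<omega> \<nu> (coef b) N) \<longlonglongrightarrow> L"
    "has_time_mean (\<lambda>t. LINT x:\<omega>|\<mu>. (cmod (u t x))\<^sup>2) L"
proof -
  define s where "s v N = (\<Sum>j=1..N. (cmod (coef v j))\<^sup>2)" for v N
  define tail where "tail N = 2 * ((l2_norm \<mu> a)\<^sup>2 - s a N + ((l2_norm \<mu> b)\<^sup>2 - s b N))" for N
  define h where "h t = (LINT x:\<omega>|\<mu>. (cmod (u t x))\<^sup>2)" for t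
  define hN where "hN N t = (LINT x:\<omega>|\<mu>. (cmod (comb (oscillation \<nu> (coef a) (coef b) t) N x))\<^sup>2)" for N t
  define K where "K = sqrt (tail 0)"
  have comb_eq: "comb (oscillation \<nu> (coef a) (coef b) t) N = comb (coef (u t)) N" if "t \<ge> 0" for t N
    unfolding comb_def by (intro ext sum.cong refl) (simp add: osc[OF that])
  have tail_ge: "(l2_norm \<mu> (u t))\<^sup>2 - s (u t) N \<le> tail N" if "t \<ge> 0" for t N
    unfolding s_def tail_def by (intro oscillation_tail_le[where \<nu> = \<nu> and t = t] u a b osc that)
  have normK: "l2_norm \<mu> (u t) \<le> K" if "t \<ge> 0" for t
    using tail_ge[OF that, of 0] unfolding K_def by (intro real_le_rsqrt) (simp add: s_def)
  have "K \<ge> 0" using normK[of 0] l2_norm_nonneg[of \<mu> "u 0"] by linarith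
  have combK: "l2_norm \<mu> (comb (coef (u t)) N) \<le> K" if "t \<ge> 0" for t N
  proof -
    have "(l2_norm \<mu> (comb (coef (u t)) N))\<^sup>2 \<le> (l2_norm \<mu> (u t))\<^sup>2"
      unfolding norm_comb by (rule Bessel_inequality[OF X_L2[OF u[OF that]]])
    then show ?thesis using normK[OF that] by (simp add: power2_le_iff_abs_le order_trans)
  qed
  have le: "\<bar>hN N t - h t\<bar> \<le> sqrt (tail N) * (2 * K)" if "t \<ge> 0" for N t
  proof -
    have "(l2_norm \<mu> (\<lambda>x. u t x - comb (coef (u t)) N x))\<^sup>2 \<le> tail N"
      unfolding Bessel_equality[OF X_L2[OF u[OF that]]] using tail_ge[OF that] by (simp add: s_def)
    then have n: "l2_norm \<mu> (\<lambda>x. u t x - comb (coef (u t)) N x) \<le> sqrt (tail N)"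
      by (rule real_le_rsqrt)
    have "0 \<le> sqrt (tail N)" using n l2_norm_nonneg order_trans by blast
    have "\<bar>h t - hN N t\<bar> \<le> l2_norm \<mu> (\<lambda>x. u t x - comb (coef (u t)) N x)
        * (l2_norm \<mu> (u t) + l2_norm \<mu> (comb (coef (u t)) N))"
      unfolding h_def hN_def comb_eq[OF that]
      by (rule local_energy_diff_le[OF X_L2[OF u[OF that]] comb_L2 \<omega>])
    also have "\<dots> \<le> sqrt (tail N) * (2 * K)"
      using normK[OF that] combK[OF that, of N] by (intro mult_mono n \<open>0 \<le> sqrt (tail N)\<close>) auto
    finally show ?thesis by (simp add: abs_minus_commute)
  qed
  have conth: "continuous_on {0..} h"
    unfolding continuous_on_def
  proof
    fix t :: real assume t: "t \<in> {0..}"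
    have "((\<lambda>r. l2_norm \<mu> (\<lambda>x. u r x - u t x)) \<longlongrightarrow> 0) (at t within {0..})"
      using cont t by (simp add: L2_continuous_def)
    then have lim: "((\<lambda>r. l2_norm \<mu> (\<lambda>x. u r x - u t x) * (2 * K)) \<longlongrightarrow> 0) (at t within {0..})"
      by (rule tendsto_mult_left_zero)
    have "\<forall>\<^sub>F r in at t within {0..}. norm (h r - h t) \<le> l2_norm \<mu> (\<lambda>x. u r x - u t x) * (2 * K)"
      unfolding eventually_at_filter
    proof (intro always_eventually allI impI)
      fix r :: real assume "r \<in> {0..}"
      then have r: "r \<ge> 0" by simp
      have t: "t \<ge> 0" using t by simp
      have "\<bar>h r - h t\<bar> \<le> l2_norm \<mu> (\<lambda>x. u r x - u t x) * (l2_norm \<mu> (u r) + l2_norm \<mu> (u t))"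
        unfolding h_def by (rule local_energy_diff_le[OF X_L2[OF u[OF r]] X_L2[OF u[OF t]] \<omega>])
      also have "\<dots> \<le> l2_norm \<mu> (\<lambda>x. u r x - u t x) * (2 * K)"
        using normK[OF r] normK[OF t] by (intro mult_left_mono) auto
      finally show "norm (h r - h t) \<le> l2_norm \<mu> (\<lambda>x. u r x - u t x) * (2 * K)" by simp
    qed
    from Lim_null_comparison[OF this lim]
    show "(h \<longlongrightarrow> h t) (at t within {0..})" by (simp only: LIM_zero_iff)
  qed
  have tail0: "tail \<longlonglongrightarrow> 0"
  proof -
    have "tail \<longlonglongrightarrow> 2 * ((l2_norm \<mu> a)\<^sup>2 - (l2_norm \<mu> a)\<^sup>2 + ((l2_norm \<mu> b)\<^sup>2 - (l2_norm \<mu> b)\<^sup>2))"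
      unfolding tail_def[abs_def] s_def by (intro tendsto_intros Parseval_norm a b)
    then show ?thesis by simp
  qed
  note goal_thesis = that
  show thesis
  proof (rule has_time_mean_uniform_limit)
    show "has_time_mean (hN N)
        (resonant_energy \<omega> \<nu> (coef a) N + resonant_energy \<omega> \<nu> (coef b) N)" for N
      unfolding hN_def[abs_def] by (rule has_time_mean_comb[OF \<omega> \<nu>])
    show "set_integrable lborel {0..T} h" for T
      by (intro borel_integrable_atLeastAtMost' continuous_on_subset[OF conth]) auto
    show "\<bar>hN N t - h t\<bar> \<le> sqrt (tail N) * (2 * K)" if "t \<ge> 0" for N t by (rule le[OF that])
    show "(\<lambda>N. sqrt (tail N) * (2 * K)) \<longlonglongrightarrow> 0"
      using tendsto_mult_left_zero[OF tendsto_real_sqrt[OF tail0, simplified]] by simp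
    show thesis if "(\<lambda>N. resonant_energy \<omega> \<nu> (coef a) N + resonant_energy \<omega> \<nu> (coef b) N) \<longlonglongrightarrow> L"
      "has_time_mean h L" for L
      by (rule goal_thesis[OF that(1) that(2)[unfolded h_def[abs_def]]])
  qed
qed

end

section \<open>Solutions in coordinates\<close>

text \<open>The form in which differentiability occurs in \<open>L2_C1\<close>.\<close>

lemma has_vector_derivative_iff_quotient:
  "(f has_vector_derivative D) (at t within S) \<longleftrightarrow>
    ((\<lambda>r. (f r - f t) /\<^sub>R (r - t)) \<longlongrightarrow> D) (at t within S)"
proof -
  have eq: "norm (f r - f t - (r - t) *\<^sub>R D) / norm (r - t) = norm ((f r - f t) /\<^sub>R (r - t) - D)"
    if "r \<noteq> t" for r
  proof -
    have "(f r - f t) /\<^sub>R (r - t) - D = (f r - f t - (r - t) *\<^sub>R D) /\<^sub>R (r - t)"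
      using that by (simp add: scaleR_diff_right)
    then show ?thesis by (simp add: divide_inverse mult.commute)
  qed
  have "(f has_vector_derivative D) (at t within S) \<longleftrightarrow>
      ((\<lambda>r. norm (f r - f t - (r - t) *\<^sub>R D) / norm (r - t)) \<longlongrightarrow> 0) (at t within S)"
    by (simp add: has_vector_derivative_def has_derivative_iff_norm bounded_linear_scaleR_left)
  also have "\<dots> \<longleftrightarrow> ((\<lambda>r. norm ((f r - f t) /\<^sub>R (r - t) - D)) \<longlongrightarrow> 0) (at t within S)"
    by (rule filterlim_cong[OF refl refl])
      (unfold eventually_at_filter, intro always_eventually allI impI eq)
  finally show ?thesis by (simp only: tendsto_norm_zero_iff LIM_zero_iff)
qed

lemma has_vector_derivative_cis:
  "((\<lambda>t. cis (k * t)) has_vector_derivative \<i> * complex_of_real k * cis (k * t)) (at t within S)"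
proof -
  have "((\<lambda>z. exp (\<i> * of_real k * z)) has_field_derivative
      \<i> * of_real k * exp (\<i> * of_real k * of_real t)) (at (complex_of_real t))"
    by (auto intro!: derivative_eq_intros)
  from has_vector_derivative_real_field[OF this] show ?thesis
    by (simp add: cis_conv_exp mult.assoc)
qed

lemma linear_ode_unique:
  assumes "\<And>t. t \<ge> 0 \<Longrightarrow>
      (u has_vector_derivative \<i> * complex_of_real k * u t) (at t within {0..})"
    and "t \<ge> 0"
  shows "u t = u 0 * cis (k * t)"
proof -
  have "((\<lambda>r. u r * cis (- k * r)) has_vector_derivative 0) (at r within {0..})" if "r \<in> {0..}" for r
  proof -
    have "((\<lambda>r. u r * cis (- k * r)) has_vector_derivative
        u r * (\<i> * complex_of_real (- k) * cis (- k * r)) + \<i> * complex_of_real k * u r * cis (- k * r))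
        (at r within {0..})"
      by (rule has_vector_derivative_mult[OF assms(1) has_vector_derivative_cis]) (use that in simp)
    then show ?thesis by (simp add: algebra_simps)
  qed
  then obtain C where C: "\<And>r. r \<in> {0..} \<Longrightarrow> u r * cis (- k * r) = C"
    using has_vector_derivative_zero_constant[of "{0..}" "\<lambda>r. u r * cis (- k * r)"]
      convex_real_interval(1)[of 0] by blast
  have "u t * cis (- k * t) = u 0" using C[of t] C[of 0] \<open>t \<ge> 0\<close> by simp
  then have "u t * (cis (- k * t) * cis (k * t)) = u 0 * cis (k * t)" by (simp only: mult.assoc[symmetric])
  then show ?thesis by (simp add: cis_mult)
qed

context hilbert_space_with_basis
begin

text \<open>A coordinate is a bounded functional on \<open>L\<^sup>2\<close>, so it can be differentiated through.\<close>

lemma coef_has_vector_derivative: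
  assumes C1: "L2_C1 \<mu> y dy" and t: "t \<ge> 0" and j: "j \<ge> 1"
  shows "((\<lambda>r. coef (y r) j) has_vector_derivative coef (dy t) j) (at t within {0..})"
proof -
  have y: "y r \<in> L2 \<mu>" and dy: "dy r \<in> L2 \<mu>" if "r \<ge> 0" for r
    using C1 that by (auto simp: L2_C1_def L2_continuous_def)
  define q where "q r = (\<lambda>x. (y r x - y t x) /\<^sub>R (r - t) - dy t x)" for r
  have lim: "((\<lambda>r. l2_norm \<mu> (q r)) \<longlongrightarrow> 0) (at t within {0..})"
    using C1 t by (simp add: L2_C1_def q_def)
  have "\<forall>\<^sub>F r in at t within {0..}.
      norm ((coef (y r) j - coef (y t) j) /\<^sub>R (r - t) - coef (dy t) j) \<le> l2_norm \<mu> (q r)"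
    unfolding eventually_at_filter
  proof (intro always_eventually allI impI)
    fix r :: real assume "r \<in> {0..}"
    then have r: "r \<ge> 0" by simp
    define k where "k = complex_of_real (inverse (r - t))"
    define d where "d = (\<lambda>x. k * y r x + (- k) * y t x)"
    have d: "d \<in> L2 \<mu>" unfolding d_def by (intro L2_lin y r t)
    have q: "q r = (\<lambda>x. 1 * d x + (- 1) * dy t x)"
      by (simp add: q_def d_def k_def fun_eq_iff scaleR_conv_of_real algebra_simps del: of_real_inverse)
    have "q r \<in> L2 \<mu>" unfolding q by (intro L2_lin d dy t)
    have "coef (q r) j = 1 * (k * coef (y r) j + (- k) * coef (y t) j) + (- 1) * coef (dy t) j"
      unfolding q coef_lin[OF d dy[OF t] j] unfolding d_def coef_lin[OF y[OF r] y[OF t] j] ..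
    also have "\<dots> = (coef (y r) j - coef (y t) j) /\<^sub>R (r - t) - coef (dy t) j"
      by (simp add: k_def scaleR_conv_of_real algebra_simps del: of_real_inverse)
    finally show "norm ((coef (y r) j - coef (y t) j) /\<^sub>R (r - t) - coef (dy t) j) \<le> l2_norm \<mu> (q r)"
      using coef_le_norm[OF \<open>q r \<in> L2 \<mu>\<close> j] by simp
  qed
  from Lim_null_comparison[OF this lim]
  have "((\<lambda>r. (coef (y r) j - coef (y t) j) /\<^sub>R (r - t)) \<longlongrightarrow> coef (dy t) j) (at t within {0..})"
    by (simp only: LIM_zero_iff)
  then show ?thesis
    by (simp add: has_vector_derivative_iff_quotient)
qed

lemma norm_comb_tendsto_0:
  assumes "\<And>j. ((\<lambda>r. c r j) \<longlongrightarrow> 0) F"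
  shows "((\<lambda>r. l2_norm \<mu> (comb (c r) N)) \<longlongrightarrow> 0) F"
proof -
  have "l2_norm \<mu> (comb (c r) N) = sqrt (\<Sum>j=1..N. (cmod (c r j))\<^sup>2)" for r
    using norm_comb[of "c r" N] l2_norm_nonneg[of \<mu> "comb (c r) N"] by (metis real_sqrt_unique)
  moreover have "((\<lambda>r. sqrt (\<Sum>j=1..N. (cmod (c r j))\<^sup>2)) \<longlongrightarrow> sqrt (\<Sum>j=1..N. (cmod 0)\<^sup>2)) F"
    by (intro tendsto_intros assms)
  ultimately show ?thesis by simp
qed

lemma L2_continuous_comb:
  assumes "\<And>j. continuous_on {0..} (\<lambda>t. c t j)"
  shows "L2_continuous \<mu> (\<lambda>t. comb (c t) N)"
  unfolding L2_continuous_def comb_diff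
proof (intro conjI allI impI)
  fix t :: real assume "t \<ge> 0"
  then have "((\<lambda>r. c r j) \<longlongrightarrow> c t j) (at t within {0..})" for j
    using assms[of j] by (simp add: continuous_on_def)
  then have "((\<lambda>r. c r j - c t j) \<longlongrightarrow> 0) (at t within {0..})" for j
    by (simp only: LIM_zero_iff)
  then show "((\<lambda>r. l2_norm \<mu> (comb (\<lambda>j. c r j - c t j) N)) \<longlongrightarrow> 0) (at t within {0..})"
    by (rule norm_comb_tendsto_0)
qed (rule comb_L2)

lemma L2_C1_comb:
  assumes der: "\<And>j t. t \<ge> 0 \<Longrightarrow> ((\<lambda>r. c r j) has_vector_derivative dc t j) (at t within {0..})"
    and cont: "\<And>j. continuous_on {0..} (\<lambda>t. dc t j)"
  shows "L2_C1 \<mu> (\<lambda>t. comb (c t) N) (\<lambda>t. comb (dc t) N)"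
  unfolding L2_C1_def
proof (intro conjI allI impI)
  show "L2_continuous \<mu> (\<lambda>t. comb (dc t) N)" by (rule L2_continuous_comb[OF cont])
  show "L2_continuous \<mu> (\<lambda>t. comb (c t) N)"
    by (intro L2_continuous_comb continuous_on_vector_derivative[OF der]) simp
next
  fix t :: real assume t: "t \<ge> 0"
  have q: "(\<lambda>x. (comb (c r) N x - comb (c t) N x) /\<^sub>R (r - t) - comb (dc t) N x)
      = comb (\<lambda>j. (c r j - c t j) /\<^sub>R (r - t) - dc t j) N" for r
    by (simp only: comb_diff scaleR_conv_of_real comb_mult)
  have "((\<lambda>r. (c r j - c t j) /\<^sub>R (r - t) - dc t j) \<longlongrightarrow> 0) (at t within {0..})" for j
    using der[OF t, of j] by (simp add: has_vector_derivative_iff_quotient LIM_zero_iff)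
  then show "((\<lambda>r. l2_norm \<mu> (\<lambda>x. (comb (c r) N x - comb (c t) N x) /\<^sub>R (r - t) - comb (dc t) N x))
      \<longlongrightarrow> 0) (at t within {0..})"
    unfolding q by (rule norm_comb_tendsto_0)
qed

lemma resonant_energy_cong:
  assumes "\<And>i j. i \<ge> 1 \<Longrightarrow> j \<ge> 1 \<Longrightarrow> \<nu> i = \<nu> j \<longleftrightarrow> \<nu>' i = \<nu>' j"
    and "\<And>i j. i \<ge> 1 \<Longrightarrow> j \<ge> 1 \<Longrightarrow> c i * cnj (c j) = d i * cnj (d j)"
  shows "resonant_energy \<omega> \<nu> c N = resonant_energy \<omega> \<nu>' d N"
  unfolding resonant_energy_def
  by (intro arg_cong[of _ _ Re] sum.cong refl) (simp add: assms)

lemma resonant_energy_0: "(\<And>j. j \<ge> 1 \<Longrightarrow> c j = 0) \<Longrightarrow> resonant_energy \<omega> \<nu> c N = 0"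
  unfolding resonant_energy_def by (simp add: sum.neutral)

lemma resonant_energy_coef_comb:
  assumes "N \<le> M"
  shows "resonant_energy \<omega> \<nu> (coef (comb c N)) M = resonant_energy \<omega> \<nu> c N"
proof -
  have "(\<Sum>i=1..M. \<Sum>j=1..M. if \<nu> i = \<nu> j
        then coef (comb c N) i * cnj (coef (comb c N) j) * gram \<omega> i j else 0)
      = (\<Sum>i=1..N. \<Sum>j=1..N. if \<nu> i = \<nu> j then c i * cnj (c j) * gram \<omega> i j else 0)"
  proof (rule sum.mono_neutral_cong_right)
    show "\<forall>i\<in>{1..M} - {1..N}. (\<Sum>j=1..M. if \<nu> i = \<nu> j
        then coef (comb c N) i * cnj (coef (comb c N) j) * gram \<omega> i j else 0) = 0"
      by (auto simp: coef_comb intro!: sum.neutral)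
    show "(\<Sum>j=1..M. if \<nu> i = \<nu> j
          then coef (comb c N) i * cnj (coef (comb c N) j) * gram \<omega> i j else 0)
        = (\<Sum>j=1..N. if \<nu> i = \<nu> j then c i * cnj (c j) * gram \<omega> i j else 0)" if "i \<in> {1..N}" for i
      by (rule sum.mono_neutral_cong_right) (use assms that in \<open>auto simp: coef_comb\<close>)
  qed (use assms in auto)
  then show ?thesis by (simp add: resonant_energy_def)
qed

end

context laplacian_eigenbasis
begin

lemma lam_sq_pos: "j \<ge> 1 \<Longrightarrow> (lam j)\<^sup>2 > 0"
  using lam_pos[of j] by simp

lemma lam_sq_eq_iff: "i \<ge> 1 \<Longrightarrow> j \<ge> 1 \<Longrightarrow> (lam i)\<^sup>2 = (lam j)\<^sup>2 \<longleftrightarrow> lam i = lam j"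
  using lam_pos[of i] lam_pos[of j] by (simp add: power2_eq_iff)

lemma coef_A:
  "(u, w) \<in> A \<Longrightarrow> u \<in> X" "(u, w) \<in> A \<Longrightarrow> w \<in> X"
  "(u, w) \<in> A \<Longrightarrow> j \<ge> 1 \<Longrightarrow> coef w j = complex_of_real ((lam j)\<^sup>2) * coef u j"
  by (auto simp: A_eq_diag_op diag_op_def)

lemma coef_op_sqrt:
  "(u, w) \<in> op_sqrt \<mu> X A \<Longrightarrow> u \<in> X" "(u, w) \<in> op_sqrt \<mu> X A \<Longrightarrow> w \<in> X"
  "(u, w) \<in> op_sqrt \<mu> X A \<Longrightarrow> j \<ge> 1 \<Longrightarrow> coef w j = complex_of_real (lam j) * coef u j"
  by (auto simp: op_sqrt_eq_diag_op diag_op_def)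

text \<open>Each coordinate of \<open>y\<close> solves \<open>u' = \<i> \<lambda>\<^sub>j\<^sup>2 u\<close>, and \<open>dy = \<i> A y\<close>. The second amplitude, that
  of the negative frequencies, is zero.\<close>

lemma schroedinger_oscillation:
  assumes f: "(y0, f) \<in> A" and sol: "schroedinger_solution \<mu> X A y0 y dy"
    and t: "t \<ge> 0" and j: "j \<ge> 1"
  shows "coef (dy t) j
    = oscillation (\<lambda>j. (lam j)\<^sup>2) (coef (\<lambda>x. \<i> * f x)) (coef (\<lambda>x. 0)) t j"
proof -
  obtain F where F: "\<And>t. t \<ge> 0 \<Longrightarrow> (y t, F t) \<in> A"
    and ae: "\<And>t. t \<ge> 0 \<Longrightarrow> AE x in \<mu>. \<i> * dy t x = - F t x"
    and C1: "L2_C1 \<mu> y dy" and dyX: "\<And>t. t \<ge> 0 \<Longrightarrow> dy t \<in> X" and y0: "AE x in \<mu>. y 0 x = y0 x"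
    using sol by (auto simp: schroedinger_solution_def)
  define k where "k = (lam j)\<^sup>2"
  have dy: "coef (dy r) j = \<i> * complex_of_real k * coef (y r) j" if r: "r \<ge> 0" for r
  proof -
    have "AE x in \<mu>. dy r x = \<i> * F r x"
      using ae[OF r]
    proof eventually_elim
      case (elim x)
      then have "\<i> * (\<i> * dy r x) = \<i> * (- F r x)" by (rule arg_cong)
      then show ?case by simp
    qed
    then have "coef (dy r) j = coef (\<lambda>x. \<i> * F r x) j"
      by (intro coef_cong_AE j X_L2 dyX r X_mult coef_A(2)[OF F])
    also have "\<dots> = \<i> * coef (F r) j"
      by (intro coef_mult j X_L2 coef_A(2)[OF F] r)
    finally show ?thesis using coef_A(3)[OF F[OF r] j] by (simp add: k_def)
  qed
  have "coef (y t) j = coef (y 0) j * cis (k * t)"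
  proof (rule linear_ode_unique[OF _ t])
    fix r :: real assume r: "r \<ge> 0"
    show "((\<lambda>r. coef (y r) j) has_vector_derivative \<i> * complex_of_real k * coef (y r) j)
        (at r within {0..})"
      using coef_has_vector_derivative[OF C1 r j] by (simp add: dy[OF r])
  qed
  moreover have "coef (y 0) j = coef y0 j"
    by (intro coef_cong_AE j X_L2 coef_A(1)[OF F] coef_A(1)[OF f] y0) simp
  moreover have "coef (\<lambda>x. \<i> * f x) j = \<i> * (complex_of_real k * coef y0 j)"
    using coef_mult[OF X_L2[OF coef_A(2)[OF f]] j, of \<i>] coef_A(3)[OF f j] by (simp add: k_def)
  moreover have "coef (\<lambda>x. 0) j = 0" by (simp add: coef_def l2_inner_def)
  ultimately show ?thesis by (simp add: dy[OF t] oscillation_def k_def)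
qed

text \<open>The combinations \<open>y\<^sub>j' \<plusminus> \<i> \<lambda>\<^sub>j y\<^sub>j\<close> diagonalise the first order system for the coordinate \<open>j\<close>: they
  solve \<open>u' = \<plusminus>\<i> \<lambda>\<^sub>j u\<close>, and \<open>y\<^sub>j'\<close> is half of their sum.\<close>

lemma wave_oscillation:
  assumes z: "(y0, z) \<in> op_sqrt \<mu> X A" and y1: "y1 \<in> X"
    and sol: "wave_solution \<mu> X A y0 y1 y dy" and t: "t \<ge> 0" and j: "j \<ge> 1"
  shows "coef (dy t) j = oscillation lam (coef (\<lambda>x. 1 / 2 * y1 x + \<i> / 2 * z x))
    (coef (\<lambda>x. 1 / 2 * y1 x + (- \<i> / 2) * z x)) t j"
proof -
  have C1: "L2_C1 \<mu> y dy"
    and tested: "\<And>v w t. (v, w) \<in> A \<Longrightarrow> t \<ge> 0 \<Longrightarrow>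
      ((\<lambda>s. l2_inner \<mu> (dy s) v) has_vector_derivative - l2_inner \<mu> (y t) w) (at t within {0..})"
    and init: "AE x in \<mu>. y 0 x = y0 x" "AE x in \<mu>. dy 0 x = y1 x"
    using sol by (auto simp: wave_solution_def)
  have yL2: "y 0 \<in> L2 \<mu>" "dy 0 \<in> L2 \<mu>"
    using C1 by (auto simp: L2_C1_def L2_continuous_def)
  note zX = coef_op_sqrt(1,2)[OF z, THEN X_L2]
  define l where "l = complex_of_real (lam j)"
  have ev: "(e j, \<lambda>x. l\<^sup>2 * e j x) \<in> A" using eigen[OF j] by (simp add: l_def)
  have der_y: "((\<lambda>s. coef (y s) j) has_vector_derivative coef (dy r) j) (at r within {0..})"
    if "r \<ge> 0" for r by (rule coef_has_vector_derivative[OF C1 that j])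
  have der_dy: "((\<lambda>s. coef (dy s) j) has_vector_derivative - (l\<^sup>2 * coef (y r) j)) (at r within {0..})"
    if "r \<ge> 0" for r
    using tested[OF ev that] by (simp add: coef_def l2_inner_mult_right l_def)
  \<comment> \<open>Both signs at once: \<open>s\<close> is the sign, as a complex number.\<close>
  have half: "coef (dy t) j + s * (\<i> * l * coef (y t) j)
      = (coef (dy 0) j + s * (\<i> * l * coef (y 0) j)) * cis (Re s * lam j * t)"
    if s: "s = 1 \<or> s = - 1" for s
  proof (rule linear_ode_unique[where u = "\<lambda>t. coef (dy t) j + s * (\<i> * l * coef (y t) j)", OF _ t])
    fix r :: real assume r: "r \<ge> 0"
    have "((\<lambda>t. coef (dy t) j + s * (\<i> * l * coef (y t) j)) has_vector_derivative
        - (l\<^sup>2 * coef (y r) j) + s * (\<i> * l * coef (dy r) j)) (at r within {0..})"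
      by (intro has_vector_derivative_add der_dy r has_vector_derivative_mult_right der_y)
    also have "- (l\<^sup>2 * coef (y r) j) + s * (\<i> * l * coef (dy r) j)
        = \<i> * complex_of_real (Re s * lam j) * (coef (dy r) j + s * (\<i> * l * coef (y r) j))"
      using s by (auto simp: l_def algebra_simps power2_eq_square)
    finally show "((\<lambda>t. coef (dy t) j + s * (\<i> * l * coef (y t) j)) has_vector_derivative
        \<i> * complex_of_real (Re s * lam j) * (coef (dy r) j + s * (\<i> * l * coef (y r) j)))
        (at r within {0..})" .
  qed
  have y0: "coef (y 0) j = coef y0 j" and dy0: "coef (dy 0) j = coef y1 j"
    using coef_cong_AE[OF yL2(1) zX(1) init(1) j] coef_cong_AE[OF yL2(2) X_L2[OF y1] init(2) j] by auto
  have zc: "coef z j = l * coef y0 j" using coef_op_sqrt(3)[OF z j] by (simp add: l_def)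
  have p: "coef (dy t) j + \<i> * l * coef (y t) j = (coef y1 j + \<i> * coef z j) * cis (lam j * t)"
    using half[of 1] by (simp add: y0 dy0 zc mult.assoc)
  have m: "coef (dy t) j - \<i> * l * coef (y t) j = (coef y1 j - \<i> * coef z j) * cis (- (lam j * t))"
    using half[of "- 1"] by (simp add: y0 dy0 zc mult.assoc)
  have "coef (dy t) j = ((coef (dy t) j + \<i> * l * coef (y t) j) + (coef (dy t) j - \<i> * l * coef (y t) j)) / 2"
    by simp
  also have "\<dots> = (1 / 2 * coef y1 j + \<i> / 2 * coef z j) * cis (lam j * t)
      + (1 / 2 * coef y1 j + (- \<i> / 2) * coef z j) * cis (- (lam j * t))"
    unfolding p m by (simp add: field_simps)
  also have "\<dots> = oscillation lam (coef (\<lambda>x. 1 / 2 * y1 x + \<i> / 2 * z x))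
      (coef (\<lambda>x. 1 / 2 * y1 x + (- \<i> / 2) * z x)) t j"
    unfolding oscillation_def coef_lin[OF X_L2[OF y1] zX(2) j] ..
  finally show ?thesis .
qed

text \<open>The explicit solution with finitely many coordinates \<open>c\<^sub>j\<close> of \<open>A y0\<close>.\<close>

lemma comb_schroedinger_solution:
  fixes c :: "nat \<Rightarrow> complex" and N :: nat
  defines "l \<equiv> \<lambda>j. complex_of_real (lam j)"
  shows "(comb (\<lambda>j. c j / (l j)\<^sup>2) N, comb c N) \<in> A"
    and "schroedinger_solution \<mu> X A (comb (\<lambda>j. c j / (l j)\<^sup>2) N)
      (\<lambda>t. comb (\<lambda>j. c j / (l j)\<^sup>2 * cis ((lam j)\<^sup>2 * t)) N)
      (\<lambda>t. comb (\<lambda>j. \<i> * c j * cis ((lam j)\<^sup>2 * t)) N)"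
proof -
  have l: "l j \<noteq> 0" if "j \<ge> 1" for j using lam_pos[OF that] by (simp add: l_def)
  show "(comb (\<lambda>j. c j / (l j)\<^sup>2) N, comb c N) \<in> A"
    unfolding A_eq_diag_op by (rule comb_diag_op) (use l in \<open>auto simp: l_def\<close>)
  \<comment> \<open>The derivative of the coordinate \<open>0\<close>, where \<open>lam 0\<close> may vanish, is wrong for \<open>c\<close>; since the
    coordinate does not enter the sums, it is set to zero.\<close>
  define d where "d j = (if j = 0 then 0 else c j)" for j
  have comb_d: "comb (\<lambda>j. c j * g j) N = comb (\<lambda>j. d j * g j) N" for g
    unfolding comb_def d_def by (intro ext sum.cong) auto
  show "schroedinger_solution \<mu> X A (comb (\<lambda>j. c j / (l j)\<^sup>2) N)
      (\<lambda>t. comb (\<lambda>j. c j / (l j)\<^sup>2 * cis ((lam j)\<^sup>2 * t)) N)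
      (\<lambda>t. comb (\<lambda>j. \<i> * c j * cis ((lam j)\<^sup>2 * t)) N)"
    unfolding schroedinger_solution_def
  proof (intro conjI exI[of _ "\<lambda>t. comb (\<lambda>j. c j * cis ((lam j)\<^sup>2 * t)) N"] allI impI)
    show "(comb (\<lambda>j. c j / (l j)\<^sup>2 * cis ((lam j)\<^sup>2 * t)) N, comb (\<lambda>j. c j * cis ((lam j)\<^sup>2 * t)) N) \<in> A"
      for t
      unfolding A_eq_diag_op by (rule comb_diag_op) (use l in \<open>auto simp: l_def\<close>)
    show "L2_continuous \<mu> (\<lambda>t. comb (\<lambda>j. c j * cis ((lam j)\<^sup>2 * t)) N)"
      by (intro L2_continuous_comb continuous_intros)
    show "AE x in \<mu>. \<i> * comb (\<lambda>j. \<i> * c j * cis ((lam j)\<^sup>2 * t)) N x = - comb (\<lambda>j. c j * cis ((lam j)\<^sup>2 * t)) N x"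
      for t
      by (simp add: comb_def sum_distrib_left mult.assoc[symmetric] flip: sum_negf)
    have "(\<lambda>t. comb (\<lambda>j. c j / (l j)\<^sup>2 * cis ((lam j)\<^sup>2 * t)) N)
        = (\<lambda>t. comb (\<lambda>j. d j / (l j)\<^sup>2 * cis ((lam j)\<^sup>2 * t)) N)"
      "(\<lambda>t. comb (\<lambda>j. \<i> * c j * cis ((lam j)\<^sup>2 * t)) N)
        = (\<lambda>t. comb (\<lambda>j. \<i> * d j * cis ((lam j)\<^sup>2 * t)) N)"
      using comb_d[of "\<lambda>j. cis ((lam j)\<^sup>2 * t) / (l j)\<^sup>2" for t]
        comb_d[of "\<lambda>j. \<i> * cis ((lam j)\<^sup>2 * t)" for t] by (simp_all add: mult_ac)
    then show "L2_C1 \<mu> (\<lambda>t. comb (\<lambda>j. c j / (l j)\<^sup>2 * cis ((lam j)\<^sup>2 * t)) N)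
        (\<lambda>t. comb (\<lambda>j. \<i> * c j * cis ((lam j)\<^sup>2 * t)) N)"
    proof (simp only:, intro L2_C1_comb continuous_intros)
      fix j t
      have "((\<lambda>t. d j / (l j)\<^sup>2 * cis ((lam j)\<^sup>2 * t)) has_vector_derivative
          d j / (l j)\<^sup>2 * (\<i> * complex_of_real ((lam j)\<^sup>2) * cis ((lam j)\<^sup>2 * t))) (at t within {0..})"
        by (intro has_vector_derivative_mult_right has_vector_derivative_cis)
      moreover have "d j / (l j)\<^sup>2 * (\<i> * complex_of_real ((lam j)\<^sup>2) * cis ((lam j)\<^sup>2 * t))
          = \<i> * d j * cis ((lam j)\<^sup>2 * t)"
        using l[of j] by (cases "j = 0") (auto simp: d_def l_def)
      ultimately show "((\<lambda>t. d j / (l j)\<^sup>2 * cis ((lam j)\<^sup>2 * t)) has_vector_derivative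
          \<i> * d j * cis ((lam j)\<^sup>2 * t)) (at t within {0..})" by simp
    qed
    show "comb (\<lambda>j. \<i> * c j * cis ((lam j)\<^sup>2 * t)) N \<in> X" for t by (rule comb_X)
  qed simp
qed

end

context laplacian_eigenbasis
begin

text \<open>The initial data are chosen such that only positive frequencies occur.\<close>

lemma comb_wave_solution:
  fixes c :: "nat \<Rightarrow> complex" and N :: nat
  defines "y0 \<equiv> comb (\<lambda>j. - \<i> * c j / complex_of_real (lam j)) N"
  shows "(y0, \<lambda>x. - \<i> * comb c N x) \<in> op_sqrt \<mu> X A"
    and "wave_solution \<mu> X A y0 (comb c N)
      (\<lambda>t. comb (\<lambda>j. - \<i> * c j / complex_of_real (lam j) * cis (lam j * t)) N)
      (\<lambda>t. comb (\<lambda>j. c j * cis (lam j * t)) N)"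
proof -
  define l where "l j = complex_of_real (lam j)" for j
  have l: "l j \<noteq> 0" if "j \<ge> 1" for j using lam_pos[OF that] by (simp add: l_def)
  have sqrt: "(comb (\<lambda>j. - \<i> * c j / l j * g j) N, comb (\<lambda>j. - \<i> * c j * g j) N) \<in> op_sqrt \<mu> X A" for g
    unfolding op_sqrt_eq_diag_op by (rule comb_diag_op) (use l in \<open>auto simp: l_def\<close>)
  show "(y0, \<lambda>x. - \<i> * comb c N x) \<in> op_sqrt \<mu> X A"
    unfolding comb_mult using sqrt[of "\<lambda>j. 1"] by (simp add: y0_def l_def)
  \<comment> \<open>The derivative of the coordinate \<open>0\<close>, where \<open>lam 0\<close> may vanish, is wrong for \<open>c\<close>; since the
    coordinate does not enter the sums, it is set to zero.\<close>
  define d where "d j = (if j = 0 then 0 else c j)" for j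
  have comb_d: "comb (\<lambda>j. c j * g j) N = comb (\<lambda>j. d j * g j) N" for g
    unfolding comb_def d_def by (intro ext sum.cong) auto
  have "wave_solution \<mu> X A y0 (comb c N)
      (\<lambda>t. comb (\<lambda>j. - \<i> * c j / l j * cis (lam j * t)) N) (\<lambda>t. comb (\<lambda>j. c j * cis (lam j * t)) N)"
    unfolding wave_solution_def
  proof (intro conjI allI impI)
    show "\<exists>z. (\<forall>t\<ge>0. (comb (\<lambda>j. - \<i> * c j / l j * cis (lam j * t)) N, z t) \<in> op_sqrt \<mu> X A)
        \<and> L2_continuous \<mu> z"
    proof (intro exI conjI allI impI)
      show "(comb (\<lambda>j. - \<i> * c j / l j * cis (lam j * t)) N, comb (\<lambda>j. - \<i> * c j * cis (lam j * t)) N)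
          \<in> op_sqrt \<mu> X A" for t by (rule sqrt)
      show "L2_continuous \<mu> (\<lambda>t. comb (\<lambda>j. - \<i> * c j * cis (lam j * t)) N)"
        by (intro L2_continuous_comb continuous_intros)
    qed
    have "(\<lambda>t. comb (\<lambda>j. - \<i> * c j / l j * cis (lam j * t)) N)
        = (\<lambda>t. comb (\<lambda>j. - \<i> * d j / l j * cis (lam j * t)) N)"
      "(\<lambda>t. comb (\<lambda>j. c j * cis (lam j * t)) N) = (\<lambda>t. comb (\<lambda>j. d j * cis (lam j * t)) N)"
      using comb_d[of "\<lambda>j. - \<i> * cis (lam j * t) / l j" for t]
        comb_d[of "\<lambda>j. cis (lam j * t)" for t] by (simp_all add: mult_ac)
    then show "L2_C1 \<mu> (\<lambda>t. comb (\<lambda>j. - \<i> * c j / l j * cis (lam j * t)) N)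
        (\<lambda>t. comb (\<lambda>j. c j * cis (lam j * t)) N)"
    proof (simp only:, intro L2_C1_comb continuous_intros)
      fix j t
      have "((\<lambda>t. - \<i> * d j / l j * cis (lam j * t)) has_vector_derivative
          - \<i> * d j / l j * (\<i> * complex_of_real (lam j) * cis (lam j * t))) (at t within {0..})"
        by (intro has_vector_derivative_mult_right has_vector_derivative_cis)
      moreover have "- \<i> * d j / l j * (\<i> * complex_of_real (lam j) * cis (lam j * t)) = d j * cis (lam j * t)"
        using l[of j] by (cases "j = 0") (auto simp: d_def l_def mult.left_commute[of "c j" \<i>])
      ultimately show "((\<lambda>t. - \<i> * d j / l j * cis (lam j * t)) has_vector_derivative
          d j * cis (lam j * t)) (at t within {0..})" by (simp only:)
    qed
    show "comb (\<lambda>j. c j * cis (lam j * t)) N \<in> X" for t by (rule comb_X)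
    show "\<forall>(v, w)\<in>A. \<forall>t\<ge>0. ((\<lambda>s. l2_inner \<mu> (comb (\<lambda>j. c j * cis (lam j * s)) N) v) has_vector_derivative
        - l2_inner \<mu> (comb (\<lambda>j. - \<i> * c j / l j * cis (lam j * t)) N) w) (at t within {0..})"
    proof (clarify)
      fix v w and t :: real assume vw: "(v, w) \<in> A"
      note vwL2 = coef_A(1,2)[OF vw, THEN X_L2]
      have "((\<lambda>s. \<Sum>j=1..N. c j * cis (lam j * s) * cnj (coef v j)) has_vector_derivative
          (\<Sum>j=1..N. c j * (\<i> * complex_of_real (lam j) * cis (lam j * t)) * cnj (coef v j)))
          (at t within {0..})"
        by (intro has_vector_derivative_sum has_vector_derivative_mult_left
            has_vector_derivative_mult_right has_vector_derivative_cis)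
      also have "(\<Sum>j=1..N. c j * (\<i> * complex_of_real (lam j) * cis (lam j * t)) * cnj (coef v j))
          = - (\<Sum>j=1..N. - \<i> * c j / l j * cis (lam j * t) * cnj (coef w j))"
        unfolding sum_negf[symmetric]
        by (intro sum.cong refl) (use l in \<open>auto simp: coef_A(3)[OF vw] l_def power2_eq_square mult_ac\<close>)
      finally show "((\<lambda>s. l2_inner \<mu> (comb (\<lambda>j. c j * cis (lam j * s)) N) v) has_vector_derivative
          - l2_inner \<mu> (comb (\<lambda>j. - \<i> * c j / l j * cis (lam j * t)) N) w) (at t within {0..})"
        by (simp only: inner_comb_left[OF vwL2(1)] inner_comb_left[OF vwL2(2)])
    qed
  qed (simp_all add: y0_def l_def)
  then show "wave_solution \<mu> X A y0 (comb c N)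
      (\<lambda>t. comb (\<lambda>j. - \<i> * c j / complex_of_real (lam j) * cis (lam j * t)) N)
      (\<lambda>t. comb (\<lambda>j. c j * cis (lam j * t)) N)" by (simp only: l_def)
qed

section \<open>Asymptotic observability constants as Rayleigh quotients\<close>

text \<open>The denominators in \<open>C_schroedinger\<close> and \<open>C_wave\<close> are norms of images under \<open>A\<close> and \<open>A\<^sup>1\<^sup>/\<^sup>2\<close>, while
  the data are only assumed to be nonzero; both operators are injective.\<close>

lemma norm_sq_pos_if_image_nonzero:
  assumes "u \<in> X" "w \<in> X" "\<And>j. j \<ge> 1 \<Longrightarrow> coef w j = k j * coef u j" "\<And>j. j \<ge> 1 \<Longrightarrow> k j \<noteq> 0"
    and "\<not> (AE x in \<mu>. u x = 0)"
  shows "(l2_norm \<mu> w)\<^sup>2 > 0"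
proof (rule ccontr)
  assume "\<not> (l2_norm \<mu> w)\<^sup>2 > 0"
  then have "l2_norm \<mu> w = 0" by (simp add: not_less)
  then have "coef u j = 0" if "j \<ge> 1" for j
    using coef_le_norm[OF X_L2[OF assms(2)] that] assms(3,4)[OF that] by simp
  then have "l2_norm \<mu> u = 0" by (rule norm_zero_if_coef_zero[OF assms(1)])
  then show False using assms(5) by (simp add: l2_norm_eq_0_iff X_L2[OF assms(1)])
qed

text \<open>The amplitude of \<open>dy\<close> is \<open>\<i> A y0\<close>, and a constant phase does not change the resonant energy. The
  frequencies are \<open>\<lambda>\<^sub>j\<^sup>2\<close>, with the same coincidences as \<open>\<lambda>\<^sub>j\<close>.\<close>

lemma schroedinger_time_mean:
  assumes \<omega>: "\<omega> \<in> sets \<mu>" and f: "(y0, f) \<in> A" and sol: "schroedinger_solution \<mu> X A y0 y dy"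
  obtains L where "(\<lambda>N. resonant_energy \<omega> lam (coef f) N) \<longlonglongrightarrow> L"
    "Lim at_top (\<lambda>T. 1 / T * ((LINT t:{0..T}|lborel. (LINT x:\<omega>|\<mu>. (cmod (dy t x))\<^sup>2)) / K)) = L / K"
proof -
  have fX: "f \<in> X" by (rule coef_A(2)[OF f])
  have dy: "L2_continuous \<mu> dy" "\<And>t. t \<ge> 0 \<Longrightarrow> dy t \<in> X"
    using sol by (auto simp: schroedinger_solution_def L2_C1_def)
  obtain L where L: "(\<lambda>N. resonant_energy \<omega> (\<lambda>j. (lam j)\<^sup>2) (coef (\<lambda>x. \<i> * f x)) N
        + resonant_energy \<omega> (\<lambda>j. (lam j)\<^sup>2) (coef (\<lambda>x. 0)) N) \<longlonglongrightarrow> L"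
    and mean: "has_time_mean (\<lambda>t. LINT x:\<omega>|\<mu>. (cmod (dy t x))\<^sup>2) L"
    by (rule time_mean_local_energy[OF \<omega> lam_sq_pos dy X_mult[OF fX] zero_X
          schroedinger_oscillation[OF f sol]])
  have "resonant_energy \<omega> (\<lambda>j. (lam j)\<^sup>2) (coef (\<lambda>x. \<i> * f x)) N = resonant_energy \<omega> lam (coef f) N" for N
    by (rule resonant_energy_cong) (simp_all add: lam_sq_eq_iff coef_mult[OF X_L2[OF fX]] mult_ac)
  moreover have "resonant_energy \<omega> (\<lambda>j. (lam j)\<^sup>2) (coef (\<lambda>x. 0)) N = 0" for N
    by (rule resonant_energy_0) (simp add: coef_def l2_inner_def)
  ultimately show thesis
    using that[of L] L Lim_time_average_quotient[OF mean] by simp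
qed

lemma wave_time_mean:
  assumes \<omega>: "\<omega> \<in> sets \<mu>" and z: "(y0, z) \<in> op_sqrt \<mu> X A" and y1: "y1 \<in> X"
    and sol: "wave_solution \<mu> X A y0 y1 y dy"
  obtains L where
    "(\<lambda>N. resonant_energy \<omega> lam (coef (\<lambda>x. 1 / 2 * y1 x + \<i> / 2 * z x)) N
        + resonant_energy \<omega> lam (coef (\<lambda>x. 1 / 2 * y1 x + (- \<i> / 2) * z x)) N) \<longlonglongrightarrow> L"
    "Lim at_top (\<lambda>T. 1 / T * ((LINT t:{0..T}|lborel. (LINT x:\<omega>|\<mu>. (cmod (dy t x))\<^sup>2)) / K)) = L / K"
proof -
  have zX: "z \<in> X" by (rule coef_op_sqrt(2)[OF z])
  have dy: "L2_continuous \<mu> dy" "\<And>t. t \<ge> 0 \<Longrightarrow> dy t \<in> X"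
    using sol by (auto simp: wave_solution_def L2_C1_def)
  obtain L where L: "(\<lambda>N. resonant_energy \<omega> lam (coef (\<lambda>x. 1 / 2 * y1 x + \<i> / 2 * z x)) N
        + resonant_energy \<omega> lam (coef (\<lambda>x. 1 / 2 * y1 x + (- \<i> / 2) * z x)) N) \<longlonglongrightarrow> L"
    and mean: "has_time_mean (\<lambda>t. LINT x:\<omega>|\<mu>. (cmod (dy t x))\<^sup>2) L"
    by (rule time_mean_local_energy[OF \<omega> lam_pos dy X_lin[OF y1 zX] X_lin[OF y1 zX]
          wave_oscillation[OF z y1 sol]])
  show thesis by (rule that[OF L Lim_time_average_quotient[OF mean]])
qed

text \<open>Finitely supported coefficients suffice, because both the resonant energy and the norm of arbitrary
  data are limits over truncations.\<close>

definition rayleigh_quotients :: "'a set \<Rightarrow> real set" where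
  "rayleigh_quotients \<omega> =
    {resonant_energy \<omega> lam c N / (\<Sum>j=1..N. (cmod (c j))\<^sup>2) | c N. (\<Sum>j=1..N. (cmod (c j))\<^sup>2) \<noteq> 0}"

text \<open>\<open>C_schroedinger\<close> and \<open>C_wave\<close> are by definition the infima of the following two sets.\<close>

definition schroedinger_quotients :: "'a set \<Rightarrow> real set" where
  "schroedinger_quotients \<omega> =
     {Lim at_top (\<lambda>T. 1 / T *
        ((LINT t:{0..T}|lborel. (LINT x:\<omega>|\<mu>. (cmod (dy t x))\<^sup>2)) / (l2_norm \<mu> f)\<^sup>2)) | y0 f y dy.
      (y0, f) \<in> A \<and> \<not> (AE x in \<mu>. y0 x = 0) \<and> schroedinger_solution \<mu> X A y0 y dy}"

definition wave_quotients :: "'a set \<Rightarrow> real set" where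
  "wave_quotients \<omega> =
     {Lim at_top (\<lambda>T. 1 / T *
        ((LINT t:{0..T}|lborel. (LINT x:\<omega>|\<mu>. (cmod (dy t x))\<^sup>2)) /
         ((l2_norm \<mu> z)\<^sup>2 + (l2_norm \<mu> y1)\<^sup>2))) | y0 y1 z y dy.
      (y0, z) \<in> op_sqrt \<mu> X A \<and> y1 \<in> X \<and>
      \<not> ((AE x in \<mu>. y0 x = 0) \<and> (AE x in \<mu>. y1 x = 0)) \<and>
      wave_solution \<mu> X A y0 y1 y dy}"

lemma comb_nonzero_coef:
  assumes "(\<Sum>j=1..N. (cmod (c j))\<^sup>2) \<noteq> 0" and "AE x in \<mu>. comb d N x = 0"
    and "\<And>j. j \<ge> 1 \<Longrightarrow> d j = 0 \<Longrightarrow> c j = 0"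
  shows False
proof -
  have "l2_norm \<mu> (comb d N) = 0" using assms(2) by (simp add: l2_norm_eq_0_iff comb_L2)
  then have "(\<Sum>j=1..N. (cmod (d j))\<^sup>2) = 0" using norm_comb[of d N] by simp
  then have "d j = 0" if "j \<in> {1..N}" for j using that by (subst (asm) sum_nonneg_eq_0_iff) auto
  then have "c j = 0" if "j \<in> {1..N}" for j using that assms(3)[of j] by auto
  then show False using assms(1) by simp
qed

lemma resonant_energy_coef_comb_tendsto:
  "(\<lambda>M. resonant_energy \<omega> \<nu> (coef (comb c N)) M) \<longlonglongrightarrow> resonant_energy \<omega> \<nu> c N"
  by (rule tendsto_eventually, rule eventually_sequentiallyI[of N]) (rule resonant_energy_coef_comb)

lemma rayleigh_subset_schroedinger:
  assumes \<omega>: "\<omega> \<in> sets \<mu>"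
  shows "rayleigh_quotients \<omega> \<subseteq> schroedinger_quotients \<omega>"
proof
  fix r assume "r \<in> rayleigh_quotients \<omega>"
  then obtain c N where r: "r = resonant_energy \<omega> lam c N / (\<Sum>j=1..N. (cmod (c j))\<^sup>2)"
    and nz: "(\<Sum>j=1..N. (cmod (c j))\<^sup>2) \<noteq> 0"
    by (auto simp: rayleigh_quotients_def)
  define y0 where "y0 = comb (\<lambda>j. c j / (complex_of_real (lam j))\<^sup>2) N"
  note f = comb_schroedinger_solution(1)[of c N, folded y0_def]
    and sol = comb_schroedinger_solution(2)[of c N, folded y0_def]
  define dy where "dy t = comb (\<lambda>j. \<i> * c j * cis ((lam j)\<^sup>2 * t)) N" for t
  obtain L where L: "(\<lambda>M. resonant_energy \<omega> lam (coef (comb c N)) M) \<longlonglongrightarrow> L"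
    and Lim: "Lim at_top (\<lambda>T. 1 / T * ((LINT t:{0..T}|lborel. (LINT x:\<omega>|\<mu>. (cmod (dy t x))\<^sup>2))
      / (l2_norm \<mu> (comb c N))\<^sup>2)) = L / (l2_norm \<mu> (comb c N))\<^sup>2"
    by (rule schroedinger_time_mean[OF \<omega> f sol, folded dy_def, where K = "(l2_norm \<mu> (comb c N))\<^sup>2"])
  have Lval: "L = resonant_energy \<omega> lam c N"
    by (rule LIMSEQ_unique[OF L resonant_energy_coef_comb_tendsto])
  have "\<not> (AE x in \<mu>. y0 x = 0)"
  proof
    assume ae: "AE x in \<mu>. y0 x = 0"
    show False
      by (rule comb_nonzero_coef[OF nz ae[unfolded y0_def]]) (use lam_pos in force)
  qed
  moreover have "r = Lim at_top (\<lambda>T. 1 / T * ((LINT t:{0..T}|lborel. (LINT x:\<omega>|\<mu>. (cmod (dy t x))\<^sup>2))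
      / (l2_norm \<mu> (comb c N))\<^sup>2))"
    by (rule trans[OF _ Lim[symmetric]]) (simp only: r norm_comb Lval)
  ultimately show "r \<in> schroedinger_quotients \<omega>"
    unfolding schroedinger_quotients_def mem_Collect_eq
    by (intro exI[of _ y0] exI[of _ "comb c N"] exI[of _ dy]
        exI[of _ "\<lambda>t. comb (\<lambda>j. c j / (complex_of_real (lam j))\<^sup>2 * cis ((lam j)\<^sup>2 * t)) N"]
        conjI f sol[folded dy_def])
qed

text \<open>For the solution of \<open>comb_wave_solution\<close> both terms of the denominator are equal to the squared norm
  of \<open>c\<close>, hence the factor \<open>1/2\<close>.\<close>

lemma rayleigh_half_subset_wave:
  assumes \<omega>: "\<omega> \<in> sets \<mu>" and r: "r \<in> rayleigh_quotients \<omega>"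
  shows "r / 2 \<in> wave_quotients \<omega>"
proof -
  obtain c N where r: "r = resonant_energy \<omega> lam c N / (\<Sum>j=1..N. (cmod (c j))\<^sup>2)"
    and nz: "(\<Sum>j=1..N. (cmod (c j))\<^sup>2) \<noteq> 0"
    using r by (auto simp: rayleigh_quotients_def)
  define y0 where "y0 = comb (\<lambda>j. - \<i> * c j / complex_of_real (lam j)) N"
  define z where "z = (\<lambda>x. - \<i> * comb c N x)"
  define K where "K = (l2_norm \<mu> z)\<^sup>2 + (l2_norm \<mu> (comb c N))\<^sup>2"
  note zs = comb_wave_solution(1)[of c N, folded y0_def z_def]
    and sol = comb_wave_solution(2)[of c N, folded y0_def]
  define dy where "dy t = comb (\<lambda>j. c j * cis (lam j * t)) N" for t
  obtain L where L: "(\<lambda>M. resonant_energy \<omega> lam (coef (\<lambda>x. 1 / 2 * comb c N x + \<i> / 2 * z x)) M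
        + resonant_energy \<omega> lam (coef (\<lambda>x. 1 / 2 * comb c N x + (- \<i> / 2) * z x)) M) \<longlonglongrightarrow> L"
    and Lim: "Lim at_top (\<lambda>T. 1 / T * ((LINT t:{0..T}|lborel. (LINT x:\<omega>|\<mu>. (cmod (dy t x))\<^sup>2)) / K)) = L / K"
    by (rule wave_time_mean[OF \<omega> zs comb_X sol, folded dy_def, where K = K])
  have "(\<lambda>x. 1 / 2 * comb c N x + \<i> / 2 * z x) = comb c N"
    "(\<lambda>x. 1 / 2 * comb c N x + (- \<i> / 2) * z x) = (\<lambda>x. 0)"
    by (simp_all add: z_def fun_eq_iff)
  moreover have "resonant_energy \<omega> lam (coef (\<lambda>x. 0)) M = 0" for M
    by (rule resonant_energy_0) (simp add: coef_def l2_inner_def)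
  ultimately have "(\<lambda>M. resonant_energy \<omega> lam (coef (comb c N)) M) \<longlonglongrightarrow> L" using L by simp
  then have Lval: "L = resonant_energy \<omega> lam c N"
    by (rule LIMSEQ_unique[OF _ resonant_energy_coef_comb_tendsto])
  have Kval: "K = 2 * (\<Sum>j=1..N. (cmod (c j))\<^sup>2)"
    unfolding K_def z_def l2_norm_mult by (simp add: norm_comb)
  have val: "r / 2 = Lim at_top (\<lambda>T. 1 / T * ((LINT t:{0..T}|lborel. (LINT x:\<omega>|\<mu>. (cmod (dy t x))\<^sup>2)) / K))"
    by (rule trans[OF _ Lim[symmetric]]) (simp add: r Kval Lval)
  have "\<not> (AE x in \<mu>. comb c N x = 0)" using comb_nonzero_coef[OF nz] by blast
  then show ?thesis
    unfolding wave_quotients_def mem_Collect_eq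
    by (intro exI[of _ y0] exI[of _ "comb c N"] exI[of _ z] exI[of _ dy]
        exI[of _ "\<lambda>t. comb (\<lambda>j. - \<i> * c j / complex_of_real (lam j) * cis (lam j * t)) N"]
        conjI zs sol[folded dy_def] comb_X val[unfolded K_def]) blast
qed

lemma resonant_energy_ge:
  assumes K: "\<And>r. r \<in> rayleigh_quotients \<omega> \<Longrightarrow> K \<le> r"
  shows "K * (\<Sum>j=1..N. (cmod (c j))\<^sup>2) \<le> resonant_energy \<omega> lam c N"
proof (cases "(\<Sum>j=1..N. (cmod (c j))\<^sup>2) = 0")
  case True
  then have c: "c j = 0" if "j \<in> {1..N}" for j
    using that by (subst (asm) sum_nonneg_eq_0_iff) auto
  have "resonant_energy \<omega> lam c N = Re (\<Sum>i=1..N. \<Sum>j=1..N. 0)"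
    unfolding resonant_energy_def by (intro arg_cong[of _ _ Re] sum.cong refl) (simp add: c)
  then show ?thesis using True by simp
next
  case False
  then have "(\<Sum>j=1..N. (cmod (c j))\<^sup>2) > 0" by (simp add: sum_nonneg order_less_le)
  moreover have "K \<le> resonant_energy \<omega> lam c N / (\<Sum>j=1..N. (cmod (c j))\<^sup>2)"
    using False by (intro K) (auto simp: rayleigh_quotients_def)
  ultimately show ?thesis by (simp add: pos_le_divide_eq)
qed

lemma schroedinger_quotients_ge:
  assumes \<omega>: "\<omega> \<in> sets \<mu>" and K: "\<And>r. r \<in> rayleigh_quotients \<omega> \<Longrightarrow> K \<le> r"
    and q: "q \<in> schroedinger_quotients \<omega>"
  shows "K \<le> q"
proof -
  obtain y0 f y dy where f: "(y0, f) \<in> A" and nz: "\<not> (AE x in \<mu>. y0 x = 0)"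
    and sol: "schroedinger_solution \<mu> X A y0 y dy"
    and qL: "q = Lim at_top (\<lambda>T. 1 / T *
        ((LINT t:{0..T}|lborel. (LINT x:\<omega>|\<mu>. (cmod (dy t x))\<^sup>2)) / (l2_norm \<mu> f)\<^sup>2))"
    using q by (auto simp: schroedinger_quotients_def)
  have pos: "(l2_norm \<mu> f)\<^sup>2 > 0"
    by (rule norm_sq_pos_if_image_nonzero[OF coef_A(1)[OF f] coef_A(2)[OF f] coef_A(3)[OF f] _ nz])
      (use lam_pos in force)+
  obtain L where L: "(\<lambda>N. resonant_energy \<omega> lam (coef f) N) \<longlonglongrightarrow> L"
    and Lim: "Lim at_top (\<lambda>T. 1 / T * ((LINT t:{0..T}|lborel. (LINT x:\<omega>|\<mu>. (cmod (dy t x))\<^sup>2))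
      / (l2_norm \<mu> f)\<^sup>2)) = L / (l2_norm \<mu> f)\<^sup>2"
    by (rule schroedinger_time_mean[OF \<omega> f sol, where K = "(l2_norm \<mu> f)\<^sup>2"])
  note val = trans[OF qL Lim]
  have "K * (l2_norm \<mu> f)\<^sup>2 \<le> L"
    by (rule LIMSEQ_le[OF tendsto_mult[OF tendsto_const Parseval_norm[OF coef_A(2)[OF f]]] L])
      (intro exI allI impI resonant_energy_ge K)
  then show ?thesis using pos by (simp add: val pos_le_divide_eq)
qed

text \<open>With the amplitudes \<open>a\<close> and \<open>b\<close> of the positive and the negative frequencies, the denominator is
  \<open>2 (\<parallel>a\<parallel>\<^sup>2 + \<parallel>b\<parallel>\<^sup>2)\<close>.\<close>

lemma wave_quotients_ge:
  assumes \<omega>: "\<omega> \<in> sets \<mu>" and K: "\<And>r. r \<in> rayleigh_quotients \<omega> \<Longrightarrow> K \<le> r"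
    and q: "q \<in> wave_quotients \<omega>"
  shows "K / 2 \<le> q"
proof -
  obtain y0 y1 z y dy where z: "(y0, z) \<in> op_sqrt \<mu> X A" and y1: "y1 \<in> X"
    and nz: "\<not> ((AE x in \<mu>. y0 x = 0) \<and> (AE x in \<mu>. y1 x = 0))"
    and sol: "wave_solution \<mu> X A y0 y1 y dy"
    and qL: "q = Lim at_top (\<lambda>T. 1 / T *
        ((LINT t:{0..T}|lborel. (LINT x:\<omega>|\<mu>. (cmod (dy t x))\<^sup>2)) / ((l2_norm \<mu> z)\<^sup>2 + (l2_norm \<mu> y1)\<^sup>2)))"
    using q unfolding wave_quotients_def by blast
  define a where "a = (\<lambda>x. 1 / 2 * y1 x + \<i> / 2 * z x)"
  define b where "b = (\<lambda>x. 1 / 2 * y1 x + (- \<i> / 2) * z x)"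
  have zX: "z \<in> X" by (rule coef_op_sqrt(2)[OF z])
  have aX: "a \<in> X" and bX: "b \<in> X" unfolding a_def b_def by (intro X_lin y1 zX)+
  have ab: "(l2_norm \<mu> a)\<^sup>2 + (l2_norm \<mu> b)\<^sup>2 = ((l2_norm \<mu> z)\<^sup>2 + (l2_norm \<mu> y1)\<^sup>2) / 2"
    unfolding a_def b_def l2_norm_parallelogram[OF X_L2[OF y1] X_L2[OF zX]] by simp
  have pos: "(l2_norm \<mu> z)\<^sup>2 + (l2_norm \<mu> y1)\<^sup>2 > 0"
  proof (cases "AE x in \<mu>. y1 x = 0")
    case True
    then have "\<not> (AE x in \<mu>. y0 x = 0)" using nz by blast
    then have "(l2_norm \<mu> z)\<^sup>2 > 0"
      by (rule norm_sq_pos_if_image_nonzero[OF coef_op_sqrt(1)[OF z] zX coef_op_sqrt(3)[OF z], rotated 2])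
        (use lam_pos in force)+
    then show ?thesis by (simp add: add_pos_nonneg)
  next
    case False
    then have "l2_norm \<mu> y1 \<noteq> 0" by (simp add: l2_norm_eq_0_iff X_L2[OF y1])
    then show ?thesis by (simp add: add_nonneg_pos)
  qed
  obtain L where L: "(\<lambda>N. resonant_energy \<omega> lam (coef a) N + resonant_energy \<omega> lam (coef b) N) \<longlonglongrightarrow> L"
    and Lim: "Lim at_top (\<lambda>T. 1 / T * ((LINT t:{0..T}|lborel. (LINT x:\<omega>|\<mu>. (cmod (dy t x))\<^sup>2))
      / ((l2_norm \<mu> z)\<^sup>2 + (l2_norm \<mu> y1)\<^sup>2))) = L / ((l2_norm \<mu> z)\<^sup>2 + (l2_norm \<mu> y1)\<^sup>2)"
    by (rule wave_time_mean[OF \<omega> z y1 sol, folded a_def b_def,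
        where K = "(l2_norm \<mu> z)\<^sup>2 + (l2_norm \<mu> y1)\<^sup>2"])
  note val = trans[OF qL Lim]
  have "K * (l2_norm \<mu> a)\<^sup>2 + K * (l2_norm \<mu> b)\<^sup>2 \<le> L"
    by (rule LIMSEQ_le[OF tendsto_add[OF tendsto_mult[OF tendsto_const Parseval_norm[OF aX]]
            tendsto_mult[OF tendsto_const Parseval_norm[OF bX]]] L])
      (intro exI allI impI add_mono resonant_energy_ge K)
  then have "K / 2 * ((l2_norm \<mu> z)\<^sup>2 + (l2_norm \<mu> y1)\<^sup>2) \<le> L"
    using ab by (simp add: distrib_left[symmetric])
  then show ?thesis using pos by (simp add: val pos_le_divide_eq)
qed

text \<open>The resonant energy of \<open>c\<close> is the time mean of a nonnegative function.\<close>

lemma rayleigh_quotients_nonneg: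
  assumes \<omega>: "\<omega> \<in> sets \<mu>" and "r \<in> rayleigh_quotients \<omega>"
  shows "0 \<le> r"
proof -
  obtain c N where r: "r = resonant_energy \<omega> lam c N / (\<Sum>j=1..N. (cmod (c j))\<^sup>2)"
    using assms(2) by (auto simp: rayleigh_quotients_def)
  have "has_time_mean (\<lambda>t. LINT x:\<omega>|\<mu>. (cmod (comb (oscillation lam c (\<lambda>j. 0) t) N x))\<^sup>2)
      (resonant_energy \<omega> lam c N + resonant_energy \<omega> lam (\<lambda>j. 0) N)"
    by (rule has_time_mean_comb[OF \<omega> lam_pos])
  then have "((\<lambda>T. (1 / T) *\<^sub>R (LINT t:{0..T}|lborel.
      (LINT x:\<omega>|\<mu>. (cmod (comb (oscillation lam c (\<lambda>j. 0) t) N x))\<^sup>2))) \<longlongrightarrow> resonant_energy \<omega> lam c N) at_top"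
    by (simp add: has_time_mean_def resonant_energy_0)
  moreover have "\<forall>\<^sub>F T in at_top. 0 \<le> (1 / T) *\<^sub>R (LINT t:{0..T}|lborel.
      (LINT x:\<omega>|\<mu>. (cmod (comb (oscillation lam c (\<lambda>j. 0) t) N x))\<^sup>2))"
    using eventually_gt_at_top[of 0]
  proof eventually_elim
    case (elim T)
    have "0 \<le> (LINT t:{0..T}|lborel.
      (LINT x:\<omega>|\<mu>. (cmod (comb (oscillation lam c (\<lambda>j. 0) t) N x))\<^sup>2))"
      unfolding set_lebesgue_integral_def[of lborel]
      by (intro integral_nonneg_AE AE_I2) (simp add: local_energy_nonneg)
    then show ?case using elim by simp
  qed
  ultimately have "0 \<le> resonant_energy \<omega> lam c N" by (rule tendsto_lowerbound) simp
  then show ?thesis by (simp add: r sum_nonneg)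
qed

lemma local_energy_in_rayleigh:
  assumes j: "j \<ge> 1"
  shows "(LINT x:\<omega>|\<mu>. (\<phi> j x)\<^sup>2) \<in> rayleigh_quotients \<omega>"
proof -
  define c where "c i = (if i = j then 1 else 0 :: complex)" for i
  have sum: "(\<Sum>i=1..j. (cmod (c i))\<^sup>2) = 1"
    using j by (simp add: c_def if_distrib[of cmod] if_distrib[of "\<lambda>x. x\<^sup>2"] cong: if_cong)
  have "(\<Sum>i=1..j. \<Sum>k=1..j. if lam i = lam k then c i * cnj (c k) * gram \<omega> i k else 0)
      = (\<Sum>i=1..j. if i = j then gram \<omega> j j else 0)"
  proof (intro sum.cong refl)
    fix i
    have "(\<Sum>k=1..j. if lam i = lam k then c i * cnj (c k) * gram \<omega> i k else 0)
        = (\<Sum>k=1..j. if k = j then (if i = j then gram \<omega> j j else 0) else 0)"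
      by (intro sum.cong refl) (auto simp: c_def)
    then show "(\<Sum>k=1..j. if lam i = lam k then c i * cnj (c k) * gram \<omega> i k else 0)
        = (if i = j then gram \<omega> j j else 0)" using j by simp
  qed
  also have "\<dots> = gram \<omega> j j" using j by simp
  finally have "resonant_energy \<omega> lam c j = (LINT x:\<omega>|\<mu>. (\<phi> j x)\<^sup>2)"
    by (simp add: resonant_energy_def gram_diag)
  then have "(LINT x:\<omega>|\<mu>. (\<phi> j x)\<^sup>2) = resonant_energy \<omega> lam c j / (\<Sum>i=1..j. (cmod (c i))\<^sup>2)"
    by (simp only: sum div_by_1)
  moreover have "(\<Sum>i=1..j. (cmod (c i))\<^sup>2) \<noteq> 0" unfolding sum by simp
  ultimately show ?thesis
    unfolding rayleigh_quotients_def mem_Collect_eq by (intro exI[of _ c] exI[of _ j] conjI)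
qed

lemma C_schroedinger_eq_rayleigh:
  assumes \<omega>: "\<omega> \<in> sets \<mu>"
  shows "C_schroedinger \<mu> X A \<omega> = Inf (rayleigh_quotients \<omega>)"
proof -
  have ne: "rayleigh_quotients \<omega> \<noteq> {}" using local_energy_in_rayleigh[of 1] by blast
  have bdd: "bdd_below (rayleigh_quotients \<omega>)"
    using rayleigh_quotients_nonneg[OF \<omega>] by (intro bdd_belowI[of _ 0])
  note sub = rayleigh_subset_schroedinger[OF \<omega>]
  have ge: "Inf (rayleigh_quotients \<omega>) \<le> q" if "q \<in> schroedinger_quotients \<omega>" for q
    by (rule schroedinger_quotients_ge[OF \<omega> _ that]) (rule cInf_lower[OF _ bdd])
  have "Inf (schroedinger_quotients \<omega>) = Inf (rayleigh_quotients \<omega>)"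
  proof (rule antisym)
    show "Inf (schroedinger_quotients \<omega>) \<le> Inf (rayleigh_quotients \<omega>)"
      using ge by (intro cInf_superset_mono ne sub bdd_belowI)
    show "Inf (rayleigh_quotients \<omega>) \<le> Inf (schroedinger_quotients \<omega>)"
      using ge ne sub by (intro cInf_greatest) auto
  qed
  then show ?thesis by (simp add: C_schroedinger_def schroedinger_quotients_def)
qed

lemma C_wave_eq_half_rayleigh:
  assumes \<omega>: "\<omega> \<in> sets \<mu>"
  shows "2 * C_wave \<mu> X A \<omega> = Inf (rayleigh_quotients \<omega>)"
proof -
  have ne: "rayleigh_quotients \<omega> \<noteq> {}" using local_energy_in_rayleigh[of 1] by blast
  have bdd: "bdd_below (rayleigh_quotients \<omega>)"
    using rayleigh_quotients_nonneg[OF \<omega>] by (intro bdd_belowI[of _ 0])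
  note sub = rayleigh_half_subset_wave[OF \<omega>]
  have ge: "Inf (rayleigh_quotients \<omega>) / 2 \<le> q" if "q \<in> wave_quotients \<omega>" for q
    by (rule wave_quotients_ge[OF \<omega> _ that]) (rule cInf_lower[OF _ bdd])
  have "2 * Inf (wave_quotients \<omega>) = Inf (rayleigh_quotients \<omega>)"
  proof (rule antisym)
    show "2 * Inf (wave_quotients \<omega>) \<le> Inf (rayleigh_quotients \<omega>)"
    proof (rule cInf_greatest[OF ne])
      fix r assume "r \<in> rayleigh_quotients \<omega>"
      then have "Inf (wave_quotients \<omega>) \<le> r / 2" using ge by (intro cInf_lower sub bdd_belowI)
      then show "2 * Inf (wave_quotients \<omega>) \<le> r" by simp
    qed
    have "Inf (rayleigh_quotients \<omega>) / 2 \<le> Inf (wave_quotients \<omega>)"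
      using ge ne sub by (intro cInf_greatest) auto
    then show "Inf (rayleigh_quotients \<omega>) \<le> 2 * Inf (wave_quotients \<omega>)" by simp
  qed
  then show ?thesis by (simp add: C_wave_def wave_quotients_def)
qed

lemma rayleigh_le_J:
  assumes \<omega>: "\<omega> \<in> sets \<mu>"
  shows "Inf (rayleigh_quotients \<omega>) \<le> J_functional \<mu> \<phi> \<omega>"
  unfolding J_functional_def
proof (rule cINF_greatest)
  fix j :: nat assume "j \<in> {1..}"
  then show "Inf (rayleigh_quotients \<omega>) \<le> (LINT x:\<omega>|\<mu>. (\<phi> j x)\<^sup>2)"
    using rayleigh_quotients_nonneg[OF \<omega>]
    by (intro cInf_lower local_energy_in_rayleigh bdd_belowI[of _ 0]) auto
qed auto

text \<open>Eigenfunctions with equal eigenvalues would be proportional and orthogonal.\<close>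

lemma lam_inj_if_simple:
  assumes simple: "simple_eigenvalues \<mu> A" and ij: "i \<ge> 1" "j \<ge> 1" and eq: "lam i = lam j"
  shows "i = j"
proof (rule ccontr)
  assume "i \<noteq> j"
  define k where "k = complex_of_real ((lam i)\<^sup>2)"
  have "(e i, \<lambda>x. k * e i x) \<in> A" "(e j, \<lambda>x. k * e j x) \<in> A"
    using eigen[OF ij(1)] eigen[OF ij(2)] by (simp_all add: k_def eq)
  moreover have "\<not> (AE x in \<mu>. e i x = 0)"
    using norm_e[OF ij(1)] l2_norm_eq_0_iff[OF e_L2[OF ij(1)]] by simp
  ultimately obtain a where a: "AE x in \<mu>. e j x = a * e i x"
    using simple unfolding simple_eigenvalues_def by blast
  have "coef (e j) j = coef (\<lambda>x. a * e i x) j"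
    by (intro coef_cong_AE a ij e_L2 X_L2 X_mult e_X)
  also have "\<dots> = a * coef (e i) j" by (intro coef_mult e_L2 ij)
  finally show False using ij \<open>i \<noteq> j\<close> by (simp add: coef_e)
qed

lemma J_le_rayleigh_if_simple:
  assumes \<omega>: "\<omega> \<in> sets \<mu>" and simple: "simple_eigenvalues \<mu> A"
  shows "J_functional \<mu> \<phi> \<omega> \<le> Inf (rayleigh_quotients \<omega>)"
proof (rule cInf_greatest)
  show "rayleigh_quotients \<omega> \<noteq> {}" using local_energy_in_rayleigh[of 1] by blast
  fix r assume "r \<in> rayleigh_quotients \<omega>"
  then obtain c N where r: "r = resonant_energy \<omega> lam c N / (\<Sum>j=1..N. (cmod (c j))\<^sup>2)"
    and nz: "(\<Sum>j=1..N. (cmod (c j))\<^sup>2) \<noteq> 0"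
    by (auto simp: rayleigh_quotients_def)
  define G where "G j = (LINT x:\<omega>|\<mu>. (\<phi> j x)\<^sup>2)" for j
  have J: "J_functional \<mu> \<phi> \<omega> \<le> G j" if "j \<ge> 1" for j
    unfolding J_functional_def G_def
    by (rule cINF_lower) (use that in \<open>auto intro!: bdd_belowI2[of _ 0] simp: set_lebesgue_integral_def\<close>)
  have "(\<Sum>i=1..N. \<Sum>j=1..N. if lam i = lam j then c i * cnj (c j) * gram \<omega> i j else 0)
      = (\<Sum>i=1..N. complex_of_real ((cmod (c i))\<^sup>2 * G i))"
  proof (rule sum.cong[OF refl])
    fix i assume i: "i \<in> {1..N}"
    have "(\<Sum>j=1..N. if lam i = lam j then c i * cnj (c j) * gram \<omega> i j else 0)
        = (\<Sum>j=1..N. if i = j then c j * cnj (c j) * gram \<omega> j j else 0)"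
      using i lam_inj_if_simple[OF simple, of i] by (intro sum.cong refl) auto
    also have "\<dots> = c i * cnj (c i) * gram \<omega> i i" using i by simp
    also have "\<dots> = complex_of_real ((cmod (c i))\<^sup>2 * G i)"
      by (simp only: gram_diag G_def of_real_mult complex_norm_square)
    finally show "(\<Sum>j=1..N. if lam i = lam j then c i * cnj (c j) * gram \<omega> i j else 0)
        = complex_of_real ((cmod (c i))\<^sup>2 * G i)" .
  qed
  then have "resonant_energy \<omega> lam c N = (\<Sum>i=1..N. (cmod (c i))\<^sup>2 * G i)"
    by (simp only: resonant_energy_def Re_sum Re_complex_of_real)
  also have "\<dots> \<ge> (\<Sum>i=1..N. (cmod (c i))\<^sup>2 * J_functional \<mu> \<phi> \<omega>)"
    by (intro sum_mono mult_left_mono J) auto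
  finally have "(\<Sum>i=1..N. (cmod (c i))\<^sup>2) * J_functional \<mu> \<phi> \<omega> \<le> resonant_energy \<omega> lam c N"
    by (simp only: sum_distrib_right)
  moreover have "(\<Sum>j=1..N. (cmod (c j))\<^sup>2) > 0" using nz by (simp add: sum_nonneg order_less_le)
  ultimately show "J_functional \<mu> \<phi> \<omega> \<le> r" by (simp add: r pos_le_divide_eq mult.commute)
qed

end

theorem corollary1:
  fixes M :: "('m::{t2_space,second_countable_topology}, 'n::finite) riem"
    and V :: "'m measure" and \<Omega> :: "'m set" and b :: "'m bc"
    and \<phi> :: "nat \<Rightarrow> 'm \<Rightarrow> real" and lam :: "nat \<Rightarrow> real"
  defines "\<mu> \<equiv> domain_measure V \<Omega>"
    and "X \<equiv> state_space V \<Omega> b"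
    and "A \<equiv> laplacian_op M V \<Omega> b"
  assumes "smooth_riemannian_manifold M" and "riem_volume M V"
    and "riem_domain M \<Omega>" and "admissible_bc M \<Omega> b"
    and "positive_selfadjoint \<mu> X A"
    and "hilbert_basis \<mu> X (\<lambda>j x. complex_of_real (\<phi> j x))"
    and "\<And>j. j \<ge> 1 \<Longrightarrow> lam j > 0"
    and "\<And>j. j \<ge> 1 \<Longrightarrow>
           (\<lambda>x. complex_of_real (\<phi> j x), \<lambda>x. complex_of_real ((lam j)\<^sup>2 * \<phi> j x)) \<in> A"
  shows "(\<forall>\<omega>\<in>sets \<mu>. 2 * C_wave \<mu> X A \<omega> = C_schroedinger \<mu> X A \<omega> \<and>
            C_schroedinger \<mu> X A \<omega> \<le> J_functional \<mu> \<phi> \<omega>) \<and>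
         (simple_eigenvalues \<mu> A \<longrightarrow>
           (\<forall>\<omega>\<in>sets \<mu>. 2 * C_wave \<mu> X A \<omega> = C_schroedinger \<mu> X A \<omega> \<and>
              C_schroedinger \<mu> X A \<omega> = (INF j\<in>{1..}. LINT x:\<omega>|\<mu>. (\<phi> j x)\<^sup>2) \<and>
              (INF j\<in>{1..}. LINT x:\<omega>|\<mu>. (\<phi> j x)\<^sup>2) = J_functional \<mu> \<phi> \<omega>))"
proof -
  interpret laplacian_eigenbasis \<mu> X \<phi> A lam
    using assms(8-11) by unfold_locales (auto simp: positive_selfadjoint_def)
  have "2 * C_wave \<mu> X A \<omega> = C_schroedinger \<mu> X A \<omega>" "C_schroedinger \<mu> X A \<omega> \<le> J_functional \<mu> \<phi> \<omega>"
    if "\<omega> \<in> sets \<mu>" for \<omega>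
    using C_wave_eq_half_rayleigh[OF that] C_schroedinger_eq_rayleigh[OF that] rayleigh_le_J[OF that]
    by simp_all
  moreover have "C_schroedinger \<mu> X A \<omega> = J_functional \<mu> \<phi> \<omega>"
    if "simple_eigenvalues \<mu> A" "\<omega> \<in> sets \<mu>" for \<omega>
    using C_schroedinger_eq_rayleigh[OF that(2)] rayleigh_le_J[OF that(2)]
      J_le_rayleigh_if_simple[OF that(2,1)] by simp
  ultimately show ?thesis unfolding J_functional_def by blast
qed

end
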